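(* Fix a finite relational language $L$ with all relation symbols of arity at least $2$ and $\overline\alpha:L\to(0,1)\cap\mathbb{Q}$. Let $\mathfrak{M},\mathfrak{N}$ be countable models of $S_{\overline\alpha}$. If $\dim(\mathfrak{M})\leq\dim(\mathfrak{N})$, then there is an elementary embedding $f:\mathfrak{M}\to\mathfrak{N}$. Consequently there is an elementary chain $\mathfrak{M}_0\preccurlyeq\mathfrak{M}_1\preccurlyeq\cdots\preccurlyeq\mathfrak{M}_n\preccurlyeq\cdots\preccurlyeq\mathfrak{M}_\omega$ of countable models of $S_{\overline\alpha}$ such that every countable model of $S_{\overline\alpha}$ is isomorphic to some member of the chain.
   Context: $K_L$ is the class of finite $L$-structures (including the empty one) with all relations symmetric and irreflexive. For $\mathfrak{A}\in K_L$, $\delta(\mathfrak{A})=|A|-\sum_{E\in L}\overline\alpha(E)N_E(\mathfrak{A})$, where $N_E(\mathfrak{A})$ is the number of subsets of $A$ on which $E$ holds. $K_{\overline\alpha}=\{\mathfrak{A}\in K_L:\delta(\mathfrak{A}')\geq0\text{ for all }\mathfrak{A}'\subseteq\mathfrak{A}\}$. For $\mathfrak{A}\subseteq\mathfrak{B}$, $\mathfrak{A}\leq\mathfrak{B}$ means $\delta(\mathfrak{A})\leq\delta(\mathfrak{A}')$ for all $\mathfrak{A}\subseteq\mathfrak{A}'\subseteq\mathfrak{B}$; $\delta(\mathfrak{B}/\mathfrak{A})=\delta(\mathfrak{B})-\delta(\mathfrak{A})$; for infinite $\mathfrak{M}$ and finite $\mathfrak{A}\subseteq\mathfrak{M}$,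 $\mathfrak{A}\leq\mathfrak{M}$ means $\mathfrak{A}\leq\mathfrak{B}$ for all finite $\mathfrak{A}\subseteq\mathfrak{B}\subseteq\mathfrak{M}$. $S_{\overline\alpha}$ is the complete theory axiomatized by: every finite substructure lies in $K_{\overline\alpha}$, and for all $\mathfrak{A}\leq\mathfrak{B}$ in $K_{\overline\alpha}$ every embedding of $\mathfrak{A}$ into the model extends to an embedding of $\mathfrak{B}$ (it is the theory of the Fraïssé-type generic for $(K_{\overline\alpha},\leq)$). For $\mathfrak{M}\models S_{\overline\alpha}$, $\dim(\mathfrak{M})=\max\{\delta(\mathfrak{B}):\mathfrak{B}\leq\mathfrak{M},\ B\text{ finite}\}$, with $\dim(\mathfrak{M})=\infty$ if these values are unbounded. *)

theory Defs
  imports Complex_Main "HOL-Library.Extended_Real" "HOL-Library.Countable_Set" "HOL-Library.Multiset"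
begin

text \<open>A relational language is a set \<open>L\<close> of symbols with an arity function \<open>ar\<close>. What a structure
  assigns to symbols outside \<open>L\<close> is ignored throughout. The empty structure is allowed.\<close>

record ('r, 'a) lstruct =
  univ :: "'a set"
  rel :: "'r \<Rightarrow> 'a list set"

definition lstructure :: "'r set \<Rightarrow> ('r \<Rightarrow> nat) \<Rightarrow> ('r, 'a) lstruct \<Rightarrow> bool" where
  "lstructure L ar M \<longleftrightarrow>
     (\<forall>E\<in>L. \<forall>xs\<in>rel M E. length xs = ar E \<and> set xs \<subseteq> univ M)"

definition substructure :: "'r set \<Rightarrow> ('r, 'a) lstruct \<Rightarrow> ('r, 'a) lstruct \<Rightarrow> bool" where
  "substructure L A B \<longleftrightarrow>
     univ A \<subseteq> univ B \<and> (\<forall>E\<in>L. rel A E = {xs \<in> rel B E. set xs \<subseteq> univ A})"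

definition embedding ::
  "'r set \<Rightarrow> ('a \<Rightarrow> 'b) \<Rightarrow> ('r, 'a) lstruct \<Rightarrow> ('r, 'b) lstruct \<Rightarrow> bool" where
  "embedding L f A B \<longleftrightarrow>
     inj_on f (univ A) \<and> f ` univ A \<subseteq> univ B \<and>
     (\<forall>E\<in>L. \<forall>xs. set xs \<subseteq> univ A \<longrightarrow> (xs \<in> rel A E \<longleftrightarrow> map f xs \<in> rel B E))"

definition isomorphic :: "'r set \<Rightarrow> ('r, 'a) lstruct \<Rightarrow> ('r, 'b) lstruct \<Rightarrow> bool" where
  "isomorphic L A B \<longleftrightarrow> (\<exists>f. embedding L f A B \<and> f ` univ A = univ B)"

subsection \<open>First-order logic with equality\<close>

datatype 'r fm =
    Eq nat nat
  | Rel 'r "nat list"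
  | Neg "'r fm"
  | Conj "'r fm" "'r fm"
  | Exi nat "'r fm"

primrec lformula :: "'r set \<Rightarrow> ('r \<Rightarrow> nat) \<Rightarrow> 'r fm \<Rightarrow> bool" where
  "lformula L ar (Eq i j) \<longleftrightarrow> True"
| "lformula L ar (Rel E is) \<longleftrightarrow> E \<in> L \<and> length is = ar E"
| "lformula L ar (Neg p) \<longleftrightarrow> lformula L ar p"
| "lformula L ar (Conj p q) \<longleftrightarrow> lformula L ar p \<and> lformula L ar q"
| "lformula L ar (Exi i p) \<longleftrightarrow> lformula L ar p"

primrec sat :: "('r, 'a) lstruct \<Rightarrow> (nat \<Rightarrow> 'a) \<Rightarrow> 'r fm \<Rightarrow> bool" where
  "sat M v (Eq i j) \<longleftrightarrow> v i = v j"
| "sat M v (Rel E is) \<longleftrightarrow> map v is \<in> rel M E"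
| "sat M v (Neg p) \<longleftrightarrow> \<not> sat M v p"
| "sat M v (Conj p q) \<longleftrightarrow> sat M v p \<and> sat M v q"
| "sat M v (Exi i p) \<longleftrightarrow> (\<exists>a\<in>univ M. sat M (v(i := a)) p)"

text \<open>Valuations are total, so this is the usual notion for nonempty \<open>M\<close>; models of
  \<open>S\<^sub>\<alpha>\<close> are always infinite. Injectivity of \<open>f\<close> comes from the formulas \<open>Eq i j\<close>.\<close>

definition elementary_embedding ::
  "'r set \<Rightarrow> ('r \<Rightarrow> nat) \<Rightarrow> ('a \<Rightarrow> 'b) \<Rightarrow> ('r, 'a) lstruct \<Rightarrow> ('r, 'b) lstruct \<Rightarrow> bool" where
  "elementary_embedding L ar f M N \<longleftrightarrow>
     f ` univ M \<subseteq> univ N \<and>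
     (\<forall>p v. lformula L ar p \<longrightarrow> range v \<subseteq> univ M \<longrightarrow> (sat M v p \<longleftrightarrow> sat N (f \<circ> v) p))"

definition elementary_substructure ::
  "'r set \<Rightarrow> ('r \<Rightarrow> nat) \<Rightarrow> ('r, 'a) lstruct \<Rightarrow> ('r, 'a) lstruct \<Rightarrow> bool" where
  "elementary_substructure L ar M N \<longleftrightarrow>
     substructure L M N \<and> elementary_embedding L ar (\<lambda>x. x) M N"

subsection \<open>The class \<open>K\<^sub>\<alpha>\<close> and the theory \<open>S\<^sub>\<alpha>\<close>\<close>

text \<open>Irreflexive means that a relation holds only of tuples of pairwise distinct elements;
  symmetric means closed under all permutations of the tuple.\<close>

definition K_L :: "'r set \<Rightarrow> ('r \<Rightarrow> nat) \<Rightarrow> ('r, 'a) lstruct set" where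
  "K_L L ar = {A. lstructure L ar A \<and> finite (univ A) \<and>
     (\<forall>E\<in>L. \<forall>xs\<in>rel A E. distinct xs \<and> (\<forall>ys. mset ys = mset xs \<longrightarrow> ys \<in> rel A E))}"

definition num_edges :: "'r \<Rightarrow> ('r, 'a) lstruct \<Rightarrow> nat" where
  "num_edges E A = card {X. X \<subseteq> univ A \<and> (\<exists>xs\<in>rel A E. set xs = X)}"

definition delta :: "'r set \<Rightarrow> ('r \<Rightarrow> real) \<Rightarrow> ('r, 'a) lstruct \<Rightarrow> real" where
  "delta L \<alpha> A = real (card (univ A)) - (\<Sum>E\<in>L. \<alpha> E * real (num_edges E A))"

definition K_alpha :: "'r set \<Rightarrow> ('r \<Rightarrow> nat) \<Rightarrow> ('r \<Rightarrow> real) \<Rightarrow> ('r, 'a) lstruct set" where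
  "K_alpha L ar \<alpha> = {A \<in> K_L L ar. \<forall>A'. substructure L A' A \<longrightarrow> delta L \<alpha> A' \<ge> 0}"

definition strong ::
  "'r set \<Rightarrow> ('r \<Rightarrow> real) \<Rightarrow> ('r, 'a) lstruct \<Rightarrow> ('r, 'a) lstruct \<Rightarrow> bool" where
  "strong L \<alpha> A B \<longleftrightarrow> substructure L A B \<and>
     (\<forall>A'. substructure L A A' \<and> substructure L A' B \<longrightarrow> delta L \<alpha> A \<le> delta L \<alpha> A')"

definition strong_inf ::
  "'r set \<Rightarrow> ('r \<Rightarrow> real) \<Rightarrow> ('r, 'a) lstruct \<Rightarrow> ('r, 'a) lstruct \<Rightarrow> bool" where
  "strong_inf L \<alpha> A M \<longleftrightarrow> finite (univ A) \<and> substructure L A M \<and>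
     (\<forall>B. finite (univ B) \<and> substructure L A B \<and> substructure L B M \<longrightarrow> strong L \<alpha> A B)"

text \<open>The pairs \<open>A \<le> B\<close> in \<open>K\<^sub>\<alpha>\<close> range over structures on sets of natural numbers, which
  represent all isomorphism types of finite structures.\<close>

definition model_S ::
  "'r set \<Rightarrow> ('r \<Rightarrow> nat) \<Rightarrow> ('r \<Rightarrow> real) \<Rightarrow> ('r, 'a) lstruct \<Rightarrow> bool" where
  "model_S L ar \<alpha> M \<longleftrightarrow> lstructure L ar M \<and>
     (\<forall>A. finite (univ A) \<and> substructure L A M \<longrightarrow> A \<in> K_alpha L ar \<alpha>) \<and>
     (\<forall>(A :: ('r, nat) lstruct) B f.
        A \<in> K_alpha L ar \<alpha> \<and> B \<in> K_alpha L ar \<alpha> \<and> strong L \<alpha> A B \<and> embedding L f A M \<longrightarrow>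
        (\<exists>g. embedding L g B M \<and> (\<forall>x\<in>univ A. g x = f x)))"

definition countable_model_S ::
  "'r set \<Rightarrow> ('r \<Rightarrow> nat) \<Rightarrow> ('r \<Rightarrow> real) \<Rightarrow> ('r, 'a) lstruct \<Rightarrow> bool" where
  "countable_model_S L ar \<alpha> M \<longleftrightarrow> model_S L ar \<alpha> M \<and> countable (univ M)"

text \<open>For finite \<open>L\<close> and rational \<open>\<alpha>\<close> the values of \<open>delta\<close> lie in a discrete set \<open>(1/c)\<int>\<close>, and
  the empty structure is strong in any model, so the maximum exists in the bounded case.\<close>

definition dim_values :: "'r set \<Rightarrow> ('r \<Rightarrow> real) \<Rightarrow> ('r, 'a) lstruct \<Rightarrow> real set" where
  "dim_values L \<alpha> M = {delta L \<alpha> B | B. strong_inf L \<alpha> B M}"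

definition dimension :: "'r set \<Rightarrow> ('r \<Rightarrow> real) \<Rightarrow> ('r, 'a) lstruct \<Rightarrow> ereal" where
  "dimension L \<alpha> M =
     (if bdd_above (dim_values L \<alpha> M) then ereal (GREATEST d. d \<in> dim_values L \<alpha> M) else \<infinity>)"

end

theory Submission imports Defs begin

text \<open>
  With rational weights the predimension is discrete: after multiplication by a common denominator
  it takes integer values. If \<open>L \<noteq> {}\<close>, a finite structure can therefore be extended, by attaching
  long gadgets each of which costs exactly one unit, until its predimension over a strong subset
  is \<open>0\<close>; the gadgets are so long that no small piece of one is noticed. A copy of such a
  zero-extension over a strong set is automatically strong, also in a model of finite dimension.

  This makes the Ehrenfeucht--Fraisse game between two models winnable as long as the chosen
  tuples sit in copies that are strong up to a sufficient size, so every embedding that preserves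
  strong sets is elementary. Such embeddings are built by a back-and-forth construction in which
  a strong set can be extended in the target exactly because the target has a strong set
  of at least the same predimension; if each of the two models bounds the dimension of the other,
  the construction yields an isomorphism. Finally, in a generic model of infinite dimension take an increasing
  sequence of strong sets of predimension \<open>n\<close> and form their d-closures: these are the
  models of the finite dimensions, and they form the chain.
\<close>

subsection \<open>Substructures, embeddings and the predimension\<close>

text \<open>The axioms extend an embedding of A to B but promise no strongness of the image, and in
  a model of finite dimension some images cannot be strong. Over a strong set only an extension of
  relative predimension 0 is forced to have a strong image, so structures are padded out to such
  extensions before they are embedded. The padding rests on a Bezout identity: over the least common
  denominator c, the numerators and c have no common divisor, so some list of edges weighs exactly
  one unit more than n points. These edges must be laid out so that no proper part of the gadget is
  overweight; this is shown by assigning the units of weight to points, with the single surplus unit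
  sent to whichever point is missing. A gadget hangs on two base points because two strong sets, the
  structure to be embedded and the part already placed, must survive the padding together. Gadgets
  must exceed any prescribed length because a formula controls only extensions of bounded size. The
  empty language has no gadgets and is treated apart: its countable models are the countably
  infinite pure sets.\<close>

definition hedges :: "('r, 'a) lstruct \<Rightarrow> 'r \<Rightarrow> 'a set \<Rightarrow> 'a set set" where
  "hedges M E X = {Y. Y \<subseteq> X \<and> (\<exists>xs\<in>rel M E. set xs = Y)}"

definition induced :: "('r, 'a) lstruct \<Rightarrow> 'a set \<Rightarrow> ('r, 'a) lstruct" where
  "induced M X = \<lparr>univ = X, rel = \<lambda>E. {xs \<in> rel M E. set xs \<subseteq> X}\<rparr>"

lemma univ_induced [simp]: "univ (induced M X) = X"
  by (simp add: induced_def)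

lemma rel_induced: "rel (induced M X) E = {xs \<in> rel M E. set xs \<subseteq> X}"
  by (simp add: induced_def)

lemma hedgesI: "xs \<in> rel M E \<Longrightarrow> set xs \<subseteq> X \<Longrightarrow> set xs \<in> hedges M E X"
  unfolding hedges_def by blast

lemma hedges_induced: "X \<subseteq> Y \<Longrightarrow> hedges (induced M Y) E X = hedges M E X"
  unfolding hedges_def rel_induced by blast

lemma finite_hedges: "finite X \<Longrightarrow> finite (hedges M E X)"
  by (rule finite_subset[of _ "Pow X"]) (auto simp: hedges_def)

lemma hedges_Int: "hedges M E (X \<inter> Y) = hedges M E X \<inter> hedges M E Y"
  by (auto simp: hedges_def)

lemma num_edges_hedges: "num_edges E M = card (hedges M E (univ M))"
  by (simp add: num_edges_def hedges_def)

lemma hedges_substructure: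
  assumes "substructure L A B" "E \<in> L" "X \<subseteq> univ A"
  shows "hedges A E X = hedges B E X"
  using assms unfolding hedges_def substructure_def by (auto 0 4)

lemma substructure_induced: "X \<subseteq> univ M \<Longrightarrow> substructure L (induced M X) M"
  by (simp add: substructure_def rel_induced)

lemma substructure_refl: "lstructure L ar M \<Longrightarrow> substructure L M M"
  by (auto simp: substructure_def lstructure_def)

lemma substructure_trans: "substructure L A B \<Longrightarrow> substructure L B C \<Longrightarrow> substructure L A C"
  by (auto simp: substructure_def)

lemma substructure_mid:
  "substructure L A C \<Longrightarrow> substructure L B C \<Longrightarrow> univ A \<subseteq> univ B \<Longrightarrow> substructure L A B"
  by (auto simp: substructure_def)

lemma embedding_substructure: "substructure L A B \<Longrightarrow> embedding L (\<lambda>x. x) A B"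
  by (auto simp: substructure_def embedding_def)

lemma embedding_comp:
  assumes "embedding L f A B" "embedding L g B C"
  shows "embedding L (g \<circ> f) A C"
proof -
  have "xs \<in> rel A E \<longleftrightarrow> map (g \<circ> f) xs \<in> rel C E" if "E \<in> L" "set xs \<subseteq> univ A" for E xs
  proof -
    have "set (map f xs) \<subseteq> univ B" using that assms by (auto simp: embedding_def)
    then show ?thesis using that assms unfolding embedding_def by (metis map_map)
  qed
  moreover have "inj_on (g \<circ> f) (univ A)"
    using assms unfolding embedding_def by (meson comp_inj_on inj_on_subset)
  moreover have "(g \<circ> f) ` univ A \<subseteq> univ C"
    using assms unfolding embedding_def by fastforce
  ultimately show ?thesis unfolding embedding_def by blast
qed

lemma embedding_restrict:
  assumes "embedding L f A B" "substructure L A' A"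
  shows "embedding L f A' B"
  using embedding_comp[OF embedding_substructure[OF assms(2)] assms(1)] by (simp add: comp_def)

lemma embedding_into:
  assumes "embedding L f A B" "f ` univ A \<subseteq> univ B'" "substructure L B' B"
  shows "embedding L f A B'"
  unfolding embedding_def
proof (intro conjI ballI allI impI)
  show "inj_on f (univ A)" "f ` univ A \<subseteq> univ B'" using assms by (auto simp: embedding_def)
  fix E xs assume *: "E \<in> L" "set xs \<subseteq> univ A"
  then have "set (map f xs) \<subseteq> univ B'" using assms by auto
  then show "xs \<in> rel A E \<longleftrightarrow> map f xs \<in> rel B' E"
    using * assms by (auto simp: embedding_def substructure_def)
qed

lemma embedding_inverse:
  assumes e: "embedding L f A B" and X: "X \<subseteq> univ A"
  shows "embedding L (inv_into X f) (induced B (f ` X)) (induced A X)"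
proof -
  have inj: "inj_on f X" using e X by (meson embedding_def inj_on_subset)
  have "ys \<in> rel B E \<longleftrightarrow> map (inv_into X f) ys \<in> rel A E"
    if "E \<in> L" "set ys \<subseteq> f ` X" for E ys
  proof -
    have "set (map (inv_into X f) ys) \<subseteq> univ A"
      using that X by (force intro: inv_into_into)
    then have "map (inv_into X f) ys \<in> rel A E \<longleftrightarrow> map f (map (inv_into X f) ys) \<in> rel B E"
      using e that unfolding embedding_def by blast
    moreover have "map f (map (inv_into X f) ys) = ys"
      using that by (auto simp: f_inv_into_f subset_iff intro!: map_idI)
    ultimately show ?thesis by simp
  qed
  moreover have "set (map (inv_into X f) ys) \<subseteq> X" if "set ys \<subseteq> f ` X" for ys
    using that by (auto simp: inv_into_into subset_iff)
  ultimately show ?thesis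
    by (auto simp: embedding_def rel_induced inj_on_inv_into inv_into_into)
qed

lemma hedges_embedding:
  assumes e: "embedding L f A B" and E: "E \<in> L" and X: "X \<subseteq> univ A"
  shows "hedges B E (f ` X) = (`) f ` hedges A E X"
proof (intro equalityI subsetI)
  fix Y assume "Y \<in> hedges B E (f ` X)"
  then obtain ys where ys: "Y \<subseteq> f ` X" "ys \<in> rel B E" "set ys = Y" by (auto simp: hedges_def)
  let ?xs = "map (inv_into X f) ys"
  have s: "set ?xs \<subseteq> X" using ys by (auto simp: inv_into_into)
  have m: "map f ?xs = ys" using ys by (auto simp: f_inv_into_f subset_iff intro!: map_idI)
  have "?xs \<in> rel A E" using e E X s m ys unfolding embedding_def by (metis order_trans)
  then have "set ?xs \<in> hedges A E X" using s by (rule hedgesI)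
  moreover have "Y = f ` set ?xs" using m ys by (metis set_map)
  ultimately show "Y \<in> (`) f ` hedges A E X" by blast
next
  fix Y assume "Y \<in> (`) f ` hedges A E X"
  then obtain xs where xs: "xs \<in> rel A E" "set xs \<subseteq> X" "Y = f ` set xs" by (auto simp: hedges_def)
  have "map f xs \<in> rel B E" using e E xs X unfolding embedding_def by (metis order_trans)
  then show "Y \<in> hedges B E (f ` X)" using xs unfolding hedges_def by (auto intro!: bexI[of _ "map f xs"])
qed

lemma card_hedges_embedding:
  assumes "embedding L f A B" "E \<in> L" "X \<subseteq> univ A"
  shows "card (hedges B E (f ` X)) = card (hedges A E X)"
proof -
  have "inj_on ((`) f) (Pow X)"
    using assms by (meson embedding_def inj_on_image_Pow inj_on_subset)
  then have "inj_on ((`) f) (hedges A E X)"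
    by (rule inj_on_subset) (auto simp: hedges_def)
  then show ?thesis using hedges_embedding[OF assms] by (simp add: card_image)
qed

text \<open>\<open>c\<close> is a common denominator and \<open>P E\<close> the numerator of the
  weight of \<open>E\<close>. \<open>unit_combination\<close> is a Bezout identity with nonnegative
  coefficients: a list of edges weighing one unit more than \<open>n\<close> points, with
  \<open>n\<close> as large as desired. For empty \<open>L\<close> it would be false, hence its
  premise.\<close>

locale rational_weights =
  fixes L :: "'r set" and ar :: "'r \<Rightarrow> nat" and \<alpha> :: "'r \<Rightarrow> real" and c :: nat and P :: "'r \<Rightarrow> nat"
  assumes finite_L: "finite L"
    and ar_ge2: "E \<in> L \<Longrightarrow> ar E \<ge> 2"
    and c_pos: "0 < c"
    and \<alpha>_eq: "E \<in> L \<Longrightarrow> \<alpha> E = real (P E) / real c"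
    and P_pos: "E \<in> L \<Longrightarrow> 0 < P E"
    and P_less: "E \<in> L \<Longrightarrow> P E < c"
    and unit_combination: "L \<noteq> {} \<Longrightarrow> \<exists>n>m. \<exists>es. set es \<subseteq> L \<and> sum_list (map P es) = 1 + n * c"
begin

text \<open>This is \<open>c\<close> times \<open>delta\<close>, so it is an integer and a strict
  inequality is a gap of at least one unit. As a function of the subsets of one fixed structure it
  can be submodular.\<close>

definition predim :: "('r, 'a) lstruct \<Rightarrow> 'a set \<Rightarrow> int" where
  "predim M X = int c * int (card X) - (\<Sum>E\<in>L. int (P E) * int (card (hedges M E X)))"

definition sym_structure :: "('r, 'a) lstruct \<Rightarrow> bool" where
  "sym_structure M \<longleftrightarrow> lstructure L ar M \<and>
     (\<forall>E\<in>L. \<forall>xs\<in>rel M E. distinct xs \<and> (\<forall>ys. mset ys = mset xs \<longrightarrow> ys \<in> rel M E))"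

text \<open>\<open>K_alpha\<close> without finiteness, so that models and their finite parts are
  treated alike.\<close>

definition admissible :: "('r, 'a) lstruct \<Rightarrow> bool" where
  "admissible M \<longleftrightarrow> sym_structure M \<and> (\<forall>X. finite X \<longrightarrow> X \<subseteq> univ M \<longrightarrow> 0 \<le> predim M X)"

definition strong_set :: "('r, 'a) lstruct \<Rightarrow> 'a set \<Rightarrow> bool" where
  "strong_set M X \<longleftrightarrow> finite X \<and> X \<subseteq> univ M \<and>
     (\<forall>Y. finite Y \<longrightarrow> X \<subseteq> Y \<longrightarrow> Y \<subseteq> univ M \<longrightarrow> predim M X \<le> predim M Y)"

text \<open>Strongness quantifies over extensions of every size; bounding the size gives
  approximations that a single formula can control.\<close>

definition strong_upto :: "nat \<Rightarrow> ('r, 'a) lstruct \<Rightarrow> 'a set \<Rightarrow> bool" where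
  "strong_upto k M X \<longleftrightarrow> finite X \<and> X \<subseteq> univ M \<and>
     (\<forall>Y. finite Y \<longrightarrow> X \<subseteq> Y \<longrightarrow> Y \<subseteq> univ M \<longrightarrow> card (Y - X) \<le> k \<longrightarrow> predim M X \<le> predim M Y)"

lemma delta_eq_predim: "delta L \<alpha> M = real_of_int (predim M (univ M)) / real c"
proof -
  have "(\<Sum>E\<in>L. \<alpha> E * real (num_edges E M)) =
        (\<Sum>E\<in>L. real (P E) * real (card (hedges M E (univ M)))) / real c"
    unfolding sum_divide_distrib by (rule sum.cong) (auto simp: \<alpha>_eq num_edges_hedges)
  then show ?thesis using c_pos by (simp add: delta_def predim_def diff_divide_distrib)
qed

lemma predim_substructure:
  assumes "substructure L A B" "X \<subseteq> univ A"
  shows "predim A X = predim B X"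
  unfolding predim_def using hedges_substructure[OF assms(1) _ assms(2)] by simp

lemma predim_induced: "X \<subseteq> Y \<Longrightarrow> predim (induced M Y) X = predim M X"
  by (simp add: predim_def hedges_induced)

lemma delta_substructure:
  "substructure L A M \<Longrightarrow> delta L \<alpha> A = real_of_int (predim M (univ A)) / real c"
  by (simp add: delta_eq_predim predim_substructure)

lemma delta_le_iff:
  assumes "substructure L A M" "substructure L B M"
  shows "delta L \<alpha> A \<le> delta L \<alpha> B \<longleftrightarrow> predim M (univ A) \<le> predim M (univ B)"
  using c_pos by (simp add: delta_substructure[OF assms(1)] delta_substructure[OF assms(2)] divide_le_cancel)

lemma predim_embedding:
  assumes "embedding L f A B" "X \<subseteq> univ A"
  shows "predim B (f ` X) = predim A X"
proof -
  have "inj_on f X" using assms by (meson embedding_def inj_on_subset)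
  then show ?thesis unfolding predim_def
    using card_hedges_embedding[OF assms(1) _ assms(2)] by (simp add: card_image)
qed

text \<open>Cardinality is modular. Edges inside both sets lie inside the intersection, edges inside
  either lie inside the union, and edges that cross from one set to the other only lower the left
  side.\<close>

lemma predim_submodular:
  assumes "finite X" "finite Y"
  shows "predim M (X \<union> Y) + predim M (X \<inter> Y) \<le> predim M X + predim M Y"
proof -
  have "(\<Sum>E\<in>L. int (P E) * int (card (hedges M E X))) + (\<Sum>E\<in>L. int (P E) * int (card (hedges M E Y)))
     \<le> (\<Sum>E\<in>L. int (P E) * int (card (hedges M E (X \<union> Y)))) + (\<Sum>E\<in>L. int (P E) * int (card (hedges M E (X \<inter> Y))))"
    unfolding sum.distrib[symmetric]
  proof (rule sum_mono)
    fix E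
    have "card (hedges M E X) + card (hedges M E Y) =
          card (hedges M E X \<union> hedges M E Y) + card (hedges M E (X \<inter> Y))"
      using card_Un_Int[OF finite_hedges[OF assms(1)] finite_hedges[OF assms(2)]]
      by (simp add: hedges_Int)
    also have "\<dots> \<le> card (hedges M E (X \<union> Y)) + card (hedges M E (X \<inter> Y))"
      using assms by (intro add_mono card_mono finite_hedges) (auto simp: hedges_def)
    finally have "int (card (hedges M E X)) + int (card (hedges M E Y)) \<le>
        int (card (hedges M E (X \<union> Y))) + int (card (hedges M E (X \<inter> Y)))" by linarith
    then have "int (P E) * (int (card (hedges M E X)) + int (card (hedges M E Y))) \<le>
        int (P E) * (int (card (hedges M E (X \<union> Y))) + int (card (hedges M E (X \<inter> Y))))"
      by (intro mult_left_mono) auto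
    then show "int (P E) * int (card (hedges M E X)) + int (P E) * int (card (hedges M E Y)) \<le>
       int (P E) * int (card (hedges M E (X \<union> Y))) + int (P E) * int (card (hedges M E (X \<inter> Y)))"
      by (simp add: distrib_left)
  qed
  moreover have "int (card X) + int (card Y) = int (card (X \<union> Y)) + int (card (X \<inter> Y))"
    using card_Un_Int[OF assms] by linarith
  then have "int c * int (card X) + int c * int (card Y) = int c * int (card (X \<union> Y)) + int c * int (card (X \<inter> Y))"
    by (metis distrib_left)
  ultimately show ?thesis unfolding predim_def by linarith
qed

lemma predim_le_card: "predim M X \<le> int c * int (card X)"
  by (auto simp: predim_def intro!: sum_nonneg)

lemma predim_empty: "sym_structure M \<Longrightarrow> predim M {} = 0"
proof -
  assume s: "sym_structure M"
  have "hedges M E {} = {}" if "E \<in> L" for E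
    using s ar_ge2[OF that] that by (fastforce simp: hedges_def sym_structure_def lstructure_def)
  then show ?thesis by (simp add: predim_def)
qed

lemma sym_structure_substructure:
  assumes "sym_structure M" "substructure L A M"
  shows "sym_structure A"
  unfolding sym_structure_def lstructure_def
proof (intro conjI ballI allI impI)
  fix E xs assume E: "E \<in> L" "xs \<in> rel A E"
  then have xs: "xs \<in> rel M E" "set xs \<subseteq> univ A" using assms(2) by (auto simp: substructure_def)
  then show "length xs = ar E" "set xs \<subseteq> univ A" "distinct xs"
    using assms(1) E by (auto simp: sym_structure_def lstructure_def)
  fix ys assume "mset ys = mset xs"
  then have "set ys = set xs" "ys \<in> rel M E"
    using assms(1) E xs by (metis set_mset_mset, simp add: sym_structure_def)
  then show "ys \<in> rel A E" using assms(2) E xs by (simp add: substructure_def)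
qed

lemma admissible_substructure:
  assumes "admissible M" "substructure L A M" shows "admissible A"
  using assms sym_structure_substructure[of M A] predim_substructure[of A M]
  by (auto simp: admissible_def substructure_def)

lemma admissible_lstructure: "admissible M \<Longrightarrow> lstructure L ar M"
  by (simp add: admissible_def sym_structure_def)

lemma strong_set_empty: "admissible M \<Longrightarrow> strong_set M {}"
  by (auto simp: strong_set_def admissible_def predim_empty)

lemma strong_set_strong_upto: "strong_set M X \<Longrightarrow> strong_upto k M X"
  by (auto simp: strong_set_def strong_upto_def)

lemma strong_upto_all: "(\<And>k. strong_upto k M X) \<Longrightarrow> strong_set M X"
  unfolding strong_set_def strong_upto_def by blast

text \<open>Cut the test set by \<open>Y\<close>: \<open>D \<inter> Y\<close> is tested by
  \<open>X\<close> inside \<open>Y\<close>, and \<open>D \<union> Y\<close> by \<open>Y\<close>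
  inside \<open>M\<close>. Neither adds more points than \<open>D\<close> does, and submodularity
  combines the two inequalities.\<close>

lemma strong_upto_trans:
  assumes X: "strong_upto k (induced M Y) X" and Y: "strong_upto k M Y"
  shows "strong_upto k M X"
  unfolding strong_upto_def
proof (intro conjI allI impI)
  show "finite X" "X \<subseteq> univ M" using X Y by (auto simp: strong_upto_def)
  fix D assume D: "finite D" "X \<subseteq> D" "D \<subseteq> univ M" "card (D - X) \<le> k"
  have XY: "X \<subseteq> Y" and fY: "finite Y" "Y \<subseteq> univ M" using X Y by (auto simp: strong_upto_def)
  have "card (D \<inter> Y - X) \<le> k" using D by (meson card_mono finite_Diff Diff_mono Int_lower1 order_refl order_trans)
  then have 1: "predim M X \<le> predim M (D \<inter> Y)"
    using X D XY fY unfolding strong_upto_def by (simp add: predim_induced)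
  have "card (D \<union> Y - Y) \<le> card (D - X)" using D XY by (intro card_mono) auto
  then have "predim M Y \<le> predim M (D \<union> Y)" using Y D fY unfolding strong_upto_def by (simp add: le_trans)
  with 1 predim_submodular[OF D(1) fY(1), of M] show "predim M X \<le> predim M D" by linarith
qed

lemma strong_upto_induced_strong_set: "strong_set (induced M Y) X \<Longrightarrow> strong_upto k M Y \<Longrightarrow> strong_upto k M X"
  using strong_upto_trans strong_set_strong_upto by blast

lemma strong_set_trans: "strong_set (induced M Y) X \<Longrightarrow> strong_set M Y \<Longrightarrow> strong_set M X"
  using strong_upto_all strong_upto_induced_strong_set strong_set_strong_upto by blast

lemma strong_set_induced: "strong_set M X \<Longrightarrow> X \<subseteq> Y \<Longrightarrow> Y \<subseteq> univ M \<Longrightarrow> strong_set (induced M Y) X"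
  by (auto simp: strong_set_def predim_induced)

text \<open>The source of free strongness: nothing above \<open>Y\<close> falls below the value of
  \<open>X\<close>, which \<open>Y\<close> shares.\<close>

lemma strong_set_same_predim:
  "strong_set M X \<Longrightarrow> X \<subseteq> Y \<Longrightarrow> finite Y \<Longrightarrow> Y \<subseteq> univ M \<Longrightarrow> predim M Y = predim M X \<Longrightarrow> strong_set M Y"
  unfolding strong_set_def by (metis order_trans)

lemma strong_set_substructure:
  assumes "substructure L A B" "strong_set B X" "X \<subseteq> univ A"
  shows "strong_set A X"
  using assms predim_substructure[OF assms(1)] by (auto simp: strong_set_def substructure_def)

text \<open>Extensions inside \<open>A\<close> are carried to extensions inside \<open>B\<close> of
  the same predimension, so \<open>A\<close> has no more tests to offer than
  \<open>B\<close>.\<close>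

lemma strong_set_embedding:
  assumes e: "embedding L f A B" and X: "X \<subseteq> univ A" and s: "strong_set B (f ` X)"
  shows "strong_set A X"
  unfolding strong_set_def
proof (intro conjI allI impI X)
  have "inj_on f X" using e X by (meson embedding_def inj_on_subset)
  then show "finite X" using s by (auto simp: strong_set_def finite_image_iff)
  fix Y assume Y: "finite Y" "X \<subseteq> Y" "Y \<subseteq> univ A"
  then have "predim B (f ` X) \<le> predim B (f ` Y)"
    using s e unfolding strong_set_def embedding_def by (meson finite_imageI image_mono order_trans)
  then show "predim A X \<le> predim A Y" using predim_embedding[OF e] X Y by simp
qed

text \<open>Strongness transfers forward only along isomorphisms, so the image is taken inside the
  substructure on \<open>f ` univ A\<close>.\<close>

lemma strong_set_embedding_image:
  assumes e: "embedding L f A B" and s: "strong_set A X"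
  shows "strong_set (induced B (f ` univ A)) (f ` X)"
  unfolding strong_set_def
proof (intro conjI allI impI)
  show "finite (f ` X)" "f ` X \<subseteq> univ (induced B (f ` univ A))" using s by (auto simp: strong_set_def)
  fix Y assume Y: "finite Y" "f ` X \<subseteq> Y" "Y \<subseteq> univ (induced B (f ` univ A))"
  let ?Z = "inv_into (univ A) f ` Y"
  have inj: "inj_on f (univ A)" using e by (simp add: embedding_def)
  have Z: "?Z \<subseteq> univ A" "f ` ?Z = Y" "finite ?Z"
    using Y by (auto simp: inv_into_into f_inv_into_f image_iff subset_iff)
  have "X \<subseteq> ?Z"
  proof
    fix x assume "x \<in> X"
    then have "f x \<in> Y" "x \<in> univ A" using Y s by (auto simp: strong_set_def)
    then show "x \<in> ?Z" using inj by (metis image_eqI inv_into_f_f)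
  qed
  then have "predim A X \<le> predim A ?Z" using s Z by (auto simp: strong_set_def)
  then have "predim B (f ` X) \<le> predim B Y" using predim_embedding[OF e Z(1)] predim_embedding[OF e, of X] s Z
    by (simp add: strong_set_def)
  then show "predim (induced B (f ` univ A)) (f ` X) \<le> predim (induced B (f ` univ A)) Y"
    using Y s by (simp add: predim_induced)
qed

section \<open>The class, strong pairs, dimension values and axioms in terms of the
  predimension\<close>

lemma K_alpha_iff: "A \<in> K_alpha L ar \<alpha> \<longleftrightarrow> admissible A \<and> finite (univ A)"
proof -
  have "(\<forall>A'. substructure L A' A \<longrightarrow> delta L \<alpha> A' \<ge> 0) \<longleftrightarrow> (\<forall>X. finite X \<longrightarrow> X \<subseteq> univ A \<longrightarrow> 0 \<le> predim A X)"
    if fin: "finite (univ A)"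
  proof (intro iffI allI impI)
    fix X assume *: "\<forall>A'. substructure L A' A \<longrightarrow> delta L \<alpha> A' \<ge> 0" "X \<subseteq> univ A"
    then have "delta L \<alpha> (induced A X) \<ge> 0" using substructure_induced by blast
    then show "0 \<le> predim A X" using c_pos
      by (simp add: delta_substructure[OF substructure_induced[OF *(2)]] zero_le_divide_iff)
  next
    fix A' assume *: "\<forall>X. finite X \<longrightarrow> X \<subseteq> univ A \<longrightarrow> 0 \<le> predim A X" "substructure L A' A"
    then have "0 \<le> predim A (univ A')" using fin by (auto simp: substructure_def intro: finite_subset)
    then show "0 \<le> delta L \<alpha> A'" using c_pos by (simp add: delta_substructure[OF *(2)])
  qed
  then show ?thesis by (auto simp: K_alpha_def K_L_def admissible_def sym_structure_def)
qed

lemma strong_iff: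
  assumes "finite (univ B)"
  shows "strong L \<alpha> A B \<longleftrightarrow> substructure L A B \<and> strong_set B (univ A)"
proof -
  have "(\<forall>A'. substructure L A A' \<and> substructure L A' B \<longrightarrow> delta L \<alpha> A \<le> delta L \<alpha> A') \<longleftrightarrow> strong_set B (univ A)"
    if sub: "substructure L A B"
  proof
    assume *: "\<forall>A'. substructure L A A' \<and> substructure L A' B \<longrightarrow> delta L \<alpha> A \<le> delta L \<alpha> A'"
    show "strong_set B (univ A)" unfolding strong_set_def
    proof (intro conjI allI impI)
      show "univ A \<subseteq> univ B" using sub by (simp add: substructure_def)
      then show "finite (univ A)" using assms finite_subset by blast
      fix Y assume Y: "univ A \<subseteq> Y" "Y \<subseteq> univ B"
      have "substructure L A (induced B Y)"
        using substructure_mid[OF sub substructure_induced[OF Y(2)]] Y by simp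
      then have "delta L \<alpha> A \<le> delta L \<alpha> (induced B Y)" using * substructure_induced[OF Y(2)] by blast
      then show "predim B (univ A) \<le> predim B Y" using delta_le_iff[OF sub substructure_induced[OF Y(2)]] by simp
    qed
  next
    assume s: "strong_set B (univ A)"
    show "\<forall>A'. substructure L A A' \<and> substructure L A' B \<longrightarrow> delta L \<alpha> A \<le> delta L \<alpha> A'"
    proof (intro allI impI)
      fix A' assume A': "substructure L A A' \<and> substructure L A' B"
      then have "predim B (univ A) \<le> predim B (univ A')"
        using s assms unfolding strong_set_def substructure_def by (meson finite_subset)
      then show "delta L \<alpha> A \<le> delta L \<alpha> A'" using A' delta_le_iff[OF sub] by blast
    qed
  qed
  then show ?thesis by (auto simp: strong_def)
qed

lemma strong_inf_iff: "strong_inf L \<alpha> A M \<longleftrightarrow> substructure L A M \<and> strong_set M (univ A)"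
proof
  assume s: "strong_inf L \<alpha> A M"
  then have sub: "substructure L A M" and fin: "finite (univ A)" by (auto simp: strong_inf_def)
  have "predim M (univ A) \<le> predim M Y" if Y: "finite Y" "univ A \<subseteq> Y" "Y \<subseteq> univ M" for Y
  proof -
    have "substructure L A (induced M Y)"
      using substructure_mid[OF sub substructure_induced[OF Y(3)]] Y by simp
    then have "strong L \<alpha> A (induced M Y)"
      using s Y substructure_induced[OF Y(3)] unfolding strong_inf_def by simp
    then show ?thesis using Y by (simp add: strong_iff strong_set_def predim_induced)
  qed
  then show "substructure L A M \<and> strong_set M (univ A)"
    using sub fin by (auto simp: strong_set_def substructure_def)
next
  assume s: "substructure L A M \<and> strong_set M (univ A)"
  have "strong L \<alpha> A B"
    if B: "finite (univ B)" "substructure L A B" "substructure L B M" for B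
    using B s strong_set_substructure[OF B(3)] by (auto simp: strong_iff substructure_def)
  then show "strong_inf L \<alpha> A M" using s by (auto simp: strong_inf_def strong_set_def)
qed

lemma dim_values_eq: "dim_values L \<alpha> M = {real_of_int (predim M X) / real c |X. strong_set M X}"
proof (intro equalityI subsetI)
  fix x assume "x \<in> dim_values L \<alpha> M"
  then show "x \<in> {real_of_int (predim M X) / real c |X. strong_set M X}"
    by (auto simp: dim_values_def strong_inf_iff delta_substructure)
next
  fix x assume "x \<in> {real_of_int (predim M X) / real c |X. strong_set M X}"
  then obtain X where X: "strong_set M X" "x = real_of_int (predim M X) / real c" by auto
  then have "strong_inf L \<alpha> (induced M X) M" by (auto simp: strong_inf_iff substructure_induced strong_set_def)
  moreover have "x = delta L \<alpha> (induced M X)"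
    using X by (simp add: delta_substructure[OF substructure_induced] strong_set_def)
  ultimately show "x \<in> dim_values L \<alpha> M" by (auto simp: dim_values_def)
qed

text \<open>The image of \<open>X\<close> in \<open>M\<close> is not asked to be strong. Since
  \<open>B\<close> lives on natural numbers, whatever is to be embedded is first copied
  there.\<close>

definition extension_property :: "('r, 'a) lstruct \<Rightarrow> bool" where
  "extension_property M \<longleftrightarrow> (\<forall>(B :: ('r, nat) lstruct) X f.
     admissible B \<longrightarrow> finite (univ B) \<longrightarrow> strong_set B X \<longrightarrow> embedding L f (induced B X) M \<longrightarrow>
     (\<exists>g. embedding L g B M \<and> (\<forall>x\<in>X. g x = f x)))"

lemma model_S_iff: "model_S L ar \<alpha> M \<longleftrightarrow> admissible M \<and> extension_property M"
proof
  assume m: "model_S L ar \<alpha> M"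
  have K: "admissible A \<and> finite (univ A)" if "finite (univ A)" "substructure L A M" for A
    using m that by (auto simp: model_S_def K_alpha_iff)
  have "admissible M" unfolding admissible_def sym_structure_def
  proof (intro conjI ballI allI impI)
    show lM: "lstructure L ar M" using m by (simp add: model_S_def)
    fix E xs assume E: "E \<in> L" "xs \<in> rel M E"
    \<comment> \<open>Symmetry and irreflexivity at a tuple are visible in the finite substructure
      on its entries, about which the axioms speak.\<close>
    let ?A = "induced M (set xs)"
    have "set xs \<subseteq> univ M" using lM E by (auto simp: lstructure_def)
    then have "admissible ?A" using K[of ?A] substructure_induced by auto
    moreover have "xs \<in> rel ?A E" using E by (simp add: rel_induced)
    ultimately have *: "distinct xs \<and> (\<forall>ys. mset ys = mset xs \<longrightarrow> ys \<in> rel ?A E)"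
      using E by (auto simp: admissible_def sym_structure_def)
    then show "distinct xs" by simp
    fix ys assume "mset ys = mset xs"
    then show "ys \<in> rel M E" using * by (auto simp: rel_induced)
  next
    fix X assume X: "finite X" "X \<subseteq> univ M"
    then have "admissible (induced M X)" using K[of "induced M X"] substructure_induced by auto
    then have "0 \<le> predim (induced M X) X" using X by (simp add: admissible_def)
    then show "0 \<le> predim M X" by (simp add: predim_induced)
  qed
  moreover have "extension_property M" unfolding extension_property_def
  proof (intro allI impI)
    fix B :: "('r, nat) lstruct" and X f
    assume B: "admissible B" "finite (univ B)" "strong_set B X" "embedding L f (induced B X) M"
    have sub: "substructure L (induced B X) B" using B by (simp add: substructure_induced strong_set_def)
    have "admissible (induced B X)" "finite X" using B sub admissible_substructure by (auto simp: strong_set_def)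
    then have "\<exists>g. embedding L g B M \<and> (\<forall>x\<in>univ (induced B X). g x = f x)"
      using m B sub unfolding model_S_def K_alpha_iff
      by (metis strong_iff univ_induced)
    then show "\<exists>g. embedding L g B M \<and> (\<forall>x\<in>X. g x = f x)" by simp
  qed
  ultimately show "admissible M \<and> extension_property M" by simp
next
  assume m: "admissible M \<and> extension_property M"
  show "model_S L ar \<alpha> M" unfolding model_S_def K_alpha_iff
  proof (intro conjI allI impI)
    show "lstructure L ar M" using m by (simp add: admissible_def sym_structure_def)
    fix A assume "finite (univ A) \<and> substructure L A M"
    then show "admissible A" "finite (univ A)" using m admissible_substructure by auto
  next
    fix A B :: "('r, nat) lstruct" and f
    assume *: "(admissible A \<and> finite (univ A)) \<and> (admissible B \<and> finite (univ B)) \<and> strong L \<alpha> A B \<and> embedding L f A M"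
    then have s: "substructure L A B" "strong_set B (univ A)" by (auto simp: strong_iff)
    have "substructure L (induced B (univ A)) A"
      using substructure_mid[OF substructure_induced s(1)] s by (auto simp: strong_set_def)
    then have "embedding L f (induced B (univ A)) M" using * embedding_restrict by blast
    then show "\<exists>g. embedding L g B M \<and> (\<forall>x\<in>univ A. g x = f x)"
      using m * s unfolding extension_property_def by blast
  qed
qed

end

subsection \<open>Gadgets of relative predimension minus one unit\<close>

lemma mod_add_cancel_nat:
  fixes i x y N :: nat
  assumes "(i + x) mod N = (i + y) mod N" "x < N" "y < N"
  shows "x = y"
proof -
  have *: "x = y" if "(i + x) mod N = (i + y) mod N" "x < N" "y \<le> x" for x y
  proof -
    have "N dvd (i + x) - (i + y)" using that mod_eq_dvd_iff_nat[of "i + y" "i + x" N] by simp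
    then have "N dvd x - y" by simp
    moreover have "x - y < N" using that by simp
    ultimately show ?thesis using that by (metis dvd_imp_le diff_is_0_eq le_antisym not_le not_gr_zero)
  qed
  show ?thesis using *[of x y] *[of y x] assms by (metis nat_le_linear)
qed

text \<open>The shape of a gadget edge: a head \<open>i\<close> and, after a jump \<open>d\<close>,
  a tail of \<open>q\<close> consecutive residues. The head and the start of the tail matter for the
  weights; the jump also tells apart edges with the same head.\<close>

definition cyclic_run :: "nat \<Rightarrow> nat \<Rightarrow> nat \<Rightarrow> nat \<Rightarrow> nat set" where
  "cyclic_run N q i d = insert (i mod N) ((\<lambda>u. (i + d + u) mod N) ` {..<q})"

lemma cyclic_run_subset: "0 < N \<Longrightarrow> cyclic_run N q i d \<subseteq> {..<N}"
  by (auto simp: cyclic_run_def)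

lemma card_cyclic_run:
  assumes "1 \<le> d" "d + q \<le> N"
  shows "card (cyclic_run N q i d) = Suc q"
proof -
  have "inj_on (\<lambda>u. (i + d + u) mod N) {..<q}"
    using assms by (intro inj_onI) (auto dest!: mod_add_cancel_nat)
  moreover have "i mod N \<notin> (\<lambda>u. (i + d + u) mod N) ` {..<q}"
  proof
    assume "i mod N \<in> (\<lambda>u. (i + d + u) mod N) ` {..<q}"
    then obtain u where u: "u < q" "(i + 0) mod N = (i + (d + u)) mod N" by (auto simp: add.assoc)
    then show False using mod_add_cancel_nat[OF u(2)] assms by auto
  qed
  ultimately show ?thesis by (simp add: cyclic_run_def card_image)
qed

text \<open>The run is short compared with \<open>N\<close>, so \<open>i\<close> is the only element of it that is preceded by
  a long gap in the cyclic order.\<close>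

lemma cyclic_run_inject:
  assumes eq: "cyclic_run N q i d = cyclic_run N q i' d'"
    and q: "1 \<le> q" and d: "1 \<le> d" "2 * (d + q) \<le> N" and d': "1 \<le> d'" "2 * (d' + q) \<le> N"
  shows "i mod N = i' mod N \<and> d = d'"
proof -
  have mem: "\<exists>s<e + q. i mod N = (j + s) mod N" if ij: "i mod N \<in> cyclic_run N q j e" for i j e
  proof (cases "i mod N = j mod N")
    case True
    then show ?thesis using q by (intro exI[of _ 0]) simp
  next
    case False
    then obtain u where "u < q" "i mod N = (j + e + u) mod N"
      using ij unfolding cyclic_run_def by auto
    then show ?thesis by (intro exI[of _ "e + u"]) (simp add: add.assoc)
  qed
  have "i' mod N \<in> cyclic_run N q i d" "i mod N \<in> cyclic_run N q i' d'"
    using eq by (auto simp: cyclic_run_def)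
  \<comment> \<open>Each head lies in the run of the other. Going from one to the other and back
    takes \<open>s + s'\<close> steps, which is less than a full turn, so both numbers are
    0.\<close>
  then obtain s s' where s: "s < d + q" "i' mod N = (i + s) mod N"
    and s': "s' < d' + q" "i mod N = (i' + s') mod N" using mem by meson
  have "(i + 0) mod N = (i' mod N + s') mod N" using s' by (simp add: mod_add_left_eq)
  also have "\<dots> = (i + (s + s')) mod N" unfolding s(2) by (simp add: mod_add_left_eq add.assoc)
  finally have eq0: "(i + 0) mod N = (i + (s + s')) mod N" .
  have "0 < N" using d by (cases N) auto
  moreover have "s + s' < N" using s(1) s'(1) d(2) d'(2) by simp
  ultimately have "0 = s + s'" by (rule mod_add_cancel_nat[OF eq0])
  then have "s = 0" by simp
  then have ii: "i mod N = i' mod N" using s by simp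
  have le: "e' \<le> e" if "cyclic_run N q i e = cyclic_run N q i' e'" "i mod N = i' mod N"
    "1 \<le> e" "2 * (e + q) \<le> N" "1 \<le> e'" "2 * (e' + q) \<le> N" for e e' i i'
  proof -
    have "(i + e) mod N \<in> cyclic_run N q i e"
      using q unfolding cyclic_run_def by (auto intro!: image_eqI[of _ _ 0])
    then have "(i + e) mod N \<in> cyclic_run N q i' e'" using that by simp
    moreover have "(i + e) mod N \<noteq> i' mod N"
    proof
      assume "(i + e) mod N = i' mod N"
      then have "(i + e) mod N = (i + 0) mod N" using that by simp
      then show False using mod_add_cancel_nat[of i e N 0] that by auto
    qed
    ultimately obtain u where u: "u < q" "(i + e) mod N = (i' + (e' + u)) mod N"
      unfolding cyclic_run_def by (auto simp: add.assoc)
    have "(i' + (e' + u)) mod N = (i + (e' + u)) mod N" using that(2) by (metis mod_add_left_eq)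
    then show ?thesis using mod_add_cancel_nat[of i e N "e' + u"] u that by auto
  qed
  show ?thesis using le[OF eq ii d d'] le[OF eq[symmetric] ii[symmetric] d' d] ii by auto
qed

text \<open>Tokens \<open>0, \<dots>, n * c\<close> are dealt out in order to the positions \<open>0, \<dots>, n + 1\<close>; every position
  \<open>1, \<dots>, n\<close> receives \<open>c\<close> of them, and the one token in excess goes to position \<open>s\<close>.\<close>

definition token_owner :: "nat \<Rightarrow> nat \<Rightarrow> nat \<Rightarrow> nat" where
  "token_owner c s t = (if t < s * c then t div c + 1 else (t + c - 1) div c)"

lemma ceil_div_bounds:
  fixes a c :: nat
  assumes "0 < c" and i: "i = (a + c - 1) div c"
  shows "a \<le> i * c" "i * c < a + c"
proof -
  have "i * c \<le> a + c - 1" unfolding i by (simp add: div_times_less_eq_dividend)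
  then show "i * c < a + c" using assms by linarith
  have "a + c - 1 < (i + 1) * c"
    unfolding i using dividend_less_div_times[OF assms(1), of "a + c - 1"] by (simp add: add.commute)
  then show "a \<le> i * c" using assms by (simp add: algebra_simps)
qed

text \<open>A position before \<open>s\<close> owns tokens from a block that begins with a multiple
  of \<open>c\<close>, a position after \<open>s\<close> from one that ends with a multiple. The
  change of rounding at token \<open>s * c\<close> is what leaves the surplus to
  \<open>s\<close>.\<close>

lemma token_owner_fibre:
  assumes c: "0 < c" and js: "j \<noteq> s"
  shows "card {t. t < 1 + n * c \<and> token_owner c s t = j} \<le> c"
proof (cases "j < s")
  case True
  have "{t. t < 1 + n * c \<and> token_owner c s t = j} \<subseteq> {(j - 1) * c..<(j - 1) * c + c}"
  proof
    fix t assume "t \<in> {t. t < 1 + n * c \<and> token_owner c s t = j}"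
    then have t: "token_owner c s t = j" by simp
    have "t < s * c"
    proof (rule ccontr)
      assume *: "\<not> t < s * c"
      then have "j = (t + c - 1) div c" using t by (simp add: token_owner_def)
      then have "t \<le> j * c" using ceil_div_bounds[OF c] by blast
      moreover have "j * c < s * c" using True c by simp
      ultimately show False using * by linarith
    qed
    then have "t div c = j - 1" using t by (auto simp: token_owner_def)
    then show "t \<in> {(j - 1) * c..<(j - 1) * c + c}"
      using c div_times_less_eq_dividend[of t c] dividend_less_div_times[OF c, of t] by auto
  qed
  then have "card {t. t < 1 + n * c \<and> token_owner c s t = j} \<le> card {(j - 1) * c..<(j - 1) * c + c}"
    by (intro card_mono) auto
  then show ?thesis by simp
next
  case False
  have "{t. t < 1 + n * c \<and> token_owner c s t = j} \<subseteq> {j * c + 1 - c..<j * c + 1}"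
  proof
    fix t assume "t \<in> {t. t < 1 + n * c \<and> token_owner c s t = j}"
    then have t: "token_owner c s t = j" by simp
    have "\<not> t < s * c"
    proof
      assume *: "t < s * c"
      then have "t div c < s" using c by (simp add: less_mult_imp_div_less)
      then show False using * t False js by (simp add: token_owner_def)
    qed
    then have "j = (t + c - 1) div c" using t by (simp add: token_owner_def)
    from ceil_div_bounds[OF c this] show "t \<in> {j * c + 1 - c..<j * c + 1}" by auto
  qed
  then have "card {t. t < 1 + n * c \<and> token_owner c s t = j} \<le> card {j * c + 1 - c..<j * c + 1}"
    by (intro card_mono) auto
  then show ?thesis by simp
qed

lemma token_owner_range:
  assumes c: "0 < c" and t: "t < 1 + n * c" and s: "s \<le> n + 1" and ne: "token_owner c s t \<noteq> s"
  shows "1 \<le> token_owner c s t \<and> token_owner c s t \<le> n"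
proof (cases "t < s * c")
  case True
  then have "t div c < s" by (simp add: less_mult_imp_div_less)
  then show ?thesis using True s ne unfolding token_owner_def by auto
next
  case False
  define j where "j = (t + c - 1) div c"
  have j: "token_owner c s t = j" using False by (simp add: token_owner_def j_def)
  note b = ceil_div_bounds[OF c j_def]
  have "j \<noteq> 0"
  proof
    assume "j = 0"
    then have "s * c = 0" using b False by simp
    then show False using c ne j \<open>j = 0\<close> by simp
  qed
  moreover have "j * c < (n + 1) * c" using b t by simp
  then have "j < n + 1" using c by (metis mult_less_cancel2)
  ultimately show ?thesis using j by simp
qed

text \<open>Positions 1 to \<open>n\<close> are the new points; 0 and \<open>n + 1\<close> are the
  base points, which coincide modulo \<open>N\<close> when \<open>N = n + 1\<close>. Edge
  \<open>k\<close> has weight \<open>Q k\<close> and arity \<open>r k\<close>. The bound on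
  \<open>r k\<close> keeps a run, jump included, within half of the cycle.\<close>

locale token_line =
  fixes c n N :: nat and Q r :: "nat \<Rightarrow> nat" and l :: nat
  assumes c: "0 < c" and N: "n + 1 \<le> N" "N \<le> n + 2"
    and Q: "\<And>k. k < l \<Longrightarrow> 1 \<le> Q k \<and> Q k \<le> c"
    and Q_sum: "(\<Sum>k<l. Q k) = 1 + n * c"
    and r: "\<And>k. k < l \<Longrightarrow> 2 \<le> r k \<and> 2 * (c + 1 + r k) \<le> n"
begin

text \<open>Edge \<open>k\<close> takes \<open>Q k\<close> consecutive tokens from
  \<open>start k\<close> on. As \<open>Q k \<le> c\<close>, at most one of them is a multiple of
  \<open>c\<close>, and it can only be \<open>pos k * c\<close>. For every choice of
  \<open>s\<close> the owners of these tokens are \<open>pos k\<close> and, if that multiple is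
  among them, possibly \<open>pos k + 1\<close>; the edge has to contain these positions.\<close>

definition start :: "nat \<Rightarrow> nat" where "start k = (\<Sum>j<k. Q j)"
definition pos :: "nat \<Rightarrow> nat" where "pos k = (start k + c - 1) div c"
text \<open>If the multiple of \<open>c\<close> is taken, the jump 1 puts \<open>pos k + 1\<close>
  into the edge. Otherwise the tail is free, and for \<open>k < l\<close> the jump is at least 2 and
  encodes \<open>start k\<close>, which keeps edges with the same head distinct.\<close>

definition gap :: "nat \<Rightarrow> nat" where
  "gap k = (if pos k * c < start k + Q k then 1 else 1 + (pos k * c - start k))"
definition edge :: "nat \<Rightarrow> nat set" where "edge k = cyclic_run N (r k - 1) (pos k) (gap k)"

lemma pos_bounds: "start k \<le> pos k * c" "pos k * c < start k + c"
  using ceil_div_bounds[OF c pos_def] by auto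

lemma start_Suc: "start (Suc k) = start k + Q k"
  by (simp add: start_def)

lemma start_mono: "j \<le> k \<Longrightarrow> start j \<le> start k"
  unfolding start_def by (rule sum_mono2) auto

lemma start_end: "k < l \<Longrightarrow> start k + Q k \<le> 1 + n * c"
  using start_mono[of "Suc k" l] by (simp add: start_Suc Q_sum start_def)

lemma pos_le: assumes "k < l" shows "pos k \<le> n"
proof -
  have "start k \<le> n * c" using start_end[OF assms] Q[OF assms] by linarith
  then have "pos k * c < (n + 1) * c" using pos_bounds(2)[of k] by simp
  then show ?thesis by (metis Suc_eq_plus1 less_Suc_eq_le mult_less_cancel2)
qed

lemma gap_bounds: "1 \<le> gap k \<and> gap k \<le> c + 1"
  using pos_bounds[of k] by (auto simp: gap_def)

lemma gap_run_bound: "k < l \<Longrightarrow> 2 * (gap k + (r k - 1)) \<le> N"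
  using gap_bounds[of k] r[of k] N by auto

lemma card_edge: "k < l \<Longrightarrow> card (edge k) = r k"
  unfolding edge_def using card_cyclic_run[of "gap k" "r k - 1" N "pos k"] gap_bounds[of k] gap_run_bound[of k] r[of k]
  by auto

lemma edge_subset: "edge k \<subseteq> {..<N}"
  unfolding edge_def using N by (intro cyclic_run_subset) simp

lemma pos_in_edge: "pos k mod N \<in> edge k"
  by (simp add: edge_def cyclic_run_def)

lemma edge_crossing:
  assumes "k < l" "pos k * c < start k + Q k"
  shows "(pos k + 1) mod N \<in> edge k"
  using assms r[of k] by (auto simp: edge_def cyclic_run_def gap_def intro!: image_eqI[of _ _ 0])

text \<open>Runs of equal length determine head and jump. Equal jumps above 1 give equal starts; two
  jumps equal to 1 at the same head would mean that both edges take the token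
  \<open>pos k * c\<close>.\<close>

lemma edge_inject:
  assumes k: "k < l" "k' < l" and eq: "edge k = edge k'" "r k = r k'"
  shows "k = k'"
proof -
  have "pos k mod N = pos k' mod N \<and> gap k = gap k'"
    using cyclic_run_inject[OF eq(1)[unfolded edge_def eq(2)]] gap_bounds[of k] gap_bounds[of k']
      gap_run_bound[OF k(1)] gap_run_bound[OF k(2)] r[OF k(1)] eq(2) by auto
  moreover have "pos k < N" "pos k' < N" using pos_le k N by (meson le_less_trans less_le_trans less_add_one)+
  ultimately have pg: "pos k = pos k'" "gap k = gap k'" by auto
  have "\<not> k < k'" if k: "k < l" "k' < l" and pg: "pos k = pos k'" "gap k = gap k'" for k k'
  proof
    assume "k < k'"
    then have s: "start k + Q k \<le> start k'" using start_mono[of "Suc k" k'] by (simp add: start_Suc)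
    show False
      using s pg pos_bounds[of k] pos_bounds[of k'] Q[OF k(1)] Q[OF k(2)]
      by (auto simp: gap_def split: if_splits)
  qed
  from this[OF k pg] this[OF k(2,1) pg[symmetric]] show ?thesis by linarith
qed

lemma token_owner_in_edge:
  assumes k: "k < l" and t: "start k \<le> t" "t < start k + Q k"
  shows "token_owner c s t mod N \<in> edge k"
proof -
  define i where "i = pos k"
  have i: "start k \<le> i * c" "i * c < start k + c" using pos_bounds unfolding i_def by auto
  have Qk: "Q k \<le> c" using Q[OF k] by simp
  have "i * c \<le> t + c" using i t by linarith
  then have "i \<le> (t + c) div c" using c by (metis div_le_mono nonzero_mult_div_cancel_right not_gr_zero)
  then have lo1: "i \<le> t div c + 1" using c by simp
  have lo2: "i \<le> (t + c - 1) div c" unfolding i_def pos_def using t by (intro div_le_mono) simp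
  show ?thesis
  proof (cases "i * c < start k + Q k")
    case True
    have "t < (i + 1) * c" using t i Qk by simp
    then have "t div c < i + 1" by (simp add: less_mult_imp_div_less)
    moreover have "t + c - 1 < (i + 2) * c" using \<open>t < (i + 1) * c\<close> c by (simp add: algebra_simps)
    then have "(t + c - 1) div c < i + 2" by (simp add: less_mult_imp_div_less)
    ultimately have "token_owner c s t = i \<or> token_owner c s t = i + 1"
      using lo1 lo2 by (auto simp: token_owner_def)
    then show ?thesis using pos_in_edge[of k] edge_crossing[OF k] True by (auto simp: i_def)
  next
    case False
    then have ti: "t < i * c" using t by simp
    then have "t div c < i" by (simp add: less_mult_imp_div_less)
    moreover have "t + c - 1 < (i + 1) * c" using ti by (simp add: algebra_simps)
    then have "(t + c - 1) div c < i + 1" by (simp add: less_mult_imp_div_less)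
    ultimately have "token_owner c s t = i" using lo1 lo2 by (auto simp: token_owner_def)
    then show ?thesis using pos_in_edge[of k] by (simp add: i_def)
  qed
qed

text \<open>A head at position 0 means \<open>start k = 0\<close>. The edge then takes token 0, a
  multiple of \<open>c\<close>, so its jump is 1 and it reaches position 1. In this way no gadget
  edge lies inside the base structure.\<close>

lemma edge_meets_interior: assumes "k < l" shows "edge k \<inter> {1..n} \<noteq> {}"
proof (cases "pos k = 0")
  case True
  then have "start k = 0" using pos_bounds(1)[of k] by simp
  then have "(pos k + 1) mod N \<in> edge k" using edge_crossing[OF assms] True Q[OF assms] by simp
  moreover have "1 < N" "1 \<le> n" using N r[OF assms] by auto
  ultimately show ?thesis using True by auto
next
  case False
  then show ?thesis using pos_in_edge[of k] pos_le[OF assms] N by (auto intro!: exI[of _ "pos k"])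
qed

text \<open>Send the surplus token to the missing position \<open>s\<close>. Every token of an edge
  inside \<open>J\<close> is then owned by a position of \<open>J\<close> other than
  \<open>s\<close>, hence by one of the points 1 to \<open>n\<close>, and such a point owns at most
  \<open>c\<close> tokens.\<close>

lemma weight_bound:
  assumes s: "s \<le> n + 1" "s mod N \<notin> J"
  shows "(\<Sum>k | k < l \<and> edge k \<subseteq> J. Q k) \<le> c * card (J \<inter> {1..n})"
proof -
  let ?K = "{k. k < l \<and> edge k \<subseteq> J}"
  let ?I = "\<lambda>k. {start k..<start k + Q k}"
  have "?I j \<inter> ?I k = {}" if "j \<noteq> k" for j k
  proof -
    have "?I j \<inter> ?I k = {}" if "j < k" for j k
      using start_mono[of "Suc j" k] that by (auto simp: start_Suc)
    then show ?thesis using that by (metis Int_commute linorder_neqE_nat)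
  qed
  then have "(\<Sum>k\<in>?K. Q k) = card (\<Union>k\<in>?K. ?I k)"
    by (subst card_UN_disjoint) auto
  also have "\<dots> \<le> card (\<Union>j\<in>J \<inter> {1..n}. {t. t < 1 + n * c \<and> token_owner c s t = j})"
  proof (rule card_mono)
    show "finite (\<Union>j\<in>J \<inter> {1..n}. {t. t < 1 + n * c \<and> token_owner c s t = j})" by auto
    show "(\<Union>k\<in>?K. ?I k) \<subseteq> (\<Union>j\<in>J \<inter> {1..n}. {t. t < 1 + n * c \<and> token_owner c s t = j})"
    proof
      fix t assume "t \<in> (\<Union>k\<in>?K. ?I k)"
      then obtain k where k: "k < l" "edge k \<subseteq> J" "start k \<le> t" "t < start k + Q k" by auto
      define j where "j = token_owner c s t"
      have jJ: "j mod N \<in> J" using token_owner_in_edge[OF k(1,3,4)] k(2) by (auto simp: j_def)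
      then have js: "j \<noteq> s" using s by auto
      have t: "t < 1 + n * c" using start_end[OF k(1)] k by simp
      have "1 \<le> j \<and> j \<le> n" using token_owner_range[OF c t s(1)] js by (simp add: j_def)
      moreover from this have "j mod N = j" using N by simp
      ultimately have "j \<in> J \<inter> {1..n}" using jJ by simp
      then show "t \<in> (\<Union>j\<in>J \<inter> {1..n}. {t. t < 1 + n * c \<and> token_owner c s t = j})"
        using t j_def by blast
    qed
  qed
  also have "\<dots> \<le> (\<Sum>j\<in>J \<inter> {1..n}. card {t. t < 1 + n * c \<and> token_owner c s t = j})"
    by (rule card_UN_le) simp
  also have "\<dots> \<le> (\<Sum>j\<in>J \<inter> {1..n}. c)"
  proof (rule sum_mono)
    fix j assume j: "j \<in> J \<inter> {1..n}"
    then have "j mod N = j" using N by simp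
    then have "j \<noteq> s" using s j by auto
    then show "card {t. t < 1 + n * c \<and> token_owner c s t = j} \<le> c" by (rule token_owner_fibre[OF c])
  qed
  finally show ?thesis by (simp add: mult.commute)
qed

end


section \<open>Attaching a gadget to a structure\<close>

context rational_weights
begin

lemma sum_list_weights_nth: "sum_list (map P es) = (\<Sum>k<length es. P (es ! k))"
  by (simp add: sum_list_sum_nth atLeast0LessThan)

text \<open>The loss is all or nothing: a set that misses one new point or one base point loses
  nothing. This protects short extensions as well as strong sets away from a base point. The base
  points may coincide.\<close>

definition gadget_over :: "nat \<Rightarrow> ('r, 'a) lstruct \<Rightarrow> 'a \<Rightarrow> 'a \<Rightarrow> ('r, 'a) lstruct \<Rightarrow> bool" where
  "gadget_over n C b1 b2 C' \<longleftrightarrow> sym_structure C' \<and> substructure L C C' \<and> finite (univ C') \<and>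
     card (univ C' - univ C) = n \<and>
     (\<forall>D\<subseteq>univ C'. if univ C' - univ C \<subseteq> D \<and> b1 \<in> D \<and> b2 \<in> D
        then predim C' D = predim C (D \<inter> univ C) - 1 else predim C (D \<inter> univ C) \<le> predim C' D)"

lemma gadget:
  assumes "L \<noteq> {}"
  shows "\<exists>n>m. \<forall>(C :: ('r, nat) lstruct) b1 b2. sym_structure C \<longrightarrow> finite (univ C) \<longrightarrow>
     b1 \<in> univ C \<longrightarrow> b2 \<in> univ C \<longrightarrow>
     (\<exists>C'. gadget_over n C b1 b2 C')"
proof -
  define R where "R = (\<Sum>E\<in>L. ar E)"
  have R: "ar E \<le> R" if "E \<in> L" for E
    unfolding R_def using that finite_L by (intro member_le_sum) auto
  \<comment> \<open>\<open>R\<close> bounds every arity, and the margin over \<open>m\<close> keeps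
    each run within half of the cycle.\<close>
  obtain n es where n: "n > m + 2 * (c + 1 + R)" and es: "set es \<subseteq> L" "sum_list (map P es) = 1 + n * c"
    using unit_combination[OF assms] by blast
  define l where "l = length es"
  have esL: "es ! k \<in> L" if "k < l" for k using es that by (auto simp: l_def)
  show ?thesis
  proof (rule exI[of _ n], intro conjI allI impI)
    show "m < n" using n by simp
    fix C :: "('r, nat) lstruct" and b1 b2
    assume C: "sym_structure C" "finite (univ C)" and b: "b1 \<in> univ C" "b2 \<in> univ C"
    \<comment> \<open>With equal base points the line closes up, and position \<open>n + 1\<close>
      is position 0.\<close>
    define N where "N = (if b1 = b2 then n + 1 else n + 2)"
    interpret T: token_line c n N "\<lambda>k. P (es ! k)" "\<lambda>k. ar (es ! k)" l
    proof
      show "0 < c" by (rule c_pos)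
      show "n + 1 \<le> N" "N \<le> n + 2" by (auto simp: N_def)
      show "(\<Sum>k<l. P (es ! k)) = 1 + n * c" using es by (simp add: l_def sum_list_weights_nth)
      fix k assume "k < l"
      then have k: "es ! k \<in> L" by (rule esL)
      show "1 \<le> P (es ! k) \<and> P (es ! k) \<le> c" using P_pos[OF k] P_less[OF k] by simp
      show "2 \<le> ar (es ! k) \<and> 2 * (c + 1 + ar (es ! k)) \<le> n" using ar_ge2[OF k] R[OF k] n by simp
    qed
    define u where "u = Suc (Max (univ C))"
    have u: "x < u" if "x \<in> univ C" for x using that C(2) by (simp add: u_def le_imp_less_Suc)
    define Z where "Z = {u..<u + n}"
    define y where "y j = (if j = 0 then b1 else if j \<le> n then u + (j - 1) else b2)" for j
    have ZC: "Z \<inter> univ C = {}" using u by (force simp: Z_def)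
    have yZ: "y ` {1..n} = Z"
    proof
      show "y ` {1..n} \<subseteq> Z" by (auto simp: y_def Z_def)
      show "Z \<subseteq> y ` {1..n}"
      proof
        fix x assume "x \<in> Z"
        then have "y (x + 1 - u) = x" "x + 1 - u \<in> {1..n}" by (auto simp: y_def Z_def)
        then show "x \<in> y ` {1..n}" by (metis imageI)
      qed
    qed
    have yin: "y j \<in> Z \<longleftrightarrow> j \<in> {1..n}" for j
    proof -
      have "b1 \<notin> Z" "b2 \<notin> Z" using ZC b by blast+
      then show ?thesis by (auto simp: y_def) (auto simp: Z_def)
    qed
    have yb2: "y ((n + 1) mod N) = b2" by (auto simp: y_def N_def)
    have y_inj: "inj_on y {..<N}"
    proof (rule inj_onI)
      fix i j assume ij: "i \<in> {..<N}" "j \<in> {..<N}" "y i = y j"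
      show "i = j"
      proof (cases "i \<in> {1..n}")
        case True
        then have "j \<in> {1..n}" using ij yin by metis
        then show ?thesis using True ij by (auto simp: y_def)
      next
        case False
        then have "j \<notin> {1..n}" using ij yin by metis
        then show ?thesis using False ij by (auto simp: y_def N_def split: if_splits)
      qed
    qed
    have yU: "y j \<in> univ C \<union> Z" for j using b by (auto simp: y_def Z_def)
    define e where "e k = y ` T.edge k" for k
    have card_e: "card (e k) = ar (es ! k)" if "k < l" for k
      unfolding e_def using T.card_edge[OF that] inj_on_subset[OF y_inj T.edge_subset]
      by (simp add: card_image)
    have e_inj: "k = k'" if "k < l" "k' < l" "es ! k = es ! k'" "e k = e k'" for k k'
      using T.edge_inject[OF that(1,2)] that(3,4) inj_on_image_eq_iff[OF y_inj T.edge_subset T.edge_subset]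
      by (simp add: e_def)
    have e_Z: "e k \<inter> Z \<noteq> {}" if "k < l" for k
      using T.edge_meets_interior[OF that] yin unfolding e_def by blast
    have e_sub: "e k \<subseteq> univ C \<union> Z" for k using yU by (auto simp: e_def)
    have fin_e: "finite (e k)" for k unfolding e_def using T.edge_subset finite_subset by blast
    define C' where "C' = \<lparr>univ = univ C \<union> Z,
       rel = \<lambda>E. rel C E \<union> {xs. distinct xs \<and> (\<exists>k<l. es ! k = E \<and> set xs = e k)}\<rparr>"
    have U: "univ C' = univ C \<union> Z" by (simp add: C'_def)
    have rel': "rel C' E = rel C E \<union> {xs. distinct xs \<and> (\<exists>k<l. es ! k = E \<and> set xs = e k)}" for E
      by (simp add: C'_def)
    have lC: "set xs \<subseteq> univ C" if "E \<in> L" "xs \<in> rel C E" for E xs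
      using C that by (auto simp: sym_structure_def lstructure_def)
    have sub: "substructure L C C'"
      unfolding substructure_def rel' U
    proof (intro conjI ballI)
      fix E assume E: "E \<in> L"
      have "\<not> e k \<subseteq> univ C" if "k < l" for k using e_Z[OF that] ZC by blast
      then show "rel C E = {xs \<in> rel C E \<union> {xs. distinct xs \<and> (\<exists>k<l. es ! k = E \<and> set xs = e k)}. set xs \<subseteq> univ C}"
        using lC[OF E] by auto
    qed simp
    have sym: "sym_structure C'" unfolding sym_structure_def lstructure_def
    proof (intro conjI ballI allI impI)
      fix E xs assume E: "E \<in> L" and xs: "xs \<in> rel C' E"
      consider "xs \<in> rel C E" | k where "distinct xs" "k < l" "es ! k = E" "set xs = e k"
        using xs by (auto simp: rel')
      note cs = this
      show "length xs = ar E"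
        using cs
      proof cases
        case 1 then show ?thesis using C E by (simp add: sym_structure_def lstructure_def)
      next
        case 2 then show ?thesis using card_e by (metis distinct_card)
      qed
      show "set xs \<subseteq> univ C'" using cs lC[OF E] e_sub U by cases auto
      show "distinct xs" using cs C E by cases (auto simp: sym_structure_def)
      fix ys assume ys: "mset ys = mset xs"
      show "ys \<in> rel C' E" using cs
      proof cases
        case 1 then show ?thesis using C E ys by (simp add: sym_structure_def rel')
      next
        case 2
        have "set ys = set xs" "distinct ys" using ys 2 by (metis set_mset_mset, metis mset_eq_imp_distinct_iff)
        then show ?thesis using 2 by (auto simp: rel')
      qed
    qed
    have Znew: "univ C' - univ C = Z" using ZC by (auto simp: U)
    \<comment> \<open>Each new point counts \<open>c\<close> and each completed edge takes away its
      weight. The edges are not edges of \<open>C\<close>, since they meet \<open>Z\<close>, and by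
      \<open>e_inject\<close> those of one symbol are pairwise distinct.\<close>
    have dlC': "predim C' D = predim C (D \<inter> univ C) + int c * int (card (D \<inter> Z)) -
        int (\<Sum>k | k < l \<and> e k \<subseteq> D. P (es ! k))" if D: "D \<subseteq> univ C \<union> Z" for D
    proof -
      have finD: "finite D" using D C(2) finite_subset by (auto simp: Z_def)
      have cardD: "card D = card (D \<inter> univ C) + card (D \<inter> Z)"
        using D ZC finD by (subst card_Un_disjoint[symmetric]) (auto intro: arg_cong[of _ _ card])
      have h: "card (hedges C' E D) = card (hedges C E (D \<inter> univ C)) + card {k. k < l \<and> e k \<subseteq> D \<and> es ! k = E}"
        if E: "E \<in> L" for E
      proof -
        let ?K = "{k. k < l \<and> e k \<subseteq> D \<and> es ! k = E}"
        have "hedges C' E D = hedges C E (D \<inter> univ C) \<union> e ` ?K"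
        proof (intro equalityI subsetI)
          fix Y assume "Y \<in> hedges C' E D"
          then obtain xs where xs: "xs \<in> rel C' E" "set xs = Y" "Y \<subseteq> D" by (auto simp: hedges_def)
          show "Y \<in> hedges C E (D \<inter> univ C) \<union> e ` ?K"
          proof (cases "xs \<in> rel C E")
            case True
            then show ?thesis using hedgesI[of xs C E "D \<inter> univ C"] lC[OF E True] xs by auto
          next
            case False then show ?thesis using xs by (auto simp: rel')
          qed
        next
          fix Y assume Y: "Y \<in> hedges C E (D \<inter> univ C) \<union> e ` ?K"
          show "Y \<in> hedges C' E D"
          proof (cases "Y \<in> hedges C E (D \<inter> univ C)")
            case True
            then show ?thesis by (auto simp: hedges_def rel')
          next
            case False
            then obtain k where k: "k \<in> ?K" "Y = e k" using Y by auto
            obtain xs where xs: "set xs = e k" "distinct xs"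
              using finite_distinct_list[OF fin_e] by blast
            then have "xs \<in> rel C' E" using k by (auto simp: rel')
            then show ?thesis using hedgesI[of xs C' E D] xs k by auto
          qed
        qed
        moreover have "hedges C E (D \<inter> univ C) \<inter> e ` ?K = {}"
          using e_Z ZC by (auto simp: hedges_def)
        moreover have "inj_on e ?K" by (rule inj_onI) (use e_inj in auto)
        ultimately show ?thesis using finD
          by (simp add: card_Un_disjoint finite_hedges card_image)
      qed
      have "(\<Sum>E\<in>L. P E * card {k. k < l \<and> e k \<subseteq> D \<and> es ! k = E}) =
            (\<Sum>E\<in>L. \<Sum>k | k \<in> {k. k < l \<and> e k \<subseteq> D} \<and> es ! k = E. P (es ! k))"
        by (rule sum.cong) (auto simp: conj_assoc)
      also have "\<dots> = (\<Sum>k | k < l \<and> e k \<subseteq> D. P (es ! k))"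
        by (rule sum.group) (auto simp: finite_L esL)
      finally have g: "(\<Sum>E\<in>L. P E * card {k. k < l \<and> e k \<subseteq> D \<and> es ! k = E}) =
          (\<Sum>k | k < l \<and> e k \<subseteq> D. P (es ! k))" .
      have "(\<Sum>E\<in>L. int (P E) * int (card (hedges C' E D))) =
         (\<Sum>E\<in>L. int (P E) * int (card (hedges C E (D \<inter> univ C)))) +
         int (\<Sum>E\<in>L. P E * card {k. k < l \<and> e k \<subseteq> D \<and> es ! k = E})"
        by (simp add: h sum.distrib distrib_left)
      then show ?thesis unfolding g predim_def cardD by (simp add: distrib_left)
    qed
    have main: "if univ C' - univ C \<subseteq> D \<and> b1 \<in> D \<and> b2 \<in> D
           then predim C' D = predim C (D \<inter> univ C) - 1 else predim C (D \<inter> univ C) \<le> predim C' D"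
      if D: "D \<subseteq> univ C'" for D
    proof (cases "Z \<subseteq> D \<and> b1 \<in> D \<and> b2 \<in> D")
      case True
      have "y j \<in> D" for j
      proof (cases "j \<in> {1..n}")
        case True
        with yin \<open>Z \<subseteq> D \<and> b1 \<in> D \<and> b2 \<in> D\<close> show ?thesis by blast
      next
        case False
        with True show ?thesis by (auto simp: y_def)
      qed
      then have "e k \<subseteq> D" for k by (auto simp: e_def)
      then have "{k. k < l \<and> e k \<subseteq> D} = {..<l}" by blast
      then have 1: "(\<Sum>k | k < l \<and> e k \<subseteq> D. P (es ! k)) = 1 + n * c"
        using T.Q_sum by simp
      have "D \<inter> Z = Z" using True by auto
      then have 2: "card (D \<inter> Z) = n" by (simp add: Z_def)
      have "D \<subseteq> univ C \<union> Z" using D U by simp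
      from dlC'[OF this] have "predim C' D = predim C (D \<inter> univ C) - 1"
        unfolding 1 2 by simp
      then show ?thesis using True Znew by simp
    next
      case False
      define J where "J = {j. j < N \<and> y j \<in> D}"
      \<comment> \<open>Whatever part of the gadget is missing supplies the position that receives
        the surplus token.\<close>
      obtain s where s: "s \<le> n + 1" "s mod N \<notin> J"
      proof -
        consider "b1 \<notin> D" | "b2 \<notin> D" | z where "z \<in> Z" "z \<notin> D" using False by auto
        then show ?thesis
        proof cases
          case 1 then show ?thesis using that[of 0] by (simp add: J_def y_def)
        next
          case 2 then show ?thesis using that[of "n + 1"] yb2 by (simp add: J_def)
        next
          case 3
          then obtain j where "j \<in> {1..n}" "y j \<notin> D" using yZ by (metis imageE)
          then show ?thesis using that[of j] T.N by (simp add: J_def)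
        qed
      qed
      have "e k \<subseteq> D \<longleftrightarrow> T.edge k \<subseteq> J" for k using T.edge_subset[of k] by (auto simp: e_def J_def)
      then have w: "(\<Sum>k | k < l \<and> e k \<subseteq> D. P (es ! k)) \<le> c * card (J \<inter> {1..n})"
        using T.weight_bound[OF s] by simp
      have "y ` (J \<inter> {1..n}) \<subseteq> D" by (auto simp: J_def)
      moreover have "y ` (J \<inter> {1..n}) \<subseteq> Z" using yZ by blast
      moreover have "inj_on y (J \<inter> {1..n})" by (rule inj_on_subset[OF y_inj]) (auto simp: J_def)
      moreover have "finite (D \<inter> Z)" by (simp add: Z_def)
      ultimately have "card (J \<inter> {1..n}) \<le> card (D \<inter> Z)"
        by (intro card_inj_on_le[of y]) simp_all
      then have "c * card (J \<inter> {1..n}) \<le> c * card (D \<inter> Z)" by simp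
      with w have "int (\<Sum>k | k < l \<and> e k \<subseteq> D. P (es ! k)) \<le> int c * int (card (D \<inter> Z))"
        by (metis le_trans of_nat_le_iff of_nat_mult)
      then have "predim C (D \<inter> univ C) \<le> predim C' D" using dlC'[OF D[unfolded U]] by linarith
      then show ?thesis using False Znew by auto
    qed
    show "\<exists>C'. gadget_over n C b1 b2 C'"
    unfolding gadget_over_def
    proof (intro exI[of _ C'] conjI allI impI sym sub)
      show "finite (univ C')" using C(2) by (simp add: U Z_def)
      show "card (univ C' - univ C) = n" unfolding Znew by (simp add: Z_def)
    qed (rule main)
  qed
qed

end

subsection \<open>Amalgams and zero-extensions\<close>

text \<open>The guard \<open>E \<in> L\<close> makes all relations outside \<open>L\<close> empty,
  as membership in \<open>tasks\<close> requires.\<close>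

definition pullback :: "'r set \<Rightarrow> 'b set \<Rightarrow> ('b \<Rightarrow> 'a) \<Rightarrow> ('r, 'a) lstruct \<Rightarrow> ('r, 'b) lstruct" where
  "pullback L S h M = \<lparr>univ = S, rel = \<lambda>E. {xs. E \<in> L \<and> set xs \<subseteq> S \<and> map h xs \<in> rel M E}\<rparr>"

lemma univ_pullback [simp]: "univ (pullback L S h M) = S"
  by (simp add: pullback_def)

lemma rel_pullback: "rel (pullback L S h M) E = {xs. E \<in> L \<and> set xs \<subseteq> S \<and> map h xs \<in> rel M E}"
  by (simp add: pullback_def)

lemma embedding_pullback:
  "inj_on h S \<Longrightarrow> h ` S \<subseteq> univ M \<Longrightarrow> embedding L h (pullback L S h M) M"
  by (auto simp: embedding_def rel_pullback)

text \<open>Renames so that two structures on natural numbers meet in \<open>X\<close> only, ready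
  for a free amalgam; \<open>F\<close> is the universe to be avoided and \<open>X\<close> keeps its
  names.\<close>

lemma nat_copy:
  fixes X F :: "nat set"
  assumes fin: "finite X" "finite F" "finite Y" and f: "inj_on f X" "f ` X \<subseteq> Y"
  obtains S h where "X \<subseteq> S" "finite S" "S \<inter> F \<subseteq> X" "bij_betw h S Y" "\<And>x. x \<in> X \<Longrightarrow> h x = f x"
proof -
  define u where "u = Suc (Max (insert 0 (X \<union> F)))"
  have u: "x < u" if "x \<in> X \<union> F" for x using that fin by (simp add: u_def le_imp_less_Suc)
  define Z where "Z = {u..<u + card (Y - f ` X)}"
  have Z: "Z \<inter> (X \<union> F) = {}" using u by (fastforce simp: Z_def)
  obtain e where e: "bij_betw e Z (Y - f ` X)"
    using finite_same_card_bij[of Z "Y - f ` X"] fin by (auto simp: Z_def)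
  define h where "h x = (if x \<in> X then f x else e x)" for x
  have "bij_betw h X (f ` X)"
    using f(1) by (auto simp: bij_betw_def h_def inj_on_def)
  moreover have "bij_betw h Z (Y - f ` X)"
    using e Z by (subst bij_betw_cong[of Z h e]) (auto simp: h_def)
  ultimately have "bij_betw h (X \<union> Z) (f ` X \<union> (Y - f ` X))"
    by (rule bij_betw_combine) auto
  moreover have "f ` X \<union> (Y - f ` X) = Y" using f by auto
  ultimately show ?thesis
    using that[of "X \<union> Z" h] fin Z by (auto simp: h_def Z_def)
qed

section \<open>Free amalgams\<close>

definition amalgam :: "('r, 'a) lstruct \<Rightarrow> ('r, 'a) lstruct \<Rightarrow> ('r, 'a) lstruct" where
  "amalgam A B = \<lparr>univ = univ A \<union> univ B, rel = \<lambda>E. rel A E \<union> rel B E\<rparr>"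

lemma univ_amalgam [simp]: "univ (amalgam A B) = univ A \<union> univ B"
  by (simp add: amalgam_def)

lemma rel_amalgam: "rel (amalgam A B) E = rel A E \<union> rel B E"
  by (simp add: amalgam_def)

context rational_weights
begin

lemma admissible_nonneg: "admissible M \<Longrightarrow> finite X \<Longrightarrow> X \<subseteq> univ M \<Longrightarrow> 0 \<le> predim M X"
  by (simp add: admissible_def)

lemma sym_structure_pullback:
  assumes "sym_structure M"
  shows "sym_structure (pullback L S h M)"
  unfolding sym_structure_def lstructure_def
proof (intro conjI ballI allI impI)
  fix E xs assume E: "E \<in> L" and "xs \<in> rel (pullback L S h M) E"
  then have xs: "set xs \<subseteq> S" "map h xs \<in> rel M E" by (auto simp: rel_pullback)
  show "set xs \<subseteq> univ (pullback L S h M)" using xs by simp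
  show "length xs = ar E" using assms E xs by (force simp: sym_structure_def lstructure_def)
  have "distinct (map h xs)" using assms E xs unfolding sym_structure_def by blast
  then show "distinct xs" by (simp add: distinct_map)
  fix ys assume ys: "mset ys = mset xs"
  then have "mset (map h ys) = mset (map h xs)" "set ys = set xs" by (simp, metis set_mset_mset)
  then show "ys \<in> rel (pullback L S h M) E"
    using assms E xs unfolding sym_structure_def rel_pullback by auto
qed

lemma admissible_embedding:
  assumes "admissible M" "sym_structure A" "embedding L f A M"
  shows "admissible A"
  unfolding admissible_def
proof (intro conjI allI impI assms(2))
  fix X assume X: "finite X" "X \<subseteq> univ A"
  then have "0 \<le> predim M (f ` X)" using assms unfolding admissible_def embedding_def by (meson finite_imageI image_mono order_trans)
  then show "0 \<le> predim A X" using predim_embedding[OF assms(3) X(2)] by simp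
qed

lemma admissible_pullback:
  assumes "admissible M" "inj_on h S" "h ` S \<subseteq> univ M"
  shows "admissible (pullback L S h M)"
  using assms admissible_embedding[OF assms(1) _ embedding_pullback[OF assms(2,3)]]
  by (auto simp: admissible_def sym_structure_pullback)

lemma finite_copy:
  assumes "admissible M" "finite Y" "Y \<subseteq> univ M"
  obtains A :: "('r, nat) lstruct" and h where "admissible A" "finite (univ A)" "embedding L h A M" "h ` univ A = Y"
proof -
  obtain S :: "nat set" and h where S: "finite S" "bij_betw h S Y"
    using nat_copy[of "{}" "{}" Y undefined] assms(2) by auto
  then have hS: "inj_on h S" "h ` S = Y" by (auto simp: bij_betw_def)
  show ?thesis
  proof (rule that[of "pullback L S h M" h])
    show "admissible (pullback L S h M)" using hS assms by (intro admissible_pullback) auto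
    show "embedding L h (pullback L S h M) M" using hS assms by (intro embedding_pullback) auto
  qed (use S hS in auto)
qed

lemma strong_upto_substructure_iff:
  "substructure L A B \<Longrightarrow> strong_upto k (induced B (univ A)) X \<longleftrightarrow> strong_upto k A X"
  by (auto simp: strong_upto_def predim_induced predim_substructure)

lemma strong_set_substructure_iff:
  "substructure L A B \<Longrightarrow> strong_set (induced B (univ A)) X \<longleftrightarrow> strong_set A X"
  by (auto simp: strong_set_def predim_induced predim_substructure)

text \<open>No edge crosses from one side to the other, so submodularity becomes an
  equality.\<close>

lemma amalgam_predim:
  assumes "lstructure L ar A" "lstructure L ar B" "finite D"
    and D: "D \<subseteq> univ A \<union> univ B"
    and agree: "\<And>E. E \<in> L \<Longrightarrow> {xs \<in> rel A E. set xs \<subseteq> univ B} = {xs \<in> rel B E. set xs \<subseteq> univ A}"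
  shows "predim (amalgam A B) D = predim A (D \<inter> univ A) + predim B (D \<inter> univ B) - predim B (D \<inter> univ A \<inter> univ B)"
proof -
  have h: "int (card (hedges (amalgam A B) E D)) =
      int (card (hedges A E (D \<inter> univ A))) + int (card (hedges B E (D \<inter> univ B)))
      - int (card (hedges B E (D \<inter> univ A \<inter> univ B)))" if E: "E \<in> L" for E
  proof -
    have sA: "set xs \<subseteq> univ A" if "xs \<in> rel A E" for xs using assms that E by (auto simp: lstructure_def)
    have sB: "set xs \<subseteq> univ B" if "xs \<in> rel B E" for xs using assms that E by (auto simp: lstructure_def)
    have "hedges (amalgam A B) E D = hedges A E (D \<inter> univ A) \<union> hedges B E (D \<inter> univ B)"
    proof (intro equalityI subsetI)
      fix Y assume "Y \<in> hedges (amalgam A B) E D"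
      then obtain xs where xs: "xs \<in> rel A E \<or> xs \<in> rel B E" "set xs = Y" "Y \<subseteq> D"
        by (auto simp: hedges_def rel_amalgam)
      then show "Y \<in> hedges A E (D \<inter> univ A) \<union> hedges B E (D \<inter> univ B)"
        using hedgesI[of xs A E "D \<inter> univ A"] hedgesI[of xs B E "D \<inter> univ B"] sA sB by auto
    next
      fix Y assume "Y \<in> hedges A E (D \<inter> univ A) \<union> hedges B E (D \<inter> univ B)"
      then show "Y \<in> hedges (amalgam A B) E D" by (auto simp: hedges_def rel_amalgam)
    qed
    moreover have "hedges A E (D \<inter> univ A) \<inter> hedges B E (D \<inter> univ B) = hedges B E (D \<inter> univ A \<inter> univ B)"
    proof (intro equalityI subsetI)
      fix Y assume "Y \<in> hedges A E (D \<inter> univ A) \<inter> hedges B E (D \<inter> univ B)"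
      then show "Y \<in> hedges B E (D \<inter> univ A \<inter> univ B)" by (auto simp: hedges_def)
    next
      fix Y assume "Y \<in> hedges B E (D \<inter> univ A \<inter> univ B)"
      then obtain xs where xs: "xs \<in> rel B E" "set xs = Y" "Y \<subseteq> D \<inter> univ A \<inter> univ B" by (auto simp: hedges_def)
      then have "xs \<in> rel A E" using agree[OF E] by blast
      then show "Y \<in> hedges A E (D \<inter> univ A) \<inter> hedges B E (D \<inter> univ B)"
        using hedgesI[of xs A E "D \<inter> univ A"] hedgesI[of xs B E "D \<inter> univ B"] xs by auto
    qed
    ultimately show ?thesis
      using card_Un_Int[of "hedges A E (D \<inter> univ A)" "hedges B E (D \<inter> univ B)"] assms(3)
      by (simp add: finite_hedges)
  qed
  have "D \<inter> univ A \<union> D \<inter> univ B = D" "(D \<inter> univ A) \<inter> (D \<inter> univ B) = D \<inter> univ A \<inter> univ B"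
    using D by auto
  then have cD: "int (card D) = int (card (D \<inter> univ A)) + int (card (D \<inter> univ B)) - int (card (D \<inter> univ A \<inter> univ B))"
    using card_Un_Int[of "D \<inter> univ A" "D \<inter> univ B"] assms(3) by simp
  show ?thesis unfolding predim_def cD
    by (simp add: h algebra_simps sum.distrib sum_subtractf)
qed

text \<open>Points of \<open>B\<close> are added to a subset of \<open>A\<close> at the same cost as
  inside \<open>B\<close> over the common part. Submodularity and strongness of that part in
  \<open>B\<close> make the cost nonnegative, so \<open>A\<close> is strong and its admissibility
  passes to the amalgam.\<close>

lemma amalgam_properties:
  assumes A: "admissible A" "finite (univ A)" and B: "admissible B" "finite (univ B)"
    and agree: "\<And>E. E \<in> L \<Longrightarrow> {xs \<in> rel A E. set xs \<subseteq> univ B} = {xs \<in> rel B E. set xs \<subseteq> univ A}"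
    and s: "strong_set B (univ A \<inter> univ B)"
  shows "admissible (amalgam A B)" "substructure L A (amalgam A B)" "substructure L B (amalgam A B)"
    "strong_set (amalgam A B) (univ A)"
    "strong_set A (univ A \<inter> univ B) \<Longrightarrow> strong_set (amalgam A B) (univ B)"
    "predim (amalgam A B) (univ A \<union> univ B) = predim A (univ A) + predim B (univ B) - predim B (univ A \<inter> univ B)"
proof -
  let ?C = "amalgam A B"
  have lA: "lstructure L ar A" and lB: "lstructure L ar B" using A B admissible_lstructure by blast+
  have sA: "set xs \<subseteq> univ A" if "E \<in> L" "xs \<in> rel A E" for E xs using lA that by (auto simp: lstructure_def)
  have sB: "set xs \<subseteq> univ B" if "E \<in> L" "xs \<in> rel B E" for E xs using lB that by (auto simp: lstructure_def)
  show subA: "substructure L A ?C" unfolding substructure_def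
  proof (intro conjI ballI)
    fix E assume E: "E \<in> L"
    show "rel A E = {xs \<in> rel ?C E. set xs \<subseteq> univ A}"
      using agree[OF E] sA[OF E] sB[OF E] by (auto simp: rel_amalgam)
  qed simp
  show subB: "substructure L B ?C" unfolding substructure_def
  proof (intro conjI ballI)
    fix E assume E: "E \<in> L"
    show "rel B E = {xs \<in> rel ?C E. set xs \<subseteq> univ B}"
      using agree[OF E] sA[OF E] sB[OF E] by (auto simp: rel_amalgam)
  qed simp
  have dlC: "predim ?C D = predim A (D \<inter> univ A) + predim B (D \<inter> univ B) - predim B (D \<inter> univ A \<inter> univ B)"
    if "D \<subseteq> univ A \<union> univ B" for D
    using amalgam_predim[OF lA lB _ that agree] that A(2) B(2) by (meson finite_Un finite_subset)
  have *: "predim A (D \<inter> univ A) \<le> predim ?C D" if D: "D \<subseteq> univ A \<union> univ B" for D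
  proof -
    let ?D = "D \<inter> univ B"
    have "predim B (?D \<union> (univ A \<inter> univ B)) + predim B (?D \<inter> (univ A \<inter> univ B)) \<le> predim B ?D + predim B (univ A \<inter> univ B)"
      using A B by (intro predim_submodular) auto
    moreover have "predim B (univ A \<inter> univ B) \<le> predim B (?D \<union> (univ A \<inter> univ B))"
      using s B by (auto simp: strong_set_def)
    moreover have "?D \<inter> (univ A \<inter> univ B) = D \<inter> univ A \<inter> univ B" by auto
    ultimately show ?thesis using dlC[OF D] by simp
  qed
  show "admissible ?C" unfolding admissible_def
  proof (intro conjI allI impI)
    have symA: "sym_structure A" and symB: "sym_structure B" using A B by (auto simp: admissible_def)
    show "sym_structure ?C" unfolding sym_structure_def lstructure_def
    proof (intro conjI ballI allI impI)
      fix E xs assume E: "E \<in> L" and "xs \<in> rel ?C E"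
      then have xs: "xs \<in> rel A E \<or> xs \<in> rel B E" by (simp add: rel_amalgam)
      show "length xs = ar E" using xs lA lB E by (auto simp: lstructure_def)
      show "set xs \<subseteq> univ ?C" using xs sA[OF E] sB[OF E] by auto
      show "distinct xs" using xs symA symB E by (auto simp: sym_structure_def)
      fix ys assume "mset ys = mset xs"
      then show "ys \<in> rel ?C E" using xs symA symB E by (auto simp: sym_structure_def rel_amalgam)
    qed
    fix X assume X: "finite X" "X \<subseteq> univ ?C"
    have "0 \<le> predim A (X \<inter> univ A)" using A X by (simp add: admissible_def)
    then show "0 \<le> predim ?C X" using *[of X] X by simp
  qed
  show "strong_set ?C (univ A)" unfolding strong_set_def
  proof (intro conjI allI impI A)
    show "univ A \<subseteq> univ ?C" by simp
    fix Y assume Y: "univ A \<subseteq> Y" "Y \<subseteq> univ ?C"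
    then have "predim A (univ A) \<le> predim ?C Y" using *[of Y] by (simp add: Int_absorb1)
    then show "predim ?C (univ A) \<le> predim ?C Y" using predim_substructure[OF subA, of "univ A"] by simp
  qed
  show "strong_set ?C (univ B)" if sA: "strong_set A (univ A \<inter> univ B)" unfolding strong_set_def
  proof (intro conjI allI impI B)
    show "univ B \<subseteq> univ ?C" by simp
    fix Y assume Y: "univ B \<subseteq> Y" "Y \<subseteq> univ ?C"
    have "Y \<inter> univ B = univ B" "Y \<inter> univ A \<inter> univ B = univ A \<inter> univ B" using Y by auto
    then have "predim ?C Y = predim A (Y \<inter> univ A) + predim B (univ B) - predim B (univ A \<inter> univ B)"
      using dlC[of Y] Y by simp
    moreover have "predim A (univ A \<inter> univ B) \<le> predim A (Y \<inter> univ A)"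
      using sA Y A(2) by (auto simp: strong_set_def)
    moreover have "predim A (univ A \<inter> univ B) = predim B (univ A \<inter> univ B)"
      using predim_substructure[OF subA, of "univ A \<inter> univ B"] predim_substructure[OF subB, of "univ A \<inter> univ B"] by simp
    ultimately show "predim ?C (univ B) \<le> predim ?C Y" using predim_substructure[OF subB, of "univ B"] by simp
  qed
  show "predim ?C (univ A \<union> univ B) = predim A (univ A) + predim B (univ B) - predim B (univ A \<inter> univ B)"
  proof -
    have "(univ A \<union> univ B) \<inter> univ A = univ A" "(univ A \<union> univ B) \<inter> univ B = univ B" by auto
    then show ?thesis using dlC[OF order_refl] by simp
  qed
qed

text \<open>Let \<open>X\<close> be a maximal extension of \<open>S\<close> of the same
  predimension. By submodularity its union with any other such extension is again one, so
  \<open>X\<close> contains them all and every point outside \<open>X\<close> will do. The strict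
  inequality provides such a point.\<close>

lemma exists_loose_point:
  assumes s: "strong_set C S" and fin: "finite (univ C)" and less: "predim C S < predim C (univ C)"
  obtains b where "b \<in> univ C" "\<And>Y. S \<subseteq> Y \<Longrightarrow> Y \<subseteq> univ C \<Longrightarrow> b \<in> Y \<Longrightarrow> predim C S < predim C Y"
proof -
  let ?T = "{X. S \<subseteq> X \<and> X \<subseteq> univ C \<and> predim C X = predim C S}"
  have "finite ?T" by (rule finite_subset[of _ "Pow (univ C)"]) (use fin in auto)
  moreover have "?T \<noteq> {}" using s unfolding strong_set_def by blast
  ultimately have "\<exists>X\<in>?T. \<forall>Y\<in>?T. X \<le> Y \<longrightarrow> X = Y" by (rule finite_has_maximal)
  then obtain X where "X \<in> ?T" and max: "\<forall>Y\<in>?T. X \<le> Y \<longrightarrow> X = Y" by (elim bexE)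
  then have X: "S \<subseteq> X" "X \<subseteq> univ C" "predim C X = predim C S" by auto
  have "X \<noteq> univ C" using X(3) less by auto
  then obtain b where b: "b \<in> univ C" "b \<notin> X" using X(2) by blast
  have ge: "predim C S \<le> predim C Y" if "S \<subseteq> Y" "Y \<subseteq> univ C" for Y
    using s that finite_subset[OF that(2) fin] by (simp add: strong_set_def)
  have "predim C S < predim C Y" if Y: "S \<subseteq> Y" "Y \<subseteq> univ C" "b \<in> Y" for Y
  proof (rule ccontr)
    assume "\<not> predim C S < predim C Y"
    then have e: "predim C Y = predim C S" using ge[OF Y(1,2)] by simp
    have "predim C (X \<union> Y) + predim C (X \<inter> Y) \<le> predim C X + predim C Y"
      using X(2) Y(2) fin by (intro predim_submodular) (rule finite_subset, assumption+)+
    moreover have "predim C S \<le> predim C (X \<inter> Y)" using X Y by (intro ge) auto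
    moreover have "predim C S \<le> predim C (X \<union> Y)" using X Y by (intro ge) auto
    ultimately have "predim C (X \<union> Y) = predim C S" using e X(3) by linarith
    then have "X \<union> Y \<in> ?T" using X Y by blast
    then have "X = X \<union> Y" using max by blast
    then show False using b Y by blast
  qed
  then show ?thesis using that b by blast
qed

section \<open>Lowering the predimension unit by unit\<close>

definition reduction :: "nat \<Rightarrow> nat \<Rightarrow> ('r, 'a) lstruct \<Rightarrow> 'a set \<Rightarrow> 'a set \<Rightarrow> ('r, 'a) lstruct \<Rightarrow> bool" where
  "reduction m k C S1 S2 C' \<longleftrightarrow> admissible C' \<and> substructure L C C' \<and> finite (univ C') \<and>
     card (univ C') = card (univ C) + k \<and> strong_set C' S1 \<and> strong_set C' S2 \<and> strong_upto m C' (univ C)"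

text \<open>The gadget hangs on one loose point for each of the strong sets. A set above
  \<open>S1\<close> or \<open>S2\<close> that contains the whole gadget and both base points
  contains the loose point, so its trace on \<open>C\<close> lies at least one unit above the strong
  set, and the loss of one unit is harmless.\<close>

lemma reduce_step:
  assumes "L \<noteq> {}"
  shows "\<exists>n>m. \<forall>(C :: ('r, nat) lstruct) S1 S2. admissible C \<longrightarrow> finite (univ C) \<longrightarrow>
     strong_set C S1 \<longrightarrow> strong_set C S2 \<longrightarrow> predim C S1 < predim C (univ C) \<longrightarrow> predim C S2 < predim C (univ C) \<longrightarrow>
     (\<exists>C'. reduction m n C S1 S2 C' \<and> predim C' (univ C') = predim C (univ C) - 1)"
proof -
  obtain n where n: "n > m" and G: "\<forall>(C :: ('r, nat) lstruct) b1 b2. sym_structure C \<longrightarrow> finite (univ C) \<longrightarrow>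
     b1 \<in> univ C \<longrightarrow> b2 \<in> univ C \<longrightarrow>
     (\<exists>C'. gadget_over n C b1 b2 C')"
    using gadget[OF assms, of m] by blast
  show ?thesis
  proof (rule exI[of _ n], intro conjI allI impI n)
    fix C :: "('r, nat) lstruct" and S1 S2
    assume C: "admissible C" "finite (univ C)" and S: "strong_set C S1" "strong_set C S2"
      and less: "predim C S1 < predim C (univ C)" "predim C S2 < predim C (univ C)"
    obtain b1 where b1: "b1 \<in> univ C" "\<And>Y. S1 \<subseteq> Y \<Longrightarrow> Y \<subseteq> univ C \<Longrightarrow> b1 \<in> Y \<Longrightarrow> predim C S1 < predim C Y"
      using exists_loose_point[OF S(1) C(2) less(1)] by blast
    obtain b2 where b2: "b2 \<in> univ C" "\<And>Y. S2 \<subseteq> Y \<Longrightarrow> Y \<subseteq> univ C \<Longrightarrow> b2 \<in> Y \<Longrightarrow> predim C S2 < predim C Y"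
      using exists_loose_point[OF S(2) C(2) less(2)] by blast
    have "sym_structure C" using C by (simp add: admissible_def)
    then obtain C' where "gadget_over n C b1 b2 C'"
      using G C(2) b1(1) b2(1) by blast
    then have C': "sym_structure C'" "substructure L C C'" "finite (univ C')"
        "card (univ C' - univ C) = n"
      and D: "\<And>D. D \<subseteq> univ C' \<Longrightarrow> if univ C' - univ C \<subseteq> D \<and> b1 \<in> D \<and> b2 \<in> D
           then predim C' D = predim C (D \<inter> univ C) - 1 else predim C (D \<inter> univ C) \<le> predim C' D"
      unfolding gadget_over_def by blast+
    have sub: "univ C \<subseteq> univ C'" using C' by (simp add: substructure_def)
    have ge: "predim C (D \<inter> univ C) \<le> predim C' D"
      if "D \<subseteq> univ C'" "\<not> (univ C' - univ C \<subseteq> D \<and> b1 \<in> D \<and> b2 \<in> D)" for D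
      using D[OF that(1)] that(2) by argo
    have full: "predim C' D = predim C (D \<inter> univ C) - 1"
      if "D \<subseteq> univ C'" "univ C' - univ C \<subseteq> D" "b1 \<in> D" "b2 \<in> D" for D
      using D[OF that(1)] that(2-4) by argo
    have strong: "strong_set C' T"
      if T: "strong_set C T" "\<And>Y. T \<subseteq> Y \<Longrightarrow> Y \<subseteq> univ C \<Longrightarrow> b1 \<in> Y \<Longrightarrow> b2 \<in> Y \<Longrightarrow> predim C T < predim C Y" for T
      unfolding strong_set_def
    proof (intro conjI allI impI)
      show "finite T" "T \<subseteq> univ C'" using T sub by (auto simp: strong_set_def)
      fix Y assume Y: "finite Y" "T \<subseteq> Y" "Y \<subseteq> univ C'"
      have TY: "T \<subseteq> Y \<inter> univ C" using Y T by (auto simp: strong_set_def)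
      have "predim C T \<le> predim C' Y"
      proof (cases "univ C' - univ C \<subseteq> Y \<and> b1 \<in> Y \<and> b2 \<in> Y")
        case True
        then show ?thesis using full[OF Y(3)] T(2)[OF TY] b1(1) b2(1) by simp
      next
        case False
        have "predim C T \<le> predim C (Y \<inter> univ C)" using T(1) TY Y by (simp add: strong_set_def)
        then show ?thesis using ge[OF Y(3) False] by simp
      qed
      then show "predim C' T \<le> predim C' Y" using predim_substructure[OF C'(2)] T by (simp add: strong_set_def)
    qed
    have s1: "strong_set C' S1" using strong[OF S(1)] b1(2) by blast
    have s2: "strong_set C' S2" using strong[OF S(2)] b2(2) by blast
    have admissible: "admissible C'" unfolding admissible_def
    proof (intro conjI allI impI C')
      fix Y assume Y: "finite Y" "Y \<subseteq> univ C'"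
      show "0 \<le> predim C' Y"
      proof (cases "univ C' - univ C \<subseteq> Y \<and> b1 \<in> Y \<and> b2 \<in> Y")
        case True
        \<comment> \<open>The union of the trace with \<open>S1\<close> contains \<open>b1\<close>
          and so exceeds \<open>S1\<close> strictly; submodularity then makes the trace itself
          positive.\<close>
        let ?Y = "Y \<inter> univ C"
        have fS: "finite S1" "S1 \<subseteq> univ C" using S by (auto simp: strong_set_def)
        have "predim C (?Y \<union> S1) + predim C (?Y \<inter> S1) \<le> predim C ?Y + predim C S1"
          using Y fS by (intro predim_submodular) auto
        moreover have "predim C S1 < predim C (?Y \<union> S1)" using True b1 fS by (intro b1(2)) auto
        moreover have "0 \<le> predim C (?Y \<inter> S1)" using Y fS by (intro admissible_nonneg[OF C(1)]) auto
        ultimately show ?thesis using full[OF Y(2)] True by simp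
      next
        case False
        have "0 \<le> predim C (Y \<inter> univ C)" using Y by (intro admissible_nonneg[OF C(1)]) auto
        then show ?thesis using ge[OF Y(2) False] by simp
      qed
    qed
    have ms: "strong_upto m C' (univ C)" unfolding strong_upto_def
    proof (intro conjI allI impI C(2) sub)
      fix Y assume Y: "finite Y" "univ C \<subseteq> Y" "Y \<subseteq> univ C'" "card (Y - univ C) \<le> m"
      have "\<not> univ C' - univ C \<subseteq> Y"
      proof
        assume "univ C' - univ C \<subseteq> Y"
        then have "n \<le> card (Y - univ C)" unfolding C'(4)[symmetric] using Y by (intro card_mono) auto
        then show False using Y(4) n by simp
      qed
      then have "predim C (Y \<inter> univ C) \<le> predim C' Y" using ge[OF Y(3)] by blast
      then show "predim C' (univ C) \<le> predim C' Y" using Y predim_substructure[OF C'(2), of "univ C"] by (simp add: Int_absorb1)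
    qed
    have card: "card (univ C') = card (univ C) + n"
      using C' C(2) sub by (metis card_Diff_subset card_mono le_add_diff_inverse)
    have "predim C' (univ C') = predim C (univ C) - 1"
      using full[of "univ C'"] b1(1) b2(1) sub by (auto simp: Int_absorb1)
    then show "\<exists>C'. reduction m n C S1 S2 C' \<and> predim C' (univ C') = predim C (univ C) - 1"
      unfolding reduction_def using admissible C' card s1 s2 ms by blast
  qed
qed

text \<open>The gadget length \<open>n\<close> is chosen before \<open>C\<close>, so the size of the
  result is controlled by the drop alone.\<close>

lemma reduce:
  assumes "L \<noteq> {}"
  shows "\<exists>n. \<forall>(C :: ('r, nat) lstruct) S1 S2 t. admissible C \<longrightarrow> finite (univ C) \<longrightarrow>
     strong_set C S1 \<longrightarrow> strong_set C S2 \<longrightarrow> predim C S1 \<le> t \<longrightarrow> predim C S2 \<le> t \<longrightarrow> t \<le> predim C (univ C) \<longrightarrow>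
     (\<exists>C'. reduction m (n * nat (predim C (univ C) - t)) C S1 S2 C' \<and> predim C' (univ C') = t)"
proof -
  obtain n where G: "\<forall>(C :: ('r, nat) lstruct) S1 S2. admissible C \<longrightarrow> finite (univ C) \<longrightarrow>
     strong_set C S1 \<longrightarrow> strong_set C S2 \<longrightarrow> predim C S1 < predim C (univ C) \<longrightarrow> predim C S2 < predim C (univ C) \<longrightarrow>
     (\<exists>C'. reduction m n C S1 S2 C' \<and> predim C' (univ C') = predim C (univ C) - 1)"
    using reduce_step[OF assms, of m] by blast
  have "\<exists>C'. reduction m (n * nat (predim C (univ C) - t)) C S1 S2 C' \<and> predim C' (univ C') = t"
    if "admissible C" "finite (univ C)" "strong_set C S1" "strong_set C S2" "predim C S1 \<le> t" "predim C S2 \<le> t" "t \<le> predim C (univ C)"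
      "k = nat (predim C (univ C) - t)"
    for C :: "('r, nat) lstruct" and S1 S2 t k
    using that
  proof (induction k arbitrary: C)
    case 0
    have "lstructure L ar C" using 0 admissible_lstructure by blast
    then have "substructure L C C" by (rule substructure_refl)
    moreover have "strong_upto m C (univ C)" using 0 by (auto simp: strong_upto_def dest: subset_antisym)
    ultimately show ?case using 0 by (intro exI[of _ C]) (simp add: reduction_def)
  next
    case (Suc k)
    then have less: "t < predim C (univ C)" by simp
    then obtain C1 where C1: "admissible C1" "substructure L C C1" "finite (univ C1)"
      "card (univ C1) = card (univ C) + n" "predim C1 (univ C1) = predim C (univ C) - 1"
      "strong_set C1 S1" "strong_set C1 S2" "strong_upto m C1 (univ C)"
      using G Suc.prems unfolding reduction_def by (meson le_less_trans)
    have eq: "predim C1 S1 = predim C S1" "predim C1 S2 = predim C S2"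
      using predim_substructure[OF C1(2)] Suc.prems by (auto simp: strong_set_def)
    have "\<exists>C'. reduction m (n * nat (predim C1 (univ C1) - t)) C1 S1 S2 C' \<and> predim C' (univ C') = t"
      by (rule Suc.IH) (use C1 eq Suc.prems less in auto)
    then obtain C' where C': "admissible C'" "substructure L C1 C'" "finite (univ C')"
        "card (univ C') = card (univ C1) + n * nat (predim C1 (univ C1) - t)" "predim C' (univ C') = t"
        "strong_set C' S1" "strong_set C' S2" "strong_upto m C' (univ C1)" unfolding reduction_def by blast
    have "nat (predim C (univ C) - t) = Suc (nat (predim C1 (univ C1) - t))" using less C1(5) by simp
    then have "card (univ C') = card (univ C) + n * nat (predim C (univ C) - t)" using C' C1(4) by simp
    moreover have "strong_upto m C' (univ C)"
      using strong_upto_trans[OF _ C'(8)] strong_upto_substructure_iff[OF C'(2)] C1(8) by blast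
    ultimately show ?case using C' substructure_trans[OF C1(2) C'(2)] unfolding reduction_def by blast
  qed
  then show ?thesis by blast
qed

definition zero_extension_over :: "nat \<Rightarrow> nat \<Rightarrow> ('r, 'a) lstruct \<Rightarrow> 'a set \<Rightarrow> ('r, 'a) lstruct \<Rightarrow> bool" where
  "zero_extension_over m b A X C \<longleftrightarrow> admissible C \<and> substructure L A C \<and> finite (univ C) \<and>
     card (univ C) \<le> b \<and> predim C (univ C) = predim C X \<and> strong_set C X \<and> strong_upto m C (univ A)"

text \<open>Lower the value of \<open>A\<close> to that of \<open>X\<close>. The former is at most
  \<open>c * card (univ A)\<close> and the latter nonnegative, so the number of gadgets is bounded
  in terms of the size of \<open>A\<close>; the game depends on this uniform bound.\<close>

lemma zero_extension:
  assumes "L \<noteq> {}"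
  shows "\<exists>n. \<forall>(A :: ('r, nat) lstruct) X. admissible A \<longrightarrow> finite (univ A) \<longrightarrow> strong_set A X \<longrightarrow>
     (\<exists>C. zero_extension_over m (card (univ A) + n * (c * card (univ A))) A X C)"
proof -
  obtain n where G: "\<And>(C :: ('r, nat) lstruct) S1 S2 t. admissible C \<Longrightarrow> finite (univ C) \<Longrightarrow>
     strong_set C S1 \<Longrightarrow> strong_set C S2 \<Longrightarrow> predim C S1 \<le> t \<Longrightarrow> predim C S2 \<le> t \<Longrightarrow> t \<le> predim C (univ C) \<Longrightarrow>
     (\<exists>C'. reduction m (n * nat (predim C (univ C) - t)) C S1 S2 C' \<and> predim C' (univ C') = t)"
    using reduce[OF assms, of m] by blast
  show ?thesis
  proof (rule exI[of _ n], intro allI impI)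
    fix A :: "('r, nat) lstruct" and X
    assume A: "admissible A" "finite (univ A)" "strong_set A X"
    have "predim A X \<le> predim A (univ A)" using A by (simp add: strong_set_def)
    then obtain C where C: "admissible C" "substructure L A C" "finite (univ C)"
        "card (univ C) = card (univ A) + n * nat (predim A (univ A) - predim A X)" "predim C (univ C) = predim A X"
        "strong_set C X" "strong_upto m C (univ A)"
      using G[OF A(1,2,3,3) order_refl order_refl] unfolding reduction_def by blast
    have "0 \<le> predim A X" using A by (simp add: admissible_def strong_set_def)
    then have "predim A (univ A) - predim A X \<le> int (c * card (univ A))" using predim_le_card[of A "univ A"] by simp
    then have "nat (predim A (univ A) - predim A X) \<le> c * card (univ A)" by (simp only: nat_le_iff)
    then have "card (univ C) \<le> card (univ A) + n * (c * card (univ A))" using C(4) by simp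
    moreover have "predim C X = predim A X" using predim_substructure[OF C(2), of X] A by (simp add: strong_set_def)
    ultimately show "\<exists>C. zero_extension_over m (card (univ A) + n * (c * card (univ A))) A X C" unfolding zero_extension_over_def using C by metis
  qed
qed

text \<open>Values on finite sets are natural numbers, so some finite superset has the least one,
  and that superset is strong.\<close>

lemma strong_closure:
  assumes "admissible M" "finite X" "X \<subseteq> univ M"
  obtains Y where "X \<subseteq> Y" "strong_set M Y"
proof -
  let ?P = "\<lambda>Y. finite Y \<and> X \<subseteq> Y \<and> Y \<subseteq> univ M"
  obtain Y where Y: "?P Y" "\<And>W. ?P W \<Longrightarrow> nat (predim M Y) \<le> nat (predim M W)"
    using ex_has_least_nat[of ?P X "\<lambda>Y. nat (predim M Y)"] assms by blast
  have "strong_set M Y" unfolding strong_set_def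
  proof (intro conjI allI impI)
    fix W assume W: "finite W" "Y \<subseteq> W" "W \<subseteq> univ M"
    then have "nat (predim M Y) \<le> nat (predim M W)" "0 \<le> predim M W" using Y assms by (auto simp: admissible_def)
    then show "predim M Y \<le> predim M W" by simp
  qed (use Y in auto)
  then show ?thesis using that Y by blast
qed

text \<open>The required degree of strongness may depend on the size of the closure, because the
  predimension drops at most \<open>c * card X\<close> times.\<close>

lemma strong_upto_closure:
  fixes \<mu> F :: "nat \<Rightarrow> nat"
  assumes M: "admissible M" "finite X" "X \<subseteq> univ M"
    and F: "mono F" "\<And>x. x + \<mu> x \<le> F x"
  obtains Y where "X \<subseteq> Y" "strong_upto (\<mu> (card Y)) M Y" "card Y \<le> (F ^^ (c * card X)) (card X)"
proof -
  have F_ge: "x \<le> F x" for x using F(2)[of x] by simp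
  have F_iter: "(F ^^ j) x \<le> (F ^^ k) x" if "j \<le> k" for j k x
    using that by (induction k) (auto simp: le_Suc_eq intro: order_trans[OF _ F_ge])
  \<comment> \<open>The invariant ties the size to the drop so far: each failure of strongness
    lowers the value by at least one unit and enlarges the set by one application of
    \<open>F\<close>.\<close>
  let ?P = "\<lambda>Y. finite Y \<and> X \<subseteq> Y \<and> Y \<subseteq> univ M \<and> predim M Y \<le> predim M X \<and>
     card Y \<le> (F ^^ nat (predim M X - predim M Y)) (card X)"
  obtain Y where Y: "?P Y" "\<And>W. ?P W \<Longrightarrow> nat (predim M Y) \<le> nat (predim M W)"
    using ex_has_least_nat[of ?P X "\<lambda>Y. nat (predim M Y)"] assms by auto
  have "strong_upto (\<mu> (card Y)) M Y" unfolding strong_upto_def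
  proof (intro conjI allI impI)
    fix W assume W: "finite W" "Y \<subseteq> W" "W \<subseteq> univ M" "card (W - Y) \<le> \<mu> (card Y)"
    show "predim M Y \<le> predim M W"
    proof (rule ccontr)
      assume less: "\<not> predim M Y \<le> predim M W"
      let ?k = "nat (predim M X - predim M Y)"
      have "card W = card Y + card (W - Y)" using W Y
        by (metis card_Diff_subset card_mono le_add_diff_inverse)
      also have "\<dots> \<le> F (card Y)" using W F(2)[of "card Y"] by linarith
      also have "\<dots> \<le> F ((F ^^ ?k) (card X))" using Y(1) F(1) by (simp add: monoD)
      also have "\<dots> = (F ^^ Suc ?k) (card X)" by simp
      also have "\<dots> \<le> (F ^^ nat (predim M X - predim M W)) (card X)" using less Y(1) by (intro F_iter) linarith
      finally have "card W \<le> (F ^^ nat (predim M X - predim M W)) (card X)" .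
      moreover have "X \<subseteq> W" using W Y(1) by blast
      moreover have "predim M W \<le> predim M X" using less Y(1) by linarith
      ultimately have "?P W" using W by blast
      then have "nat (predim M Y) \<le> nat (predim M W)" by (rule Y)
      moreover have "0 \<le> predim M W" using M W by (simp add: admissible_def)
      ultimately show False using less by simp
    qed
  qed (use Y in auto)
  moreover have "card Y \<le> (F ^^ (c * card X)) (card X)"
  proof -
    have "0 \<le> predim M Y" using M Y by (simp add: admissible_def)
    then have "nat (predim M X - predim M Y) \<le> c * card X" using predim_le_card[of M X] by (simp add: nat_le_iff)
    then show ?thesis using F_iter Y(1) order_trans by blast
  qed
  ultimately show ?thesis using that Y by blast
qed

end

subsection \<open>Embeddings preserving strong sets are elementary\<close>

primrec free_vars :: "'r fm \<Rightarrow> nat set" where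
  "free_vars (Eq i j) = {i, j}"
| "free_vars (Rel E is) = set is"
| "free_vars (Neg p) = free_vars p"
| "free_vars (Conj p q) = free_vars p \<union> free_vars q"
| "free_vars (Exi i p) = free_vars p - {i}"

lemma finite_free_vars: "finite (free_vars p)"
  by (induction p) auto

context rational_weights
begin

lemma model_admissible: "model_S L ar \<alpha> M \<Longrightarrow> admissible M"
  by (simp add: model_S_iff)

lemma model_extend:
  fixes B :: "('r, nat) lstruct"
  assumes "model_S L ar \<alpha> M" "admissible B" "finite (univ B)" "strong_set B X" "embedding L f (induced B X) M"
  obtains g where "embedding L g B M" "\<And>x. x \<in> X \<Longrightarrow> g x = f x"
  using assms unfolding model_S_iff extension_property_def by blast

lemma strong_upto_mono: "strong_upto k M X \<Longrightarrow> j \<le> k \<Longrightarrow> strong_upto j M X"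
  unfolding strong_upto_def by (meson order_trans)

text \<open>Inside \<open>B\<close> no test adds more than \<open>k\<close> points.\<close>

lemma strong_upto_small:
  assumes e: "embedding L f B M" and X: "X \<subseteq> univ B" and fin: "finite (univ B)"
    and s: "strong_upto k M (f ` X)" and k: "card (univ B) \<le> k"
  shows "strong_set B X"
  unfolding strong_set_def
proof (intro conjI allI impI X)
  show "finite X" using X fin by (rule finite_subset)
  fix Y assume Y: "finite Y" "X \<subseteq> Y" "Y \<subseteq> univ B"
  have "card (f ` Y - f ` X) \<le> card (f ` Y)" using Y by (intro card_mono) auto
  also have "\<dots> \<le> card Y" by (rule card_image_le[OF Y(1)])
  also have "\<dots> \<le> card (univ B)" by (rule card_mono[OF fin Y(3)])
  finally have "card (f ` Y - f ` X) \<le> k" using k by simp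
  moreover have "f ` Y \<subseteq> univ M" using e Y by (auto simp: embedding_def)
  ultimately have "predim M (f ` X) \<le> predim M (f ` Y)"
    using s Y unfolding strong_upto_def by (meson finite_imageI image_mono)
  then show "predim B X \<le> predim B Y" using predim_embedding[OF e] X Y by simp
qed

lemma substructure_pullback:
  assumes e: "embedding L f A M" and A: "lstructure L ar A" "univ A \<subseteq> S"
    and h: "\<And>x. x \<in> univ A \<Longrightarrow> h x = f x"
  shows "substructure L A (pullback L S h M)"
  unfolding substructure_def
proof (intro conjI ballI)
  show "univ A \<subseteq> univ (pullback L S h M)" using A by simp
  fix E assume E: "E \<in> L"
  have "xs \<in> rel A E \<longleftrightarrow> map h xs \<in> rel M E" if "set xs \<subseteq> univ A" for xs
  proof -
    have m: "map h xs = map f xs" using h that by (intro map_cong) auto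
    show ?thesis unfolding m using e E that unfolding embedding_def by blast
  qed
  moreover have "set xs \<subseteq> univ A" if "xs \<in> rel A E" for xs
    using A(1) E that by (simp add: lstructure_def)
  ultimately show "rel A E = {xs \<in> rel (pullback L S h M) E. set xs \<subseteq> univ A}"
    using E A(2) by (auto simp: rel_pullback)
qed

text \<open>Joined with the image of \<open>C\<close>, the test set is a small extension of the
  image of \<open>X\<close> and cannot lie below it, while the image of \<open>C\<close> has exactly
  that value. Submodularity then compares \<open>D\<close> with its trace on the image of
  \<open>C\<close>, where \<open>A\<close> is strong up to \<open>k\<close>.\<close>

lemma strong_upto_zero_extension:
  assumes e: "embedding L g C N" and fin: "finite (univ C)"
    and sub: "X \<subseteq> A" "A \<subseteq> univ C"
    and predim: "predim C (univ C) = predim C X" and mA: "strong_upto k C A"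
    and mN: "strong_upto (card (univ C) + k) N (g ` X)"
  shows "strong_upto k N (g ` A)"
  unfolding strong_upto_def
proof (intro conjI allI impI)
  let ?G = "g ` univ C"
  have inj: "inj_on g (univ C)" and G: "?G \<subseteq> univ N" using e by (auto simp: embedding_def)
  show "finite (g ` A)" "g ` A \<subseteq> univ N" using fin sub G finite_subset[OF sub(2) fin] by auto
  fix D assume D: "finite D" "g ` A \<subseteq> D" "D \<subseteq> univ N" "card (D - g ` A) \<le> k"
  have "D \<union> ?G - g ` X \<subseteq> ?G \<union> (D - g ` A)" using sub by auto
  then have "card (D \<union> ?G - g ` X) \<le> card (?G \<union> (D - g ` A))"
    using D fin by (intro card_mono) auto
  also have "\<dots> \<le> card ?G + card (D - g ` A)" by (rule card_Un_le)
  also have "\<dots> \<le> card (univ C) + k" using D(4) card_image_le[OF fin, of g] by simp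
  finally have "card (D \<union> ?G - g ` X) \<le> card (univ C) + k" .
  moreover have "finite (D \<union> ?G)" "g ` X \<subseteq> D \<union> ?G" "D \<union> ?G \<subseteq> univ N" using D G fin sub by auto
  ultimately have 1: "predim N (g ` X) \<le> predim N (D \<union> ?G)" using mN unfolding strong_upto_def by blast
  have 2: "predim N ?G = predim N (g ` X)" using predim predim_embedding[OF e order_refl] predim_embedding[OF e, of X] sub by simp
  have 3: "predim N (D \<union> ?G) + predim N (D \<inter> ?G) \<le> predim N D + predim N ?G"
    using D fin by (intro predim_submodular) auto
  define W where "W = {x \<in> univ C. g x \<in> D}"
  have gW: "g ` W = D \<inter> ?G" by (auto simp: W_def)
  have W: "W \<subseteq> univ C" "A \<subseteq> W" "finite W" using sub D fin by (auto simp: W_def)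
  have "g ` (W - A) \<subseteq> D - g ` A"
  proof
    fix y assume "y \<in> g ` (W - A)"
    then obtain x where x: "x \<in> W" "x \<notin> A" "y = g x" by blast
    then have "x \<in> univ C" using W by blast
    then have "g x \<notin> g ` A" using x(2) inj_on_image_mem_iff[OF inj _ sub(2)] by simp
    then show "y \<in> D - g ` A" using x(1,3) by (simp add: W_def)
  qed
  then have "card (g ` (W - A)) \<le> k" using D card_mono[of "D - g ` A"] by (meson finite_Diff order_trans)
  moreover have "card (g ` (W - A)) = card (W - A)" using inj W by (intro card_image) (auto intro: inj_on_subset)
  ultimately have "predim C A \<le> predim C W" using mA W by (simp add: strong_upto_def)
  then have "predim N (g ` A) \<le> predim N (D \<inter> ?G)"
    using predim_embedding[OF e, of A] predim_embedding[OF e W(1)] sub gW by simp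
  with 1 2 3 show "predim N (g ` A) \<le> predim N D" by linarith
qed

text \<open>A position of the game. The strongness demanded is a function of the size of
  \<open>A\<close>, since that size is unknown when the bound for a formula is fixed.\<close>

definition strong_copies :: "(nat \<Rightarrow> nat) \<Rightarrow> ('r, 'a) lstruct \<Rightarrow> ('r, 'b) lstruct \<Rightarrow>
    ('r, nat) lstruct \<Rightarrow> (nat \<Rightarrow> 'a) \<Rightarrow> (nat \<Rightarrow> 'b) \<Rightarrow> bool" where
  "strong_copies \<mu> M N A h1 h2 \<longleftrightarrow> admissible A \<and> finite (univ A) \<and>
     embedding L h1 A M \<and> embedding L h2 A N \<and>
     strong_upto (\<mu> (card (univ A))) M (h1 ` univ A) \<and> strong_upto (\<mu> (card (univ A))) N (h2 ` univ A)"

lemma strong_copies_commute: "strong_copies \<mu> M N A h1 h2 \<longleftrightarrow> strong_copies \<mu> N M A h2 h1"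
  by (auto simp: strong_copies_def)

lemma strong_copies_mono:
  "strong_copies \<mu> M N A h1 h2 \<Longrightarrow> (\<And>k. \<nu> k \<le> \<mu> k) \<Longrightarrow> strong_copies \<nu> M N A h1 h2"
  by (auto simp: strong_copies_def intro: strong_upto_mono)

definition absorbs :: "(nat \<Rightarrow> nat) \<Rightarrow> (nat \<Rightarrow> nat) \<Rightarrow> ('r, 'a) lstruct \<Rightarrow> ('r, 'b) lstruct \<Rightarrow> bool" where
  "absorbs \<mu>' \<mu> M N \<longleftrightarrow> (\<forall>A h1 h2. \<forall>a\<in>univ M. strong_copies \<mu>' M N A h1 h2 \<longrightarrow>
     (\<exists>A' h1' h2'. strong_copies \<mu> M N A' h1' h2' \<and> univ A \<subseteq> univ A' \<and>
        (\<forall>x\<in>univ A. h1' x = h1 x \<and> h2' x = h2 x) \<and> a \<in> h1' ` univ A'))"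

text \<open>A pair of \<open>\<mu>'\<close>-strong copies of \<open>A\<close> can absorb any further point of \<open>M\<close> at the price of
  falling back to \<open>\<mu>\<close>-strong copies: one round of the Ehrenfeucht--Fraisse game.\<close>

lemma game_step:
  fixes \<mu> :: "nat \<Rightarrow> nat"
  assumes "L \<noteq> {}"
  shows "\<exists>\<mu>'. \<forall>(M :: ('r, 'a) lstruct) (N :: ('r, 'b) lstruct).
     model_S L ar \<alpha> M \<longrightarrow> model_S L ar \<alpha> N \<longrightarrow> absorbs \<mu>' \<mu> M N"
proof -
  \<comment> \<open>The running sum makes \<open>F\<close> monotone for arbitrary
    \<open>\<mu>\<close>.\<close>
  define F where "F x = x + (\<Sum>i\<le>x. \<mu> i)" for x
  have F: "mono F" "x + \<mu> x \<le> F x" for x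
    unfolding F_def by (auto intro!: monoI add_mono sum_mono2 member_le_sum)
  obtain nn where nn: "\<And>k (A :: ('r, nat) lstruct) X. admissible A \<Longrightarrow> finite (univ A) \<Longrightarrow> strong_set A X \<Longrightarrow>
     \<exists>C. zero_extension_over k (card (univ A) + nn k * (c * card (univ A))) A X C"
    using zero_extension[OF assms] by metis
  \<comment> \<open>Bounds the size of a closure of at most \<open>s + 1\<close> points; summing
    over all sizes stands in for a maximum.\<close>
  define t where "t s = (\<Sum>j\<le>s + 1. (F ^^ (c * j)) j)" for s
  \<comment> \<open>Covers, for every possible closure size \<open>k\<close>, the size of the
    zero-extension and the strongness that it has to pass on.\<close>
  define \<mu>' where "\<mu>' s = (\<Sum>k\<le>t s. k + nn (\<mu> k) * (c * k) + \<mu> k)" for s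
  show ?thesis
    unfolding absorbs_def
  proof (rule exI[of _ \<mu>'], intro allI ballI impI)
    fix M :: "('r, 'a) lstruct" and N :: "('r, 'b) lstruct" and A :: "('r, nat) lstruct" and h1 h2 a
    assume M: "model_S L ar \<alpha> M" and N: "model_S L ar \<alpha> N" and a: "a \<in> univ M"
      and "strong_copies \<mu>' M N A h1 h2"
    then have A: "admissible A" "finite (univ A)" and e1: "embedding L h1 A M" and e2: "embedding L h2 A N"
      and m1: "strong_upto (\<mu>' (card (univ A))) M (h1 ` univ A)"
      and m2: "strong_upto (\<mu>' (card (univ A))) N (h2 ` univ A)" by (auto simp: strong_copies_def)
    have gM: "admissible M" using M by (rule model_admissible)
    let ?X = "insert a (h1 ` univ A)"
    have X: "finite ?X" "?X \<subseteq> univ M" using a A e1 by (auto simp: embedding_def)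
    obtain Y where Y: "?X \<subseteq> Y" "strong_upto (\<mu> (card Y)) M Y" "card Y \<le> (F ^^ (c * card ?X)) (card ?X)"
      using strong_upto_closure[OF gM X F] by blast
    have "card (h1 ` univ A) \<le> card (univ A)" by (rule card_image_le[OF A(2)])
    then have "card ?X \<le> card (univ A) + 1" using card_insert_le_m1 by (metis card_insert_if finite_imageI A(2) add.commute le_SucI plus_1_eq_Suc Suc_le_mono)
    then have "(F ^^ (c * card ?X)) (card ?X) \<le> t (card (univ A))"
      unfolding t_def by (intro member_le_sum[of _ _ "\<lambda>j. (F ^^ (c * j)) j"]) auto
    then have Yt: "card Y \<le> t (card (univ A))" using Y(3) by simp
    have Yfin: "finite Y" "Y \<subseteq> univ M" using Y(2) by (auto simp: strong_upto_def)
    have \<mu>'_ge: "card Y + nn (\<mu> (card Y)) * (c * card Y) + \<mu> (card Y) \<le> \<mu>' (card (univ A))"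
      unfolding \<mu>'_def using Yt
      by (intro member_le_sum[of _ _ "\<lambda>k. k + nn (\<mu> k) * (c * k) + \<mu> k"]) auto
    have "inj_on h1 (univ A)" "h1 ` univ A \<subseteq> Y" using e1 Y by (auto simp: embedding_def)
    then obtain S h where S: "univ A \<subseteq> S" "finite S" "bij_betw h S Y" "\<And>x. x \<in> univ A \<Longrightarrow> h x = h1 x"
      using nat_copy[OF A(2) finite.emptyI Yfin(1)] by metis
    define A' where "A' = pullback L S h M"
    have hS: "inj_on h S" "h ` S = Y" using S(3) by (auto simp: bij_betw_def)
    have U: "univ A' = S" by (simp add: A'_def)
    have eh: "embedding L h A' M" unfolding A'_def using hS Yfin by (intro embedding_pullback) auto
    have gA': "admissible A'" unfolding A'_def using hS Yfin by (intro admissible_pullback gM) auto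
    have cS: "card S = card Y" using S(3) by (rule bij_betw_same_card)
    have subA: "substructure L A A'" unfolding A'_def
      using substructure_pullback[OF e1 _ S(1,4)] A by (simp add: admissible_def sym_structure_def)
    have "h ` univ A = h1 ` univ A" using S(4) by auto
    then have sA: "strong_set A' (univ A)"
      using strong_upto_small[OF eh, of "univ A"] m1 \<mu>'_ge S by (simp add: U cS)
    \<comment> \<open>\<open>A'\<close> may exceed \<open>A\<close> by more than \<open>N\<close>
      can hold strongly. Padded to a zero-extension \<open>C\<close> of \<open>A\<close>, it gets
      its strongness in \<open>N\<close> from the copy of \<open>A\<close>, and the long gadgets
      keep it strong up to the desired bound inside \<open>C\<close>.\<close>
    obtain C where C: "admissible C" "substructure L A' C" "finite (univ C)"
        "card (univ C) \<le> card S + nn (\<mu> (card S)) * (c * card S)" "predim C (univ C) = predim C (univ A)"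
        "strong_set C (univ A)" "strong_upto (\<mu> (card S)) C S"
      using nn[OF gA' _ sA, of "\<mu> (card S)"] S(2) unfolding U zero_extension_over_def by blast
    have subAC: "substructure L A C" using subA C(2) by (rule substructure_trans)
    have "substructure L (induced C (univ A)) A"
      using substructure_mid[OF substructure_induced subAC] subAC by (simp add: substructure_def)
    then have "embedding L h2 (induced C (univ A)) N" using e2 by (rule embedding_restrict[rotated])
    then obtain g where g: "embedding L g C N" "\<And>x. x \<in> univ A \<Longrightarrow> g x = h2 x"
      using model_extend[OF N C(1,3,6)] by blast
    have "g ` univ A = h2 ` univ A" using g(2) by auto
    then have "strong_upto (card (univ C) + \<mu> (card S)) N (g ` univ A)"
      using strong_upto_mono[OF m2] \<mu>'_ge C(4) cS by simp
    then have mg: "strong_upto (\<mu> (card S)) N (g ` S)"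
      using strong_upto_zero_extension[OF g(1) C(3) S(1) _ C(5,7)] C(2) by (simp add: substructure_def U)
    have "strong_copies \<mu> M N A' h g"
      unfolding strong_copies_def
    proof (intro conjI)
      show "admissible A'" by (rule gA')
      show "finite (univ A')" using S by (simp add: U)
      show "embedding L h A' M" by (rule eh)
      show "embedding L g A' N" using embedding_restrict[OF g(1) C(2)] .
      show "strong_upto (\<mu> (card (univ A'))) M (h ` univ A')" using Y(2) hS cS by (simp add: U)
      show "strong_upto (\<mu> (card (univ A'))) N (g ` univ A')" using mg by (simp add: U)
    qed
    moreover have "\<forall>x\<in>univ A. h x = h1 x \<and> g x = h2 x" using S(4) g(2) by blast
    moreover have "a \<in> h ` univ A'" using Y(1) hS by (simp add: U)
    ultimately show "\<exists>A' h1' h2'. strong_copies \<mu> M N A' h1' h2' \<and> univ A \<subseteq> univ A' \<and>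
        (\<forall>x\<in>univ A. h1' x = h1 x \<and> h2' x = h2 x) \<and> a \<in> h1' ` univ A'"
      using S(1) U by blast
  qed
qed

definition copies_agree :: "(nat \<Rightarrow> nat) \<Rightarrow> 'r fm \<Rightarrow> ('r, 'a) lstruct \<Rightarrow> ('r, 'b) lstruct \<Rightarrow> bool" where
  "copies_agree \<mu> p M N \<longleftrightarrow> (\<forall>A h1 h2 v w. strong_copies \<mu> M N A h1 h2 \<longrightarrow>
     (\<forall>i\<in>free_vars p. \<exists>x\<in>univ A. v i = h1 x \<and> w i = h2 x) \<longrightarrow> (sat M v p \<longleftrightarrow> sat N w p))"

lemma copies_agreeD:
  assumes "copies_agree \<mu> p M N" "strong_copies \<mu> M N A h1 h2"
    "\<And>i. i \<in> free_vars p \<Longrightarrow> \<exists>x\<in>univ A. v i = h1 x \<and> w i = h2 x"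
  shows "sat M v p \<longleftrightarrow> sat N w p"
  using assms unfolding copies_agree_def by blast

text \<open>The bound is chosen from the formula, before the models. A quantifier enlarges it by one
  round of the game in each direction.\<close>

lemma strong_copies_agree:
  assumes L: "L \<noteq> {}"
  shows "lformula L ar p \<Longrightarrow> \<exists>\<mu>. \<forall>(M :: ('r, 'a) lstruct) (N :: ('r, 'b) lstruct).
     model_S L ar \<alpha> M \<longrightarrow> model_S L ar \<alpha> N \<longrightarrow> copies_agree \<mu> p M N"
proof (induction p)
  case (Eq i j)
  have "copies_agree (\<lambda>_. 0) (Eq i j) M N" for M :: "('r, 'a) lstruct" and N :: "('r, 'b) lstruct"
    unfolding copies_agree_def
  proof (intro allI impI)
    fix A h1 h2 v w
    assume "strong_copies (\<lambda>_. 0) M N A h1 h2"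
      and v: "\<forall>i\<in>free_vars (Eq i j :: 'r fm). \<exists>x\<in>univ A. v i = h1 x \<and> w i = h2 x"
    then have "inj_on h1 (univ A)" "inj_on h2 (univ A)" by (auto simp: strong_copies_def embedding_def)
    moreover obtain x y where xy: "x \<in> univ A" "y \<in> univ A" "v i = h1 x" "w i = h2 x" "v j = h1 y" "w j = h2 y"
      using v by auto
    ultimately have "h1 x = h1 y \<longleftrightarrow> x = y" "h2 x = h2 y \<longleftrightarrow> x = y" by (simp_all add: inj_on_eq_iff)
    then show "sat M v (Eq i j) \<longleftrightarrow> sat N w (Eq i j)" using xy by simp
  qed
  then show ?case by blast
next
  case (Rel E "is")
  then have E: "E \<in> L" by simp
  have "copies_agree (\<lambda>_. 0) (Rel E is) M N" for M :: "('r, 'a) lstruct" and N :: "('r, 'b) lstruct"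
    unfolding copies_agree_def
  proof (intro allI impI)
    fix A h1 h2 v w
    assume "strong_copies (\<lambda>_. 0) M N A h1 h2"
      and v: "\<forall>i\<in>free_vars (Rel E is). \<exists>x\<in>univ A. v i = h1 x \<and> w i = h2 x"
    then have e: "embedding L h1 A M" "embedding L h2 A N" by (auto simp: strong_copies_def)
    obtain u where u: "\<And>i. i \<in> set is \<Longrightarrow> u i \<in> univ A \<and> v i = h1 (u i) \<and> w i = h2 (u i)"
      using v by (auto simp: Bex_def dest!: bchoice)
    have s: "set (map u is) \<subseteq> univ A" using u by auto
    have m: "map v is = map h1 (map u is)" "map w is = map h2 (map u is)" using u by auto
    have "map u is \<in> rel A E \<longleftrightarrow> map h1 (map u is) \<in> rel M E"
      "map u is \<in> rel A E \<longleftrightarrow> map h2 (map u is) \<in> rel N E"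
      using e E s unfolding embedding_def by blast+
    then show "sat M v (Rel E is) \<longleftrightarrow> sat N w (Rel E is)" unfolding sat.simps m by blast
  qed
  then show ?case by blast
next
  case (Neg p)
  then have "lformula L ar p" by simp
  from Neg.IH[OF this] show ?case by (simp add: copies_agree_def)
next
  case (Conj p q)
  then have pq: "lformula L ar p" "lformula L ar q" by auto
  obtain \<mu>1 where \<mu>1: "\<And>(M :: ('r, 'a) lstruct) (N :: ('r, 'b) lstruct).
     model_S L ar \<alpha> M \<Longrightarrow> model_S L ar \<alpha> N \<Longrightarrow> copies_agree \<mu>1 p M N"
    using Conj.IH(1)[OF pq(1)] by (elim exE) blast
  obtain \<mu>2 where \<mu>2: "\<And>(M :: ('r, 'a) lstruct) (N :: ('r, 'b) lstruct).
     model_S L ar \<alpha> M \<Longrightarrow> model_S L ar \<alpha> N \<Longrightarrow> copies_agree \<mu>2 q M N"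
    using Conj.IH(2)[OF pq(2)] by (elim exE) blast
  define \<mu> where "\<mu> s = max (\<mu>1 s) (\<mu>2 s)" for s
  have "copies_agree \<mu> (Conj p q) M N"
    if MN: "model_S L ar \<alpha> M" "model_S L ar \<alpha> N"
    for M :: "('r, 'a) lstruct" and N :: "('r, 'b) lstruct"
    unfolding copies_agree_def
  proof (intro allI impI)
    fix A h1 h2 v w
    assume s: "strong_copies \<mu> M N A h1 h2"
      and v: "\<forall>i\<in>free_vars (Conj p q). \<exists>x\<in>univ A. v i = h1 x \<and> w i = h2 x"
    have "strong_copies \<mu>1 M N A h1 h2" "strong_copies \<mu>2 M N A h1 h2"
      using strong_copies_mono[OF s] by (simp_all add: \<mu>_def)
    then have "sat M v p \<longleftrightarrow> sat N w p" "sat M v q \<longleftrightarrow> sat N w q"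
      using copies_agreeD[OF \<mu>1[OF MN]] copies_agreeD[OF \<mu>2[OF MN]] v by simp_all
    then show "sat M v (Conj p q) \<longleftrightarrow> sat N w (Conj p q)" by simp
  qed
  then show ?case by blast
next
  case (Exi i p)
  then have p: "lformula L ar p" by simp
  obtain \<mu> where \<mu>: "\<And>(M :: ('r, 'a) lstruct) (N :: ('r, 'b) lstruct).
     model_S L ar \<alpha> M \<Longrightarrow> model_S L ar \<alpha> N \<Longrightarrow> copies_agree \<mu> p M N"
    using Exi.IH[OF p] by (elim exE) blast
  obtain \<mu>1 where \<mu>1: "\<And>(M :: ('r, 'a) lstruct) (N :: ('r, 'b) lstruct).
     model_S L ar \<alpha> M \<Longrightarrow> model_S L ar \<alpha> N \<Longrightarrow> absorbs \<mu>1 \<mu> M N"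
    using game_step[OF L, where ?'a = 'a and ?'b = 'b, of \<mu>] by (elim exE) blast
  \<comment> \<open>The converse round needs its own instance, with the two universe types
    exchanged; the resulting position is then turned around by
    \<open>strong_copies_commute\<close>.\<close>
  from game_step[OF L, where ?'a = 'b and ?'b = 'a, of \<mu>]
  obtain \<mu>2 where \<mu>2: "\<forall>(N :: ('r, 'b) lstruct) (M :: ('r, 'a) lstruct).
     model_S L ar \<alpha> N \<longrightarrow> model_S L ar \<alpha> M \<longrightarrow> absorbs \<mu>2 \<mu> N M" by (rule exE)
  define \<mu>' where "\<mu>' s = max (\<mu>1 s) (\<mu>2 s)" for s
  have "copies_agree \<mu>' (Exi i p) M N"
    if MN: "model_S L ar \<alpha> M" "model_S L ar \<alpha> N"
    for M :: "('r, 'a) lstruct" and N :: "('r, 'b) lstruct"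
    unfolding copies_agree_def
  proof (intro allI impI)
    fix A h1 h2 v w
    assume s: "strong_copies \<mu>' M N A h1 h2"
      and v: "\<forall>j\<in>free_vars (Exi i p). \<exists>x\<in>univ A. v j = h1 x \<and> w j = h2 x"
    have s1: "strong_copies \<mu>1 M N A h1 h2" and "strong_copies \<mu>2 M N A h1 h2"
      using strong_copies_mono[OF s] by (simp_all add: \<mu>'_def)
    from this(2) have s2: "strong_copies \<mu>2 N M A h2 h1" by (subst strong_copies_commute)
    have step: "sat M (v(i := h1' y)) p \<longleftrightarrow> sat N (w(i := h2' y)) p"
      if A': "strong_copies \<mu> M N A' h1' h2'" "univ A \<subseteq> univ A'"
        "\<forall>x\<in>univ A. h1' x = h1 x \<and> h2' x = h2 x" "y \<in> univ A'"
      for A' h1' h2' y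
    proof (rule copies_agreeD[OF \<mu>[OF MN] A'(1)])
      fix j assume j: "j \<in> free_vars p"
      show "\<exists>x\<in>univ A'. (v(i := h1' y)) j = h1' x \<and> (w(i := h2' y)) j = h2' x"
      proof (cases "j = i")
        case True then show ?thesis using A'(4) by auto
      next
        case False
        then obtain x where "x \<in> univ A" "v j = h1 x" "w j = h2 x" using v j by auto
        then show ?thesis using False A'(2,3) by (intro bexI[of _ x]) auto
      qed
    qed
    show "sat M v (Exi i p) \<longleftrightarrow> sat N w (Exi i p)"
    proof
      assume "sat M v (Exi i p)"
      then obtain a where a: "a \<in> univ M" "sat M (v(i := a)) p" by auto
      obtain A' h1' h2' where A': "strong_copies \<mu> M N A' h1' h2'" "univ A \<subseteq> univ A'"
        "\<forall>x\<in>univ A. h1' x = h1 x \<and> h2' x = h2 x" "a \<in> h1' ` univ A'"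
        using \<mu>1[OF MN, unfolded absorbs_def, rule_format, OF a(1) s1] by (elim exE conjE)
      obtain y where y: "y \<in> univ A'" "a = h1' y" using A'(4) by blast
      have "sat N (w(i := h2' y)) p" using step[OF A'(1-3) y(1)] a y by simp
      moreover have "h2' y \<in> univ N" using A'(1) y by (auto simp: strong_copies_def embedding_def)
      ultimately show "sat N w (Exi i p)" by auto
    next
      assume "sat N w (Exi i p)"
      then obtain a where a: "a \<in> univ N" "sat N (w(i := a)) p" by auto
      obtain A' h2' h1' where A': "strong_copies \<mu> N M A' h2' h1'" "univ A \<subseteq> univ A'"
        "\<forall>x\<in>univ A. h2' x = h2 x \<and> h1' x = h1 x" "a \<in> h2' ` univ A'"
        using \<mu>2[rule_format, OF MN(2,1), unfolded absorbs_def, rule_format, OF a(1) s2] by (elim exE conjE)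
      obtain y where y: "y \<in> univ A'" "a = h2' y" using A'(4) by blast
      have "strong_copies \<mu> M N A' h1' h2'" using A'(1) by (subst strong_copies_commute)
      moreover have "\<forall>x\<in>univ A. h1' x = h1 x \<and> h2' x = h2 x" using A'(3) by simp
      ultimately have "sat M (v(i := h1' y)) p" using step[of A' h1' h2' y] A'(2) a y by simp
      moreover have "h1' y \<in> univ M" using A'(1) y by (auto simp: strong_copies_def embedding_def)
      ultimately show "sat M v (Exi i p)" by auto
    qed
  qed
  then show ?case by blast
qed

text \<open>The parameters lie in a strong set. It and its image are strong up to every bound, in
  particular up to the bound that belongs to the formula.\<close>

lemma strong_embedding_elementary:
  fixes M :: "('r, 'a) lstruct" and N :: "('r, 'b) lstruct"
  assumes L: "L \<noteq> {}" and M: "model_S L ar \<alpha> M" and N: "model_S L ar \<alpha> N"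
    and e: "embedding L f M N" and s: "\<And>X. strong_set M X \<Longrightarrow> strong_set N (f ` X)"
  shows "elementary_embedding L ar f M N"
  unfolding elementary_embedding_def
proof (intro conjI allI impI)
  show "f ` univ M \<subseteq> univ N" using e by (simp add: embedding_def)
  fix p :: "'r fm" and v :: "nat \<Rightarrow> 'a" assume p: "lformula L ar p" and v: "range v \<subseteq> univ M"
  have gM: "admissible M" using M by (rule model_admissible)
  have X: "finite (v ` free_vars p)" "v ` free_vars p \<subseteq> univ M" using v finite_free_vars by auto
  obtain Y where Y: "v ` free_vars p \<subseteq> Y" "strong_set M Y" using strong_closure[OF gM X] by blast
  have Yfin: "finite Y" "Y \<subseteq> univ M" using Y(2) by (auto simp: strong_set_def)
  obtain A :: "('r, nat) lstruct" and h where A: "admissible A" "finite (univ A)"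
    and eh: "embedding L h A M" and hY: "h ` univ A = Y"
    using finite_copy[OF gM Yfin] by blast
  have e2: "embedding L (f \<circ> h) A N" using eh e by (rule embedding_comp)
  obtain \<mu> where \<mu>: "copies_agree \<mu> p M N"
    using strong_copies_agree[OF L p, where ?'a = 'a and ?'b = 'b] M N by (elim exE) blast
  have "(f \<circ> h) ` univ A = f ` Y" using hY by (auto simp: image_comp[symmetric])
  then have "strong_copies \<mu> M N A h (f \<circ> h)"
    using A eh e2 hY strong_set_strong_upto[OF Y(2)] strong_set_strong_upto[OF s[OF Y(2)]]
    by (simp add: strong_copies_def)
  then show "sat M v p \<longleftrightarrow> sat N (f \<circ> v) p"
  proof (rule copies_agreeD[OF \<mu>])
    fix i assume "i \<in> free_vars p"
    then have "v i \<in> h ` univ A" using Y(1) hY by blast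
    then show "\<exists>x\<in>univ A. v i = h x \<and> (f \<circ> v) i = (f \<circ> h) x" by force
  qed
qed

end

subsection \<open>Back and forth\<close>

context rational_weights
begin

text \<open>Prepares the free amalgam of \<open>A\<close> with a part of \<open>N\<close>, whose
  points are of another type: the part is renamed to natural numbers and glued to \<open>A\<close>
  along \<open>X\<close>.\<close>

lemma copy_over:
  fixes A :: "('r, nat) lstruct" and N :: "('r, 'b) lstruct"
  assumes A: "lstructure L ar A" "finite (univ A)" "X \<subseteq> univ A" and N: "admissible N"
    and f: "embedding L f (induced A X) N" and Y: "finite Y" "Y \<subseteq> univ N" "f ` X \<subseteq> Y"
  obtains S h where "finite S" "univ A \<inter> S = X" "bij_betw h S Y" "\<And>x. x \<in> X \<Longrightarrow> h x = f x"
    "embedding L h (pullback L S h N) N" "admissible (pullback L S h N)"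
    "\<And>E. E \<in> L \<Longrightarrow>
       {xs \<in> rel A E. set xs \<subseteq> S} = {xs \<in> rel (pullback L S h N) E. set xs \<subseteq> univ A}"
proof -
  have "finite X" using A(2,3) finite_subset by blast
  moreover have "inj_on f X" using f by (simp add: embedding_def)
  ultimately obtain S h where S: "X \<subseteq> S" "finite S" "S \<inter> univ A \<subseteq> X" "bij_betw h S Y"
    and hf: "\<And>x. x \<in> X \<Longrightarrow> h x = f x"
    using nat_copy[OF _ A(2) Y(1) _ Y(3)] by metis
  have hS: "inj_on h S" "h ` S = Y" using S(4) by (auto simp: bij_betw_def)
  have AS: "univ A \<inter> S = X" using S A(3) by auto
  have agree: "{xs \<in> rel A E. set xs \<subseteq> S} = {xs \<in> rel (pullback L S h N) E. set xs \<subseteq> univ A}"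
    if E: "E \<in> L" for E
  proof -
    have "xs \<in> rel A E \<longleftrightarrow> map h xs \<in> rel N E" if "set xs \<subseteq> X" for xs
    proof -
      have m: "map h xs = map f xs" using hf that by (intro map_cong) auto
      have "xs \<in> rel (induced A X) E \<longleftrightarrow> map f xs \<in> rel N E"
        using f E that unfolding embedding_def by simp
      then show ?thesis unfolding m using that by (simp add: rel_induced)
    qed
    moreover have "set xs \<subseteq> X \<longleftrightarrow> set xs \<subseteq> univ A \<and> set xs \<subseteq> S" for xs using AS by blast
    moreover have "set xs \<subseteq> univ A" if "xs \<in> rel A E" for xs using A(1) E that by (simp add: lstructure_def)
    ultimately show ?thesis using E by (auto simp: rel_pullback)
  qed
  show ?thesis
  proof (rule that[of S h])
    show "embedding L h (pullback L S h N) N" using hS Y by (intro embedding_pullback) auto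
    show "admissible (pullback L S h N)" using hS Y by (intro admissible_pullback N) auto
  qed (use S AS hf agree in auto)
qed

text \<open>Strongness of \<open>X\<close> in \<open>A\<close> makes the copy of \<open>Y\<close>
  strong in the amalgam. Conversely, if the image of \<open>X\<close> is strong in \<open>N\<close>,
  then \<open>X\<close> is strong in the copy of \<open>Y\<close>, and so \<open>A\<close> is strong
  as well.\<close>

lemma amalgam_over:
  fixes A :: "('r, nat) lstruct" and N :: "('r, 'b) lstruct"
  assumes A: "admissible A" "finite (univ A)" "strong_set A X" and N: "admissible N"
    and f: "embedding L f (induced A X) N" and Y: "finite Y" "Y \<subseteq> univ N" "f ` X \<subseteq> Y"
  obtains C S h where "admissible C" "finite (univ C)" "substructure L A C" "X \<subseteq> S" "h ` S = Y"
    "\<And>x. x \<in> X \<Longrightarrow> h x = f x" "embedding L h (induced C S) N" "strong_set C S"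
    "predim C (univ C) = predim A (univ A) + predim N Y - predim A X"
    "strong_set N (f ` X) \<Longrightarrow> strong_set C (univ A)"
proof -
  have XA: "X \<subseteq> univ A" using A(3) by (simp add: strong_set_def)
  obtain S h where S: "finite S" "univ A \<inter> S = X" "bij_betw h S Y" and hf: "\<And>x. x \<in> X \<Longrightarrow> h x = f x"
    and eB: "embedding L h (pullback L S h N) N" and gB: "admissible (pullback L S h N)"
    and agree: "\<And>E. E \<in> L \<Longrightarrow>
       {xs \<in> rel A E. set xs \<subseteq> S} = {xs \<in> rel (pullback L S h N) E. set xs \<subseteq> univ A}"
    by (rule copy_over[OF admissible_lstructure[OF A(1)] A(2) XA N f Y]) (rule that)
  define B where "B = pullback L S h N"
  note eB = eB[folded B_def] and gB = gB[folded B_def]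
  have U: "univ B = S" by (simp add: B_def)
  have hS: "h ` S = Y" and XS: "X \<subseteq> S" and SX: "S \<inter> univ A = X" using S by (auto simp: bij_betw_def)
  have hX: "h ` X = f ` X" using hf by auto
  have finB: "finite (univ B)" using S by (simp add: U)
  have agree': "{xs \<in> rel B E. set xs \<subseteq> univ A} = {xs \<in> rel A E. set xs \<subseteq> univ B}" if "E \<in> L" for E
    using agree[OF that] by (simp add: B_def)
  let ?C = "amalgam B A"
  note am = amalgam_properties[OF gB finB A(1,2) agree', unfolded U SX, OF _ A(3)]
  have sub: "substructure L (induced ?C S) B"
    using substructure_mid[OF substructure_induced am(2)] by (simp add: U)
  have "predim B S = predim N Y" using predim_embedding[OF eB, of S] hS by (simp add: U)
  then have "predim ?C (univ ?C) = predim A (univ A) + predim N Y - predim A X" using am(6) by (simp add: U)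
  moreover have "strong_set ?C (univ A)" if "strong_set N (f ` X)"
    using am(5) strong_set_embedding[OF eB, of X] XS that by (simp add: U hX)
  ultimately show ?thesis
    using that[OF am(1) _ am(3) XS hS hf embedding_restrict[OF eB sub] am(4)] finB A(2) by simp
qed

lemma embed_zero_extension:
  fixes C :: "('r, nat) lstruct"
  assumes N: "model_S L ar \<alpha> N" and C: "admissible C" "finite (univ C)" "strong_set C S" "predim C (univ C) = predim C S"
    and h: "embedding L h (induced C S) N" "strong_set N (h ` S)"
  obtains k where "embedding L k C N" "\<And>x. x \<in> S \<Longrightarrow> k x = h x"
    "h ` S \<subseteq> k ` univ C" "strong_set N (k ` univ C)" "predim N (k ` univ C) = predim N (h ` S)"
proof -
  obtain k where k: "embedding L k C N" "\<And>x. x \<in> S \<Longrightarrow> k x = h x"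
    using model_extend[OF N C(1-3) h(1)] by blast
  have kS: "k ` S = h ` S" using k(2) by auto
  have SC: "S \<subseteq> univ C" using C(3) by (simp add: strong_set_def)
  then have sub: "h ` S \<subseteq> k ` univ C" unfolding kS[symmetric] by blast
  have eq: "predim N (k ` univ C) = predim N (h ` S)"
    using predim_embedding[OF k(1) order_refl] predim_embedding[OF k(1) SC] C(4) kS by simp
  have "k ` univ C \<subseteq> univ N" using k(1) by (simp add: embedding_def)
  then have "strong_set N (k ` univ C)" using strong_set_same_predim[OF h(2) sub finite_imageI[OF C(2)] _ eq] by blast
  then show ?thesis using that k sub eq by blast
qed

text \<open>\<open>B0\<close> is the room that \<open>N\<close> has for \<open>A\<close>. Enlarge
  the image of \<open>X\<close> to a strong \<open>Y\<close> around \<open>B0\<close> and amalgamate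
  \<open>A\<close> with \<open>Y\<close> over \<open>X\<close>. Since \<open>Y\<close> has at least
  the value of \<open>A\<close>, the amalgam can be lowered to the value of \<open>Y\<close> with
  both parts still strong. As a zero-extension of \<open>Y\<close> it has a strong image in
  \<open>N\<close>, inside which the image of \<open>A\<close> is strong.\<close>

lemma strong_extend:
  fixes A :: "('r, nat) lstruct" and N :: "('r, 'b) lstruct"
  assumes L: "L \<noteq> {}" and N: "model_S L ar \<alpha> N" and A: "admissible A" "finite (univ A)" "strong_set A X"
    and f: "embedding L f (induced A X) N" "strong_set N (f ` X)"
    and B0: "strong_set N B0" "predim A (univ A) \<le> predim N B0"
  obtains g where "embedding L g A N" "\<And>x. x \<in> X \<Longrightarrow> g x = f x" "strong_set N (g ` univ A)"
proof -
  have gN: "admissible N" using N by (rule model_admissible)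
  have B0': "finite (f ` X \<union> B0)" "f ` X \<union> B0 \<subseteq> univ N" using f(2) B0(1) by (auto simp: strong_set_def)
  obtain Y where Y: "f ` X \<union> B0 \<subseteq> Y" "strong_set N Y" using strong_closure[OF gN B0'] by blast
  have Yfin: "finite Y" "Y \<subseteq> univ N" using Y(2) by (auto simp: strong_set_def)
  have "predim N B0 \<le> predim N Y" using B0(1) Y Yfin by (auto simp: strong_set_def)
  then have dlY: "predim A (univ A) \<le> predim N Y" using B0(2) by simp
  have "f ` X \<subseteq> Y" using Y(1) by blast
  then obtain C0 S h where C0: "admissible C0" "finite (univ C0)" "substructure L A C0" "X \<subseteq> S" "h ` S = Y"
    and hf: "\<And>x. x \<in> X \<Longrightarrow> h x = f x" and h: "embedding L h (induced C0 S) N" and sS: "strong_set C0 S"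
    and dlC0: "predim C0 (univ C0) = predim A (univ A) + predim N Y - predim A X"
    and sA: "strong_set N (f ` X) \<Longrightarrow> strong_set C0 (univ A)"
    by (rule amalgam_over[OF A gN f(1) Yfin]) (rule that)
  have dlS: "predim C0 S = predim N Y" using predim_embedding[OF h, of S] C0(5) by (simp add: predim_induced)
  have "predim A X \<le> predim A (univ A)" using A by (simp add: strong_set_def)
  then have "predim N Y \<le> predim C0 (univ C0)" using dlC0 by simp
  moreover have "predim C0 (univ A) \<le> predim N Y" using dlY predim_substructure[OF C0(3) order_refl] by simp
  moreover have "predim C0 S \<le> predim N Y" using dlS by simp
  ultimately obtain C where C: "admissible C" "substructure L C0 C" "finite (univ C)" "predim C (univ C) = predim N Y"
      "strong_set C (univ A)" "strong_set C S"
    using reduce[OF L, of 0] C0(1,2) sA[OF f(2)] sS unfolding reduction_def by blast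
  have SC0: "S \<subseteq> univ C0" using sS by (simp add: strong_set_def)
  have "substructure L (induced C S) (induced C0 S)"
    using substructure_mid[OF substructure_induced substructure_trans[OF substructure_induced[OF SC0] C(2)]]
      C(6) by (simp add: strong_set_def)
  then have h': "embedding L h (induced C S) N" using h by (rule embedding_restrict[rotated])
  have "predim C (univ C) = predim C S" using dlS C(4) predim_substructure[OF C(2) SC0] by simp
  then obtain k where k: "embedding L k C N" "\<And>x. x \<in> S \<Longrightarrow> k x = h x" "strong_set N (k ` univ C)"
    using embed_zero_extension[OF N C(1,3,6) _ h'] Y(2) C0(5) by metis
  have "strong_set (induced N (k ` univ C)) (k ` univ A)"
    by (rule strong_set_embedding_image[OF k(1) C(5)])
  then have "strong_set N (k ` univ A)" using k(3) by (rule strong_set_trans)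
  moreover have "embedding L k A N" using embedding_restrict[OF k(1) substructure_trans[OF C0(3) C(2)]] .
  moreover have "k x = f x" if "x \<in> X" for x using k(2) hf C0(4) that by auto
  ultimately show ?thesis using that by blast
qed

text \<open>Inequality of dimensions in terms of single strong sets, so that finite and infinite
  dimension are treated alike.\<close>

definition dominates :: "('r, 'a) lstruct \<Rightarrow> ('r, 'b) lstruct \<Rightarrow> bool" where
  "dominates N M \<longleftrightarrow> (\<forall>X. strong_set M X \<longrightarrow> (\<exists>Y. strong_set N Y \<and> predim M X \<le> predim N Y))"

definition strong_map :: "('r, 'a) lstruct \<Rightarrow> ('r, 'b) lstruct \<Rightarrow> 'a set \<Rightarrow> ('a \<Rightarrow> 'b) \<Rightarrow> bool" where
  "strong_map M N X g \<longleftrightarrow> strong_set M X \<and> embedding L g (induced M X) N \<and> strong_set N (g ` X)"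

lemma strong_map_empty:
  assumes "admissible M" "admissible N"
  shows "strong_map M N {} g"
proof -
  \<comment> \<open>The empty tuple is the only one to check for the empty map, and arities are at
    least 2.\<close>
  have "[] \<notin> rel M E" "[] \<notin> rel N E" if "E \<in> L" for E
    using assms that ar_ge2[OF that] unfolding admissible_def sym_structure_def lstructure_def by fastforce+
  then show ?thesis using strong_set_empty[OF assms(1)] strong_set_empty[OF assms(2)]
    by (auto simp: strong_map_def embedding_def rel_induced)
qed

lemma strong_map_inverse:
  assumes "strong_map M N X g"
  shows "strong_map N M (g ` X) (inv_into X g)"
proof -
  have e: "embedding L g (induced M X) N" and X: "X \<subseteq> univ M" using assms by (auto simp: strong_map_def strong_set_def)
  have inj: "inj_on g X" using e by (simp add: embedding_def)
  have "embedding L (inv_into X g) (induced N (g ` X)) (induced (induced M X) X)"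
    by (rule embedding_inverse[OF e]) simp
  moreover have "substructure L (induced (induced M X) X) M"
    using substructure_trans[OF substructure_induced substructure_induced[OF X]] by simp
  ultimately have "embedding L (inv_into X g) (induced N (g ` X)) M"
    using embedding_comp[OF _ embedding_substructure] by (fastforce simp: comp_def)
  moreover have "inv_into X g ` (g ` X) = X" using inj by force
  ultimately show ?thesis using assms by (simp add: strong_map_def)
qed

text \<open>The new point is added together with a strong set \<open>Y\<close> around it.
  \<open>Y\<close> is copied to natural numbers, where \<open>strong_extend\<close> applies, and
  domination provides the set \<open>B0\<close>.\<close>

lemma strong_map_forth:
  fixes M :: "('r, 'a) lstruct" and N :: "('r, 'b) lstruct"
  assumes L: "L \<noteq> {}" and M: "model_S L ar \<alpha> M" and N: "model_S L ar \<alpha> N" and dom: "dominates N M"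
    and p: "strong_map M N X g" and a: "a \<in> univ M"
  obtains X' g' where "strong_map M N X' g'" "X \<subseteq> X'" "a \<in> X'" "\<And>x. x \<in> X \<Longrightarrow> g' x = g x"
proof -
  have gM: "admissible M" using M by (rule model_admissible)
  have X: "finite (insert a X)" "insert a X \<subseteq> univ M" "strong_set M X" and eg: "embedding L g (induced M X) N"
    and sg: "strong_set N (g ` X)"
    using p a by (auto simp: strong_map_def strong_set_def)
  obtain Y where Y: "insert a X \<subseteq> Y" "strong_set M Y" using strong_closure[OF gM X(1,2)] by blast
  have Yfin: "finite Y" "Y \<subseteq> univ M" using Y(2) by (auto simp: strong_set_def)
  obtain A :: "('r, nat) lstruct" and h where A: "admissible A" "finite (univ A)"
    and eh: "embedding L h A M" and hY: "h ` univ A = Y"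
    using finite_copy[OF gM Yfin] by blast
  let ?S = "univ A"
  have inj: "inj_on h ?S" using eh by (simp add: embedding_def)
  define T where "T = {s \<in> ?S. h s \<in> X}"
  have T: "T \<subseteq> univ A" "h ` T = X" using Y(1) hY by (auto simp: T_def)
  have sT: "strong_set A T" using strong_set_embedding[OF eh T(1)] X(3) T(2) by simp
  have "embedding L h (induced A T) M" using embedding_restrict[OF eh substructure_induced[OF T(1)]] .
  then have "embedding L h (induced A T) (induced M X)"
    by (rule embedding_into) (use T(2) X(2) in \<open>auto simp: substructure_induced\<close>)
  then have eT: "embedding L (g \<circ> h) (induced A T) N" using eg by (rule embedding_comp)
  have "(g \<circ> h) ` T = g ` X" using T(2) by (metis image_comp)
  then have sgT: "strong_set N ((g \<circ> h) ` T)" using sg by simp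
  obtain B0 where B0: "strong_set N B0" "predim M Y \<le> predim N B0" using dom Y(2) by (auto simp: dominates_def)
  have "predim A (univ A) = predim M Y" using predim_embedding[OF eh order_refl] hY by simp
  then obtain k where k: "embedding L k A N" "\<And>x. x \<in> T \<Longrightarrow> k x = (g \<circ> h) x" "strong_set N (k ` ?S)"
    using strong_extend[OF L N A sT eT sgT B0(1)] B0(2) by metis
  let ?i = "inv_into ?S h"
  have ei: "embedding L ?i (induced M Y) (induced A ?S)" using embedding_inverse[OF eh order_refl] hY by simp
  have "embedding L k (induced A ?S) N" using embedding_restrict[OF k(1) substructure_induced] by simp
  with ei have e: "embedding L (k \<circ> ?i) (induced M Y) N" by (rule embedding_comp)
  have iY: "?i ` Y = ?S" using inj hY by (metis inv_into_image_cancel order_refl)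
  have "(k \<circ> ?i) ` Y = k ` ?S" using iY by (metis image_comp)
  then have "strong_map M N Y (k \<circ> ?i)" using Y(2) e k(3) by (simp add: strong_map_def)
  moreover have "(k \<circ> ?i) x = g x" if x: "x \<in> X" for x
  proof -
    have "x \<in> h ` ?S" using Y(1) x hY by auto
    then have "?i x \<in> ?S" "h (?i x) = x" by (auto simp: inv_into_into f_inv_into_f)
    then show ?thesis using k(2)[of "?i x"] x by (simp add: T_def)
  qed
  ultimately show ?thesis using that[of Y "k \<circ> ?i"] Y(1) by blast
qed

text \<open>A forward step for the inverse map, inverted again.\<close>

lemma strong_map_back:
  fixes M :: "('r, 'a) lstruct" and N :: "('r, 'b) lstruct"
  assumes L: "L \<noteq> {}" and M: "model_S L ar \<alpha> M" and N: "model_S L ar \<alpha> N" and dom: "dominates M N"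
    and p: "strong_map M N X g" and b: "b \<in> univ N"
  obtains X' g' where "strong_map M N X' g'" "X \<subseteq> X'" "b \<in> g' ` X'" "\<And>x. x \<in> X \<Longrightarrow> g' x = g x"
proof -
  have inj: "inj_on g X" using p by (simp add: strong_map_def embedding_def)
  obtain Y k where Y: "strong_map N M Y k" "g ` X \<subseteq> Y" "b \<in> Y" "\<And>y. y \<in> g ` X \<Longrightarrow> k y = inv_into X g y"
    using strong_map_forth[OF L N M dom strong_map_inverse[OF p] b] by metis
  have injk: "inj_on k Y" using Y(1) by (simp add: strong_map_def embedding_def)
  have kg: "k (g x) = x" if "x \<in> X" for x using Y(4)[of "g x"] inj that by simp
  have "X \<subseteq> k ` Y"
  proof
    fix x assume x: "x \<in> X"
    then have "x = k (g x)" "g x \<in> Y" using kg Y(2) by auto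
    then show "x \<in> k ` Y" by (rule image_eqI)
  qed
  moreover have "inv_into Y k x = g x" if x: "x \<in> X" for x
    using inv_into_f_f[OF injk, of "g x"] kg[OF x] Y(2) x by auto
  moreover have "b \<in> inv_into Y k ` (k ` Y)" using injk Y(3) by force
  ultimately show ?thesis using that[OF strong_map_inverse[OF Y(1)]] by blast
qed

lemma finite_subset_chain:
  assumes "mono X" "finite Y" "Y \<subseteq> (\<Union>n :: nat. X n)"
  shows "\<exists>n. Y \<subseteq> X n"
  using assms(2,3)
proof (induction Y)
  case (insert y Y)
  then obtain m n where "Y \<subseteq> X m" "y \<in> X n" by auto
  then have "insert y Y \<subseteq> X (max m n)"
    using monoD[OF assms(1), of m "max m n"] monoD[OF assms(1), of n "max m n"] by auto
  then show ?case by blast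
qed simp

text \<open>Forward steps alone give the embedding. Backward steps are taken only under the converse
  domination and make it onto, so one construction serves elementary embeddings and
  isomorphisms.\<close>

lemma back_and_forth:
  fixes M :: "('r, 'a) lstruct" and N :: "('r, 'b) lstruct"
  assumes L: "L \<noteq> {}" and M: "countable_model_S L ar \<alpha> M" and N: "countable_model_S L ar \<alpha> N"
    and dom: "dominates N M"
  obtains f where "embedding L f M N" "\<And>X. strong_set M X \<Longrightarrow> strong_set N (f ` X)"
    "dominates M N \<Longrightarrow> f ` univ M = univ N"
proof -
  have M': "model_S L ar \<alpha> M" and N': "model_S L ar \<alpha> N" and cM: "countable (univ M)" and cN: "countable (univ N)"
    using M N by (auto simp: countable_model_S_def)
  let ?a = "from_nat_into (univ M)" and ?b = "from_nat_into (univ N)"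
  \<comment> \<open>The membership guards cover an empty universe, on which
    \<open>from_nat_into\<close> enumerates nothing.\<close>
  let ?Q = "\<lambda>n (X, g) (X', g'). X \<subseteq> X' \<and> (\<forall>x\<in>X. g' x = g x) \<and> (?a n \<in> univ M \<longrightarrow> ?a n \<in> X') \<and>
     (dominates M N \<longrightarrow> ?b n \<in> univ N \<longrightarrow> ?b n \<in> g' ` X')"
  have step: "\<exists>X' g'. strong_map M N X' g' \<and> X \<subseteq> X' \<and> (\<forall>x\<in>X. g' x = g x) \<and> (?a n \<in> univ M \<longrightarrow> ?a n \<in> X') \<and>
     (dominates M N \<longrightarrow> ?b n \<in> univ N \<longrightarrow> ?b n \<in> g' ` X')" if p: "strong_map M N X g" for X g n
  proof -
    obtain X1 g1 where 1: "strong_map M N X1 g1" "X \<subseteq> X1" "\<And>x. x \<in> X \<Longrightarrow> g1 x = g x" "?a n \<in> univ M \<longrightarrow> ?a n \<in> X1"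
    proof (cases "?a n \<in> univ M")
      case True
      obtain X1 g1 where "strong_map M N X1 g1" "X \<subseteq> X1" "?a n \<in> X1" "\<And>x. x \<in> X \<Longrightarrow> g1 x = g x"
        using strong_map_forth[OF L M' N' dom p True] by metis
      then show ?thesis using that[of X1 g1] by simp
    next
      case False then show ?thesis using that[of X g] p by simp
    qed
    show ?thesis
    proof (cases "dominates M N \<and> ?b n \<in> univ N")
      case True
      obtain X2 g2 where 2: "strong_map M N X2 g2" "X1 \<subseteq> X2" "?b n \<in> g2 ` X2" "\<And>x. x \<in> X1 \<Longrightarrow> g2 x = g1 x"
        using strong_map_back[OF L M' N' _ 1(1)] True by metis
      then show ?thesis using 1 by (intro exI[of _ X2] exI[of _ g2]) auto
    next
      case False
      then show ?thesis using 1 by (intro exI[of _ X1] exI[of _ g1]) auto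
    qed
  qed
  have "\<exists>s. \<forall>n. (case s n of (X, g) \<Rightarrow> strong_map M N X g) \<and> ?Q n (s n) (s (Suc n))"
  proof (rule dependent_nat_choice)
    show "\<exists>x. case x of (X, g) \<Rightarrow> strong_map M N X g"
      using strong_map_empty[OF model_admissible[OF M'] model_admissible[OF N']] by auto
    fix x n assume "case x of (X, g) \<Rightarrow> strong_map M N X g"
    then show "\<exists>y. (case y of (X, g) \<Rightarrow> strong_map M N X g) \<and> ?Q n x y"
      using step by (cases x) auto
  qed
  then obtain s where s: "\<forall>n. (case s n of (X, g) \<Rightarrow> strong_map M N X g) \<and> ?Q n (s n) (s (Suc n))"
    by (rule exE)
  define X where "X n = fst (s n)" for n
  define g where "g n = snd (s n)" for n
  have sn: "s n = (X n, g n)" for n by (simp add: X_def g_def)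
  have p: "strong_map M N (X n) (g n)" for n using spec[OF s, of n] by (simp add: sn)
  have Q: "X n \<subseteq> X (Suc n)" "\<And>x. x \<in> X n \<Longrightarrow> g (Suc n) x = g n x" "?a n \<in> univ M \<Longrightarrow> ?a n \<in> X (Suc n)"
     "dominates M N \<Longrightarrow> ?b n \<in> univ N \<Longrightarrow> ?b n \<in> g (Suc n) ` X (Suc n)" for n
    using spec[OF s, of n] by (auto simp: sn)
  have mono: "X m \<subseteq> X n" if "m \<le> n" for m n using that Q(1) by (rule lift_Suc_mono_le[rotated])
  have agree: "g n x = g m x" if "m \<le> n" "x \<in> X m" for m n x
    using that by (induction n rule: dec_induct) (use Q(2) mono in \<open>auto simp: subset_iff\<close>)
  have XM: "X n \<subseteq> univ M" for n using p[of n] by (simp add: strong_map_def strong_set_def)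
  have cover: "\<exists>n. x \<in> X n" if "x \<in> univ M" for x
    using from_nat_into_surj[OF cM that] Q(3) that by metis
  have "mono X" using mono by (rule monoI)
  moreover have "univ M \<subseteq> (\<Union>n. X n)" using cover by auto
  ultimately have cover_fin: "\<exists>n. Y \<subseteq> X n" if "finite Y" "Y \<subseteq> univ M" for Y
    using finite_subset_chain[OF _ that(1)] that(2) by (meson order_trans)
  define f where "f x = g (LEAST n. x \<in> X n) x" for x
  have f: "f x = g n x" if "x \<in> X n" for n x
    unfolding f_def using that by (metis (no_types, lifting) LeastI Least_le agree)
  have en: "embedding L (g n) (induced M (X n)) N" for n using p[of n] by (simp add: strong_map_def)
  have emb: "embedding L f M N" unfolding embedding_def
  proof (intro conjI ballI allI impI)
    show "inj_on f (univ M)"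
    proof (rule inj_onI)
      fix x y assume xy: "x \<in> univ M" "y \<in> univ M" "f x = f y"
      obtain n where n: "{x, y} \<subseteq> X n" using cover_fin[of "{x, y}"] xy by auto
      have "inj_on (g n) (X n)" using en[of n] by (simp add: embedding_def)
      then show "x = y" using n xy(3) f[of x n] f[of y n] by (auto dest: inj_onD)
    qed
    show "f ` univ M \<subseteq> univ N"
    proof
      fix y assume "y \<in> f ` univ M"
      then obtain x n where "y = f x" "x \<in> X n" using cover by blast
      then show "y \<in> univ N" using f[of x n] en[of n] by (auto simp: embedding_def)
    qed
    fix E xs assume E: "E \<in> L" and xs: "set xs \<subseteq> univ M"
    obtain n where n: "set xs \<subseteq> X n" using cover_fin[of "set xs"] xs by auto
    have m: "map f xs = map (g n) xs" using n f[of _ n] by (intro map_cong) auto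
    have "xs \<in> rel (induced M (X n)) E \<longleftrightarrow> map (g n) xs \<in> rel N E"
      using en[of n] E n unfolding embedding_def by simp
    then show "xs \<in> rel M E \<longleftrightarrow> map f xs \<in> rel N E" unfolding m using n by (simp add: rel_induced)
  qed
  \<comment> \<open>\<open>Y\<close> lies in one stage of the construction. Its image is strong in
    the image of that stage, which is strong in \<open>N\<close>.\<close>
  have strong: "strong_set N (f ` Y)" if Y: "strong_set M Y" for Y
  proof -
    have Yf: "finite Y" "Y \<subseteq> univ M" using Y by (auto simp: strong_set_def)
    obtain n where n: "Y \<subseteq> X n" using cover_fin[OF Yf] by blast
    have "strong_set (induced M (X n)) Y" using strong_set_induced[OF Y n XM] .
    then have "strong_set (induced N (g n ` univ (induced M (X n)))) (g n ` Y)"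
      by (rule strong_set_embedding_image[OF en])
    then have "strong_set N (g n ` Y)" using p[of n] strong_set_trans by (auto simp: strong_map_def)
    moreover have "f ` Y = g n ` Y" using n f[of _ n] by (intro image_cong) auto
    ultimately show ?thesis by simp
  qed
  have surj: "f ` univ M = univ N" if dMN: "dominates M N"
  proof
    show "f ` univ M \<subseteq> univ N" using emb by (simp add: embedding_def)
    show "univ N \<subseteq> f ` univ M"
    proof
      fix y assume y: "y \<in> univ N"
      obtain n where "?b n = y" using from_nat_into_surj[OF cN y] by blast
      then obtain x where x: "x \<in> X (Suc n)" "y = g (Suc n) x" using Q(4)[OF dMN, of n] y by auto
      then show "y \<in> f ` univ M" using f[OF x(1)] XM by (intro image_eqI[of _ _ x]) auto
    qed
  qed
  show ?thesis using that emb strong surj by blast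
qed

section \<open>Dimension and domination\<close>

lemma dimension_attained:
  assumes "admissible M" "bdd_above (dim_values L \<alpha> M)"
  obtains X where "strong_set M X" "\<And>Y. strong_set M Y \<Longrightarrow> predim M Y \<le> predim M X"
    "dimension L \<alpha> M = ereal (real_of_int (predim M X) / real c)"
proof -
  obtain b where b: "\<And>x. x \<in> dim_values L \<alpha> M \<Longrightarrow> x \<le> b" using assms(2) by (auto simp: bdd_above_def)
  have nonneg: "0 \<le> predim M Y" if "strong_set M Y" for Y using assms(1) that by (auto simp: admissible_def strong_set_def)
  have "nat (predim M Y) < Suc (nat \<lceil>b * real c\<rceil>)" if "strong_set M Y" for Y
  proof -
    have "real_of_int (predim M Y) / real c \<le> b" using that by (intro b) (auto simp: dim_values_eq)
    then have "real_of_int (predim M Y) \<le> b * real c" using c_pos by (simp add: divide_le_eq)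
    then have "predim M Y \<le> \<lceil>b * real c\<rceil>" by linarith
    then show ?thesis using nat_mono le_imp_less_Suc by blast
  qed
  then have "\<exists>X. strong_set M X \<and> (\<forall>Y. strong_set M Y \<longrightarrow> nat (predim M Y) \<le> nat (predim M X))"
    using strong_set_empty[OF assms(1)] by (intro ex_has_greatest_nat[where k = "{}"]) auto
  then obtain X where X: "strong_set M X" "\<And>Y. strong_set M Y \<Longrightarrow> nat (predim M Y) \<le> nat (predim M X)"
    by (elim exE conjE) simp
  have max: "predim M Y \<le> predim M X" if "strong_set M Y" for Y using X(2)[OF that] nonneg[OF that] nonneg[OF X(1)] by simp
  have "(GREATEST d. d \<in> dim_values L \<alpha> M) = real_of_int (predim M X) / real c"
  proof (rule Greatest_equality)
    show "real_of_int (predim M X) / real c \<in> dim_values L \<alpha> M" using X(1) by (auto simp: dim_values_eq)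
    fix y assume "y \<in> dim_values L \<alpha> M"
    then obtain Y where "strong_set M Y" "y = real_of_int (predim M Y) / real c" by (auto simp: dim_values_eq)
    then show "y \<le> real_of_int (predim M X) / real c" using max by (simp add: divide_right_mono)
  qed
  then show ?thesis using that X(1) max assms(2) by (simp add: dimension_def)
qed

lemma unbounded_dim_values:
  assumes "\<not> bdd_above (dim_values L \<alpha> M)"
  obtains X where "strong_set M X" "k \<le> predim M X"
proof -
  obtain x where "x \<in> dim_values L \<alpha> M" "real_of_int k / real c < x"
    using assms unfolding bdd_above_def by (meson not_le)
  then obtain X where "strong_set M X" "real_of_int k / real c < real_of_int (predim M X) / real c"
    by (auto simp: dim_values_eq)
  then show ?thesis using that[of X] c_pos by (simp add: divide_less_cancel)
qed

lemma dimension_le_dominates: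
  assumes M: "admissible M" and N: "admissible N" and le: "dimension L \<alpha> M \<le> dimension L \<alpha> N"
  shows "dominates N M"
proof (cases "bdd_above (dim_values L \<alpha> N)")
  case False
  then show ?thesis using unbounded_dim_values unfolding dominates_def by metis
next
  case True
  obtain Y where Y: "strong_set N Y" "dimension L \<alpha> N = ereal (real_of_int (predim N Y) / real c)"
    using dimension_attained[OF N True] by metis
  have "bdd_above (dim_values L \<alpha> M)" using le Y(2) by (auto simp: dimension_def split: if_splits)
  then obtain X where X: "\<And>Z. strong_set M Z \<Longrightarrow> predim M Z \<le> predim M X"
    "dimension L \<alpha> M = ereal (real_of_int (predim M X) / real c)"
    using dimension_attained[OF M] by metis
  have "predim M X \<le> predim N Y" using le X(2) Y(2) c_pos by (simp add: divide_le_cancel)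
  then show ?thesis using X(1) Y(1) unfolding dominates_def by (meson order_trans)
qed

end

subsection \<open>The generic model and its d-closed submodels\<close>

context rational_weights
begin

section \<open>Construction of the generic model\<close>

lemma embedding_from_induced:
  "lstructure L ar B \<Longrightarrow> embedding L f (induced B (univ B)) M \<Longrightarrow> embedding L f B M"
  by (erule embedding_restrict) (auto simp: substructure_def rel_induced lstructure_def)

text \<open>A free point adds \<open>c\<close> units. It makes the dimension of the generic model
  infinite and gives \<open>strong_tower\<close> the height from which to come down to one
  unit.\<close>

lemma add_point:
  fixes A :: "('r, nat) lstruct"
  assumes A: "admissible A" "finite (univ A)"
  obtains A' where "admissible A'" "finite (univ A')" "substructure L A A'" "strong_set A' (univ A)"
    "predim A' (univ A') = predim A (univ A) + int c"
proof -
  obtain u where u: "u \<notin> univ A" using A(2) ex_new_if_finite infinite_UNIV_nat by blast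
  define Q :: "('r, nat) lstruct" where "Q = \<lparr>univ = {u}, rel = \<lambda>_. {}\<rparr>"
  have dlQ: "predim Q X = int c * int (card X)" for X by (simp add: predim_def hedges_def Q_def)
  have Q: "admissible Q" "finite (univ Q)" unfolding admissible_def dlQ
    by (auto simp: Q_def sym_structure_def lstructure_def)
  have I: "univ A \<inter> univ Q = {}" using u by (simp add: Q_def)
  have agree: "{xs \<in> rel A E. set xs \<subseteq> univ Q} = {xs \<in> rel Q E. set xs \<subseteq> univ A}" if E: "E \<in> L" for E
  proof -
    have "\<not> set xs \<subseteq> {u}" if xs: "xs \<in> rel A E" for xs
    proof -
      have "length xs \<ge> 2" "set xs \<subseteq> univ A"
        using A(1) E xs ar_ge2[OF E] by (auto simp: admissible_def sym_structure_def lstructure_def)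
      then show ?thesis using u by (cases xs) auto
    qed
    then show ?thesis by (auto simp: Q_def)
  qed
  have s: "strong_set Q {}" using strong_set_empty[OF Q(1)] .
  note am = amalgam_properties[OF A Q agree, unfolded I, OF _ s]
  have "predim Q {} = 0" by (simp add: dlQ)
  moreover have "predim Q (univ Q) = int c" by (simp add: dlQ, simp add: Q_def)
  ultimately show ?thesis using that[of "amalgam A Q"] am A(2) Q(2) by simp
qed

text \<open>Strongness of \<open>X\<close> in \<open>B\<close> makes \<open>A\<close> strong in the
  amalgam, whatever the position of \<open>X\<close> in \<open>A\<close>. This matches the axioms,
  which extend embeddings with arbitrary image.\<close>

lemma amalgamate_over:
  fixes A B :: "('r, nat) lstruct"
  assumes A: "admissible A" "finite (univ A)" and B: "admissible B" "finite (univ B)" "strong_set B X"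
    and X: "X \<subseteq> univ A" and e: "embedding L (\<lambda>x. x) (induced A X) B"
  obtains A' g where "admissible A'" "finite (univ A')" "substructure L A A'" "strong_set A' (univ A)"
    "embedding L g B A'" "\<And>x. x \<in> X \<Longrightarrow> g x = x"
proof -
  have lA: "lstructure L ar A" and lB: "lstructure L ar B" using A B admissible_lstructure by blast+
  have "(\<lambda>x. x) ` X \<subseteq> univ B" using B(3) by (simp add: strong_set_def)
  then obtain S h where S: "finite S" "univ A \<inter> S = X" "bij_betw h S (univ B)"
    and hX: "\<And>x. x \<in> X \<Longrightarrow> h x = x"
    and eB: "embedding L h (pullback L S h B) B" and gB: "admissible (pullback L S h B)"
    and agree: "\<And>E. E \<in> L \<Longrightarrow>
       {xs \<in> rel A E. set xs \<subseteq> S} = {xs \<in> rel (pullback L S h B) E. set xs \<subseteq> univ A}"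
    by (rule copy_over[OF lA A(2) X B(1) e B(2) order_refl]) (rule that)
  define B' where "B' = pullback L S h B"
  note eB = eB[folded B'_def] and gB = gB[folded B'_def] and agree = agree[folded B'_def]
  have U: "univ B' = S" by (simp add: B'_def)
  have hS: "inj_on h S" "h ` S = univ B" using S(3) by (auto simp: bij_betw_def)
  have XS: "X \<subseteq> S" using S(2) by blast
  have "h ` X = X" using hX by force
  then have sB: "strong_set B' X" using strong_set_embedding[OF eB, of X] XS B(3) by (simp add: U)
  have finB: "finite (univ B')" using S by (simp add: U)
  note am = amalgam_properties[OF A(1,2) gB finB, unfolded U S(2), OF agree sB]
  let ?g = "inv_into S h"
  have "embedding L ?g (induced B (univ B)) (induced B' S)"
    using embedding_inverse[OF eB, of S] hS(2) by (simp add: U)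
  then have "embedding L ?g B (induced B' S)" by (rule embedding_from_induced[OF lB])
  moreover have "substructure L (induced B' S) (amalgam A B')"
    using substructure_trans[OF substructure_induced am(3)] by (simp add: U)
  ultimately have "embedding L ?g B (amalgam A B')"
    using embedding_comp[OF _ embedding_substructure] by (fastforce simp: comp_def)
  moreover have "?g x = x" if x: "x \<in> X" for x
    using inv_into_f_f[OF hS(1), of x] hX[OF x] XS x by auto
  ultimately show ?thesis using that[of "amalgam A B'" ?g] am(1,2,4) A(2) finB by simp
qed

text \<open>Empty interpretations outside \<open>L\<close> make the set of tasks countable.\<close>

definition tasks :: "(nat set \<times> ('r, nat) lstruct) set" where
  "tasks = {(X, B). admissible B \<and> finite (univ B) \<and> strong_set B X \<and> (\<forall>E. E \<notin> L \<longrightarrow> rel B E = {})}"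

lemma countable_tasks: "countable tasks"
proof -
  \<comment> \<open>Recorded by its graph, the interpretation is a finite set of pairs, because
    \<open>L\<close> and the universe are finite.\<close>
  let ?f = "\<lambda>(X :: nat set, B :: ('r, nat) lstruct). (X, univ B, {(E, xs). xs \<in> rel B E})"
  have "inj ?f"
  proof (rule injI)
    fix p q :: "nat set \<times> ('r, nat) lstruct" assume eq: "?f p = ?f q"
    obtain X B X' B' where p: "p = (X, B)" and q: "q = (X', B')" by (cases p, cases q)
    have u: "X = X'" "univ B = univ B'" and r: "{(E, xs). xs \<in> rel B E} = {(E, xs). xs \<in> rel B' E}"
      using eq by (simp_all add: p q)
    have "rel B = rel B'"
    proof (intro ext set_eqI)
      fix E xs
      have "(E, xs) \<in> {(E, xs). xs \<in> rel B E} \<longleftrightarrow> (E, xs) \<in> {(E, xs). xs \<in> rel B' E}" by (simp only: r)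
      then show "xs \<in> rel B E \<longleftrightarrow> xs \<in> rel B' E" by simp
    qed
    with u show "p = q" by (simp add: p q)
  qed
  then have inj: "inj_on ?f tasks" by (rule inj_on_subset) simp
  have "?f ` tasks \<subseteq> {X. finite X} \<times> {X. finite X} \<times> {R. finite R \<and> R \<subseteq> L \<times> UNIV}"
  proof
    fix z assume "z \<in> ?f ` tasks"
    then obtain X B where z: "z = (X, univ B, {(E, xs). xs \<in> rel B E})" and t: "(X, B) \<in> tasks" by auto
    have B: "admissible B" "finite (univ B)" "strong_set B X" "\<And>E. E \<notin> L \<Longrightarrow> rel B E = {}" using t by (auto simp: tasks_def)
    have "{(E, xs). xs \<in> rel B E} \<subseteq> (SIGMA E:L. {xs. set xs \<subseteq> univ B \<and> length xs = ar E})"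
      using B(1,4) by (auto simp: admissible_def sym_structure_def lstructure_def)
    then have "finite {(E, xs). xs \<in> rel B E}"
      by (rule finite_subset) (intro finite_SigmaI finite_L finite_lists_length_eq B(2))
    moreover have "{(E, xs). xs \<in> rel B E} \<subseteq> L \<times> UNIV" using B(4) by auto
    ultimately show "z \<in> {X. finite X} \<times> {X. finite X} \<times> {R. finite R \<and> R \<subseteq> L \<times> UNIV}"
      using B z by (auto simp: strong_set_def)
  qed
  moreover have "countable ({X :: nat set. finite X} \<times> {X :: nat set. finite X} \<times> {R :: ('r \<times> nat list) set. finite R \<and> R \<subseteq> L \<times> UNIV})"
    using countable_Collect_finite_subset[of "UNIV :: nat set"]
    by (intro countable_SIGMA countable_Collect_finite_subset) (auto intro: countable_finite finite_L)
  ultimately have "countable (?f ` tasks)" by (rule countable_subset)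
  then show ?thesis using inj countable_image_inj_on by blast
qed

text \<open>Only inclusions count as problems. A general embedding becomes an inclusion once
  \<open>B\<close> is renamed along it.\<close>

definition solves :: "('r, nat) lstruct \<Rightarrow> ('r, nat) lstruct \<Rightarrow> nat set \<times> ('r, nat) lstruct \<Rightarrow> bool" where
  "solves A A' = (\<lambda>(X, B). (X, B) \<in> tasks \<longrightarrow> X \<subseteq> univ A \<longrightarrow> embedding L (\<lambda>x. x) (induced A X) B \<longrightarrow>
     (\<exists>g. embedding L g B A' \<and> (\<forall>x\<in>X. g x = x)))"

lemma solve_task:
  assumes A: "admissible A" "finite (univ A)"
  obtains A' where "admissible A'" "finite (univ A')" "substructure L A A'" "strong_set A' (univ A)"
    "predim A (univ A) < predim A' (univ A')" "solves A A' t"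
proof -
  obtain X B where t: "t = (X, B)" by (cases t)
  obtain A1 where A1: "admissible A1" "finite (univ A1)" "substructure L A A1" "strong_set A1 (univ A)"
    "predim A1 (univ A1) = predim A (univ A) + int c" using add_point[OF A] by blast
  have less: "predim A (univ A) < predim A1 (univ A1)" using A1(5) c_pos by simp
  show ?thesis
  proof (cases "(X, B) \<in> tasks \<and> X \<subseteq> univ A \<and> embedding L (\<lambda>x. x) (induced A X) B")
    case False
    then show ?thesis using that[OF A1(1-4) less] t by (auto simp: solves_def)
  next
    case True
    then have B: "admissible B" "finite (univ B)" "strong_set B X" and X: "X \<subseteq> univ A"
      and e: "embedding L (\<lambda>x. x) (induced A X) B" by (auto simp: tasks_def)
    have X1: "X \<subseteq> univ A1" using X A1(3) by (auto simp: substructure_def)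
    have "substructure L (induced A1 X) (induced A X)"
      using substructure_mid[OF substructure_induced[OF X1]
          substructure_trans[OF substructure_induced[OF X] A1(3)]] by simp
    then have e1: "embedding L (\<lambda>x. x) (induced A1 X) B" using e embedding_restrict by blast
    obtain A2 g where A2: "admissible A2" "finite (univ A2)" "substructure L A1 A2" "strong_set A2 (univ A1)"
      "embedding L g B A2" "\<And>x. x \<in> X \<Longrightarrow> g x = x"
      using amalgamate_over[OF A1(1,2) B X1 e1] by blast
    have "predim A1 (univ A1) = predim A2 (univ A1)" using predim_substructure[OF A2(3)] by simp
    also have "\<dots> \<le> predim A2 (univ A2)" using A2(2,4) by (simp add: strong_set_def)
    finally have "predim A (univ A) < predim A2 (univ A2)" using less by simp
    moreover have "strong_set A2 (univ A)"
      using strong_set_trans[OF _ A2(4)] strong_set_substructure_iff[OF A2(3)] A1(4) by blast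
    ultimately show ?thesis
      using that[OF A2(1,2) substructure_trans[OF A1(3) A2(3)]] A2(5,6) by (auto simp: solves_def t)
  qed
qed

text \<open>The union of a chain of finite structures, each strong in the next, along which every
  extension problem is eventually solved and the predimension tends to infinity.\<close>

lemma generic_model:
  obtains G :: "('r, nat) lstruct" where "model_S L ar \<alpha> G" "\<And>k. \<exists>X. strong_set G X \<and> k \<le> predim G X"
proof -
  \<comment> \<open>Only the first component of the decoded pair selects the task, so each task
    returns at arbitrarily late stages, after its points have appeared.\<close>
  let ?t = "\<lambda>n. from_nat_into tasks (fst (prod_decode n))"
  let ?P = "\<lambda>A. admissible A \<and> finite (univ A)"
  let ?Q = "\<lambda>n A A'. substructure L A A' \<and> strong_set A' (univ A) \<and> predim A (univ A) < predim A' (univ A') \<and> solves A A' (?t n)"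
  have "\<exists>s :: nat \<Rightarrow> ('r, nat) lstruct. \<forall>n. ?P (s n) \<and> ?Q n (s n) (s (Suc n))"
  proof (rule dependent_nat_choice)
    show "\<exists>A :: ('r, nat) lstruct. ?P A"
      by (rule exI[of _ "\<lparr>univ = {}, rel = \<lambda>_. {}\<rparr>"])
        (auto simp: admissible_def sym_structure_def lstructure_def predim_def hedges_def)
    fix A :: "('r, nat) lstruct" and n assume A: "?P A"
    then obtain A' where "admissible A'" "finite (univ A')" "substructure L A A'" "strong_set A' (univ A)"
      "predim A (univ A) < predim A' (univ A')" "solves A A' (?t n)" using solve_task by metis
    then show "\<exists>A'. ?P A' \<and> ?Q n A A'" by blast
  qed
  then obtain s :: "nat \<Rightarrow> ('r, nat) lstruct" where s: "\<forall>n. ?P (s n) \<and> ?Q n (s n) (s (Suc n))" by (rule exE)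
  have gs: "admissible (s n)" and fs: "finite (univ (s n))" and sub1: "substructure L (s n) (s (Suc n))"
    and st1: "strong_set (s (Suc n)) (univ (s n))" and dl1: "predim (s n) (univ (s n)) < predim (s (Suc n)) (univ (s (Suc n)))"
    and solve: "solves (s n) (s (Suc n)) (?t n)" for n
    using spec[OF s, of n] by simp_all
  have ls: "lstructure L ar (s n)" for n by (rule admissible_lstructure[OF gs])
  have sub: "substructure L (s m) (s n)" if "m \<le> n" for m n
    using that by (induction n rule: dec_induct) (use substructure_refl[OF ls] sub1 substructure_trans in blast)+
  have st: "strong_set (s n) (univ (s m))" if "m \<le> n" for m n
    using that
  proof (induction n rule: dec_induct)
    case base
    then show ?case using fs[of m] by (auto simp: strong_set_def dest: subset_antisym)
  next
    case (step n)
    then show ?case using strong_set_trans[OF _ st1] strong_set_substructure_iff[OF sub1] by blast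
  qed
  define G where "G = \<lparr>univ = (\<Union>n. univ (s n)), rel = \<lambda>E. \<Union>n. rel (s n) E\<rparr>"
  have UG: "univ G = (\<Union>n. univ (s n))" and RG: "rel G E = (\<Union>n. rel (s n) E)" for E by (simp_all add: G_def)
  have subG: "substructure L (s n) G" for n
    unfolding substructure_def
  proof (intro conjI ballI)
    show "univ (s n) \<subseteq> univ G" by (auto simp: UG)
    fix E assume E: "E \<in> L"
    show "rel (s n) E = {xs \<in> rel G E. set xs \<subseteq> univ (s n)}"
    proof (intro equalityI subsetI)
      fix xs assume "xs \<in> rel (s n) E"
      then show "xs \<in> {xs \<in> rel G E. set xs \<subseteq> univ (s n)}"
        using ls[of n] E by (auto simp: RG lstructure_def)
    next
      fix xs assume "xs \<in> {xs \<in> rel G E. set xs \<subseteq> univ (s n)}"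
      then obtain m where m: "xs \<in> rel (s m) E" "set xs \<subseteq> univ (s n)" by (auto simp: RG)
      have "xs \<in> rel (s (max m n)) E" using sub[of m "max m n"] m E by (auto simp: substructure_def)
      then show "xs \<in> rel (s n) E" using sub[of n "max m n"] m E by (auto simp: substructure_def)
    qed
  qed
  have "mono (\<lambda>n. univ (s n))" using sub by (intro monoI) (simp add: substructure_def)
  then have cover: "\<exists>n. Y \<subseteq> univ (s n)" if "finite Y" "Y \<subseteq> univ G" for Y
    using finite_subset_chain[OF _ that(1)] that(2) unfolding UG by blast
  have gG: "admissible G" unfolding admissible_def sym_structure_def lstructure_def
  proof (intro conjI ballI allI impI)
    fix E xs assume E: "E \<in> L" "xs \<in> rel G E"
    then obtain n where n: "xs \<in> rel (s n) E" by (auto simp: RG)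
    have sy: "sym_structure (s n)" using gs[of n] by (simp add: admissible_def)
    show "length xs = ar E" "distinct xs" using sy n E by (auto simp: sym_structure_def lstructure_def)
    show "set xs \<subseteq> univ G" using sy n E by (auto simp: sym_structure_def lstructure_def UG)
    fix ys assume "mset ys = mset xs"
    then have "ys \<in> rel (s n) E" using sy n E by (auto simp: sym_structure_def)
    then show "ys \<in> rel G E" by (auto simp: RG)
  next
    fix X assume X: "finite X" "X \<subseteq> univ G"
    obtain n where n: "X \<subseteq> univ (s n)" using cover[OF X] by blast
    then show "0 \<le> predim G X" using admissible_nonneg[OF gs X(1) n] predim_substructure[OF subG n] by simp
  qed
  have stG: "strong_set G (univ (s n))" for n unfolding strong_set_def
  proof (intro conjI allI impI fs)
    show "univ (s n) \<subseteq> univ G" by (auto simp: UG)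
    fix Y assume Y: "finite Y" "univ (s n) \<subseteq> Y" "Y \<subseteq> univ G"
    obtain m where m: "Y \<subseteq> univ (s m)" using cover[OF Y(1,3)] by blast
    have "univ (s m) \<subseteq> univ (s (max m n))" using sub[of m "max m n"] by (simp add: substructure_def)
    then have Ym: "Y \<subseteq> univ (s (max m n))" using m by blast
    then have "predim (s (max m n)) (univ (s n)) \<le> predim (s (max m n)) Y"
      using st[of n "max m n"] Y by (simp add: strong_set_def)
    then show "predim G (univ (s n)) \<le> predim G Y"
      using predim_substructure[OF subG Ym] predim_substructure[OF subG, of "univ (s n)" "max m n"] Y(2) Ym by simp
  qed
  have "extension_property G" unfolding extension_property_def
  proof (intro allI impI)
    fix B :: "('r, nat) lstruct" and X f
    assume B: "admissible B" "finite (univ B)" "strong_set B X" and f: "embedding L f (induced B X) G"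
    have X: "finite X" "X \<subseteq> univ B" using B(3) by (auto simp: strong_set_def)
    have inj: "inj_on f X" and fX: "f ` X \<subseteq> univ G" using f by (auto simp: embedding_def)
    obtain n1 where n1: "f ` X \<subseteq> univ (s n1)" using cover[OF _ fX] X(1) by blast
    \<comment> \<open>The inverse of \<open>f\<close> is used to rename \<open>B\<close> over the
      image of \<open>X\<close>, which turns the given embedding into an inclusion and the problem
      into one of the tasks.\<close>
    let ?i = "inv_into X f"
    have "substructure L (induced (s n1) (f ` X)) (induced G (f ` X))"
      using substructure_mid[OF substructure_trans[OF substructure_induced[OF n1] subG] substructure_induced[OF fX]]
      by simp
    moreover have "embedding L ?i (induced G (f ` X)) (induced (induced B X) X)"
      by (rule embedding_inverse[OF f]) simp
    moreover have "substructure L (induced (induced B X) X) B"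
      using X(2) by (auto simp: substructure_def rel_induced)
    ultimately have ei: "embedding L ?i (induced (s n1) (f ` X)) B"
      using embedding_restrict embedding_comp[OF _ embedding_substructure] by (fastforce simp: comp_def)
    have "?i ` f ` X \<subseteq> univ B" using inj X by auto
    then obtain S h where S: "finite S" "univ (s n1) \<inter> S = f ` X" "bij_betw h S (univ B)"
      and hi: "\<And>x. x \<in> f ` X \<Longrightarrow> h x = ?i x"
      and eB: "embedding L h (pullback L S h B) B" and gB: "admissible (pullback L S h B)"
      and agree: "\<And>E. E \<in> L \<Longrightarrow>
         {xs \<in> rel (s n1) E. set xs \<subseteq> S} = {xs \<in> rel (pullback L S h B) E. set xs \<subseteq> univ (s n1)}"
      by (rule copy_over[OF ls fs n1 B(1) ei B(2) order_refl]) (rule that)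
    define B' where "B' = pullback L S h B"
    note eB = eB[folded B'_def] and gB = gB[folded B'_def] and agree = agree[folded B'_def]
    have U: "univ B' = S" by (simp add: B'_def)
    have hS: "inj_on h S" "h ` S = univ B" using S(3) by (auto simp: bij_betw_def)
    have fXS: "f ` X \<subseteq> S" using S(2) by blast
    have hf: "h (f x) = x" if "x \<in> X" for x using hi[of "f x"] that inj by simp
    have "h ` f ` X = X" using hf by force
    then have sB: "strong_set B' (f ` X)" using strong_set_embedding[OF eB, of "f ` X"] fXS B(3) by (simp add: U)
    have task: "(f ` X, B') \<in> tasks" using gB S(1) sB by (auto simp: tasks_def U) (auto simp: B'_def rel_pullback)
    then obtain i where i: "from_nat_into tasks i = (f ` X, B')"
      using from_nat_into_surj[OF countable_tasks] by blast
    \<comment> \<open>A stage reserved for task \<open>i\<close> and not earlier than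
      \<open>n1\<close>, where the image of \<open>X\<close> is already present.\<close>
    define n where "n = prod_encode (i, n1)"
    have n: "n1 \<le> n" unfolding n_def by (rule le_prod_encode_2)
    then have fXn: "f ` X \<subseteq> univ (s n)" using n1 sub[of n1 n] by (auto simp: substructure_def)
    have "xs \<in> rel (s n) E \<longleftrightarrow> xs \<in> rel B' E" if E: "E \<in> L" and xs: "set xs \<subseteq> f ` X" for E xs
    proof -
      have "xs \<in> rel (s n) E \<longleftrightarrow> xs \<in> rel (s n1) E"
        using sub[OF n] E xs n1 by (auto simp: substructure_def)
      also have "\<dots> \<longleftrightarrow> xs \<in> rel B' E" using agree[OF E] xs S(2) by blast
      finally show ?thesis .
    qed
    then have "embedding L (\<lambda>x. x) (induced (s n) (f ` X)) B'"
      using fXS by (auto simp: embedding_def rel_induced U)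
    then obtain g where g: "embedding L g B' (s (Suc n))" "\<And>x. x \<in> f ` X \<Longrightarrow> g x = x"
      using solve[of n] task fXn by (auto simp: n_def i solves_def)
    let ?j = "inv_into S h"
    have "embedding L ?j (induced B (univ B)) (induced B' S)"
      using embedding_inverse[OF eB, of S] hS(2) by (simp add: U)
    then have "embedding L ?j B (induced B' S)" by (rule embedding_from_induced[OF admissible_lstructure[OF B(1)]])
    moreover have "embedding L g (induced B' S) (s (Suc n))"
      using embedding_restrict[OF g(1) substructure_induced[of S B']] by (simp add: U)
    ultimately have "embedding L (g \<circ> ?j) B (s (Suc n))" by (rule embedding_comp)
    then have "embedding L (g \<circ> ?j) B G"
      using embedding_comp[OF _ embedding_substructure[OF subG]] by (fastforce simp: comp_def)
    moreover have "(g \<circ> ?j) x = f x" if x: "x \<in> X" for x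
    proof -
      have "?j x = f x" using inv_into_f_f[OF hS(1), of "f x"] hf[OF x] fXS x by auto
      then show ?thesis using g(2) x by simp
    qed
    ultimately show "\<exists>g. embedding L g B G \<and> (\<forall>x\<in>X. g x = f x)" by blast
  qed
  then have "model_S L ar \<alpha> G" using gG by (simp add: model_S_iff)
  moreover have "\<exists>X. strong_set G X \<and> k \<le> predim G X" for k
  proof -
    have "int n \<le> predim (s n) (univ (s n))" for n
    proof (induction n)
      case 0 then show ?case using admissible_nonneg[OF gs fs] by simp
    next
      case (Suc n) then show ?case using dl1[of n] by simp
    qed
    from this[of "nat k"] have "k \<le> predim (s (nat k)) (univ (s (nat k)))" by linarith
    then have "k \<le> predim G (univ (s (nat k)))" using predim_substructure[OF subG order_refl] by simp
    then show ?thesis using stG by blast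
  qed
  ultimately show ?thesis by (rule that)
qed

section \<open>d-closures as models of finite dimension\<close>

definition d_closure :: "('r, 'a) lstruct \<Rightarrow> 'a set \<Rightarrow> 'a set" where
  "d_closure G D = \<Union>{B. strong_set G B \<and> D \<subseteq> B \<and> predim G B = predim G D}"

lemma strong_set_le: "strong_set M X \<Longrightarrow> finite Y \<Longrightarrow> X \<subseteq> Y \<Longrightarrow> Y \<subseteq> univ M \<Longrightarrow> predim M X \<le> predim M Y"
  by (simp add: strong_set_def)

text \<open>The intersection of \<open>B\<close> and \<open>B'\<close> contains \<open>D\<close> and
  has at least its value, so by submodularity adding \<open>B\<close> to \<open>B'\<close> costs
  nothing. Hence the zero-extensions of \<open>D\<close> form a directed family, and d-closures grow
  with \<open>D\<close>.\<close>

lemma zero_extension_Un: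
  assumes "strong_set G D" "strong_set G D'" "D \<subseteq> D'" "D \<subseteq> B" "D' \<subseteq> B'"
    and B: "strong_set G B" "predim G B = predim G D" and B': "strong_set G B'" "predim G B' = predim G D'"
  shows "strong_set G (B \<union> B') \<and> predim G (B \<union> B') = predim G D'"
proof -
  have fin: "finite B" "finite B'" and U: "B \<subseteq> univ G" "B' \<subseteq> univ G" using B B' by (auto simp: strong_set_def)
  have "predim G (B \<union> B') + predim G (B \<inter> B') \<le> predim G B + predim G B'" by (rule predim_submodular[OF fin])
  moreover have "predim G D \<le> predim G (B \<inter> B')" using assms(3-5) fin U by (intro strong_set_le[OF assms(1)]) auto
  moreover have "predim G B' \<le> predim G (B \<union> B')" using fin U by (intro strong_set_le[OF B'(1)]) auto
  ultimately have "predim G (B \<union> B') = predim G B'" using B(2) by linarith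
  then show ?thesis using strong_set_same_predim[OF B'(1), of "B \<union> B'"] fin U B'(2) by simp
qed

lemma d_closure_finite:
  assumes D: "strong_set G D" and Y: "finite Y" "Y \<subseteq> d_closure G D"
  obtains B where "Y \<subseteq> B" "strong_set G B" "D \<subseteq> B" "predim G B = predim G D"
proof -
  have "\<exists>B. Y \<subseteq> B \<and> strong_set G B \<and> D \<subseteq> B \<and> predim G B = predim G D"
    using Y
  proof (induction Y)
    case empty
    then show ?case using D by blast
  next
    case (insert y Y)
    then obtain B where B: "Y \<subseteq> B" "strong_set G B" "D \<subseteq> B" "predim G B = predim G D" by blast
    obtain B' where B': "y \<in> B'" "strong_set G B'" "D \<subseteq> B'" "predim G B' = predim G D"
      using insert.prems by (auto simp: d_closure_def)
    have "strong_set G (B \<union> B') \<and> predim G (B \<union> B') = predim G D"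
      by (rule zero_extension_Un[OF D D order_refl B(3) B'(3) B(2,4) B'(2,4)])
    then show ?case using B(1,3) B'(1) by (intro exI[of _ "B \<union> B'"]) auto
  qed
  then show ?thesis using that by blast
qed

lemma d_closure_subset: "d_closure G D \<subseteq> univ G"
  by (auto simp: d_closure_def strong_set_def)

lemma d_closure_member: "strong_set G B \<Longrightarrow> D \<subseteq> B \<Longrightarrow> predim G B = predim G D \<Longrightarrow> B \<subseteq> d_closure G D"
  by (auto simp: d_closure_def)

lemma d_closure_mono:
  assumes "strong_set G D" "strong_set G D'" "D \<subseteq> D'"
  shows "d_closure G D \<subseteq> d_closure G D'"
proof
  fix x assume "x \<in> d_closure G D"
  then obtain B where B: "x \<in> B" "strong_set G B" "D \<subseteq> B" "predim G B = predim G D" by (auto simp: d_closure_def)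
  have "strong_set G (B \<union> D') \<and> predim G (B \<union> D') = predim G D'"
    by (rule zero_extension_Un[OF assms B(3) order_refl B(2,4) assms(2) refl])
  then have "B \<union> D' \<subseteq> d_closure G D'" by (intro d_closure_member) auto
  then show "x \<in> d_closure G D'" using B(1) by blast
qed

text \<open>A finite subset of the closure lies in one finite zero-extension of \<open>D\<close>. It
  is strong there, and the zero-extension is strong in \<open>G\<close>.\<close>

lemma strong_set_d_closure_trans:
  assumes D: "strong_set G D" and X: "strong_set (induced G (d_closure G D)) X"
  shows "strong_set G X"
proof -
  have Xf: "finite X" "X \<subseteq> d_closure G D" using X by (auto simp: strong_set_def)
  obtain B where B: "X \<subseteq> B" "strong_set G B" "D \<subseteq> B" "predim G B = predim G D"
    using d_closure_finite[OF D Xf] by blast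
  have BC: "B \<subseteq> d_closure G D" using B by (intro d_closure_member)
  have "strong_set (induced G B) X" unfolding strong_set_def
  proof (intro conjI allI impI Xf(1))
    show "X \<subseteq> univ (induced G B)" using B(1) by simp
    fix Y assume Y: "finite Y" "X \<subseteq> Y" "Y \<subseteq> univ (induced G B)"
    then have YC: "Y \<subseteq> d_closure G D" using BC by auto
    then have "predim (induced G (d_closure G D)) X \<le> predim (induced G (d_closure G D)) Y"
      using X Y by (simp add: strong_set_def)
    then show "predim (induced G B) X \<le> predim (induced G B) Y"
      using Y B(1) Xf(2) YC by (simp add: predim_induced)
  qed
  then show ?thesis using B(2) by (rule strong_set_trans)
qed

text \<open>The problem is solved in \<open>G\<close> over a zero-extension \<open>Y\<close> of
  \<open>D\<close> that contains the given image. Amalgamated with \<open>Y\<close> and padded to a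
  zero-extension of \<open>Y\<close>, the solution is forced into the closure.\<close>

lemma model_d_closure:
  assumes L: "L \<noteq> {}" and G: "model_S L ar \<alpha> G" and D: "strong_set G D"
  shows "model_S L ar \<alpha> (induced G (d_closure G D))"
proof -
  let ?C = "induced G (d_closure G D)"
  have subC: "substructure L ?C G" by (rule substructure_induced[OF d_closure_subset])
  have gG: "admissible G" using G by (rule model_admissible)
  have "extension_property ?C" unfolding extension_property_def
  proof (intro allI impI)
    fix B :: "('r, nat) lstruct" and X f
    assume B: "admissible B" "finite (univ B)" "strong_set B X" and f: "embedding L f (induced B X) ?C"
    have X: "finite X" "X \<subseteq> univ B" using B(3) by (auto simp: strong_set_def)
    have "f ` X \<subseteq> d_closure G D" using f by (simp add: embedding_def)
    then obtain Y where Y: "f ` X \<subseteq> Y" "strong_set G Y" "D \<subseteq> Y" "predim G Y = predim G D"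
      using d_closure_finite[OF D finite_imageI[OF X(1)]] by blast
    have Yf: "finite Y" "Y \<subseteq> univ G" using Y(2) by (auto simp: strong_set_def)
    have fG: "embedding L f (induced B X) G"
      using embedding_comp[OF f embedding_substructure[OF subC]] by (simp add: comp_def)
    obtain A S h where A: "admissible A" "finite (univ A)" "substructure L B A" "X \<subseteq> S" "h ` S = Y"
      and hf: "\<And>x. x \<in> X \<Longrightarrow> h x = f x" and h: "embedding L h (induced A S) G" and sS: "strong_set A S"
      by (rule amalgam_over[OF B gG fG Yf Y(1)]) (rule that)
    obtain C where C: "admissible C" "substructure L A C" "finite (univ C)" "predim C (univ C) = predim C S" "strong_set C S"
      using zero_extension[OF L, of 0] A(1,2) sS unfolding zero_extension_over_def by blast
    have SA: "S \<subseteq> univ A" using sS by (simp add: strong_set_def)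
    have "substructure L (induced C S) (induced A S)"
      using substructure_mid[OF substructure_induced substructure_trans[OF substructure_induced[OF SA] C(2)]]
        C(5) by (simp add: strong_set_def)
    then have h': "embedding L h (induced C S) G" using h by (rule embedding_restrict[rotated])
    obtain k where k: "embedding L k C G" "\<And>x. x \<in> S \<Longrightarrow> k x = h x" "Y \<subseteq> k ` univ C"
      "strong_set G (k ` univ C)" "predim G (k ` univ C) = predim G Y"
      using embed_zero_extension[OF G C(1,3,5,4) h'] Y(2) A(5) by metis
    have subBC: "substructure L B C" using A(3) C(2) by (rule substructure_trans)
    have "k ` univ C \<subseteq> d_closure G D" using Y(3,4) k(3-5) by (intro d_closure_member) auto
    then have "k ` univ B \<subseteq> univ ?C" using subBC by (auto simp: substructure_def)
    then have "embedding L k B ?C" using embedding_into[OF embedding_restrict[OF k(1) subBC] _ subC] by blast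
    moreover have "k x = f x" if "x \<in> X" for x using k(2) hf A(4) that by auto
    ultimately show "\<exists>g. embedding L g B ?C \<and> (\<forall>x\<in>X. g x = f x)" by blast
  qed
  then show ?thesis using admissible_substructure[OF gG subC] by (simp add: model_S_iff)
qed

section \<open>Embeddings, isomorphisms and the chain\<close>

lemma isomorphic_if_dominates:
  fixes M :: "('r, 'a) lstruct" and N :: "('r, 'b) lstruct"
  assumes "L \<noteq> {}" "countable_model_S L ar \<alpha> M" "countable_model_S L ar \<alpha> N"
    and "dominates N M" "dominates M N"
  shows "isomorphic L M N"
proof -
  obtain f where "embedding L f M N" "\<And>X. strong_set M X \<Longrightarrow> strong_set N (f ` X)"
    "dominates M N \<Longrightarrow> f ` univ M = univ N"
    using back_and_forth[OF assms(1-4)] by metis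
  then show ?thesis using assms(5) by (auto simp: isomorphic_def)
qed

lemma elementary_embedding_exists:
  fixes M :: "('r, 'a) lstruct" and N :: "('r, 'b) lstruct"
  assumes L: "L \<noteq> {}" and M: "countable_model_S L ar \<alpha> M" and N: "countable_model_S L ar \<alpha> N"
    and le: "dimension L \<alpha> M \<le> dimension L \<alpha> N"
  shows "\<exists>f. elementary_embedding L ar f M N"
proof -
  have M': "model_S L ar \<alpha> M" and N': "model_S L ar \<alpha> N" using M N by (auto simp: countable_model_S_def)
  have "dominates N M" using dimension_le_dominates[OF model_admissible[OF M'] model_admissible[OF N'] le] .
  then obtain f where "embedding L f M N" "\<And>X. strong_set M X \<Longrightarrow> strong_set N (f ` X)"
    using back_and_forth[OF L M N] by metis
  then show ?thesis using strong_embedding_elementary[OF L M' N'] by blast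
qed

text \<open>A free point lifts the value by \<open>c\<close>, gadgets bring it down to one unit
  above \<open>D\<close>, and \<open>G\<close> has room for a strong copy because its strong sets
  have arbitrarily large predimension.\<close>

lemma strong_tower:
  fixes G :: "('r, nat) lstruct"
  assumes L: "L \<noteq> {}" and G: "model_S L ar \<alpha> G" and unb: "\<And>k. \<exists>X. strong_set G X \<and> k \<le> predim G X"
  obtains D where "\<And>n. strong_set G (D n)" "\<And>n. predim G (D n) = int n" "\<And>n. D n \<subseteq> D (Suc n)"
proof -
  have gG: "admissible G" using G by (rule model_admissible)
  have step: "\<exists>D'. strong_set G D' \<and> predim G D' = predim G D + 1 \<and> D \<subseteq> D'" if D: "strong_set G D" for D
  proof -
    have Df: "finite D" "D \<subseteq> univ G" using D by (auto simp: strong_set_def)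
    let ?A = "induced G D"
    have subA: "substructure L ?A G" by (rule substructure_induced[OF Df(2)])
    have gA: "admissible ?A" using admissible_substructure[OF gG subA] .
    have finA: "finite (univ ?A)" using Df by simp
    obtain A1 where A1: "admissible A1" "finite (univ A1)" "substructure L ?A A1" "strong_set A1 D"
      "predim A1 (univ A1) = predim ?A D + int c" using add_point[OF gA finA] by auto
    have "predim A1 D = predim ?A D" using predim_substructure[OF A1(3), of D] by simp
    then have "predim A1 D \<le> predim A1 D + 1" "predim A1 D + 1 \<le> predim A1 (univ A1)" using A1(5) c_pos by auto
    then obtain A2 where A2: "admissible A2" "substructure L A1 A2" "finite (univ A2)"
      "predim A2 (univ A2) = predim A1 D + 1" "strong_set A2 D"
      using reduce[OF L, of 0] A1(1,2,4) unfolding reduction_def by blast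
    have DA2: "D \<subseteq> univ A2" using A2(5) by (simp add: strong_set_def)
    have "substructure L (induced A2 D) ?A"
      using substructure_mid[OF substructure_induced[OF DA2] substructure_trans[OF A1(3) A2(2)]] by simp
    then have "embedding L (\<lambda>x. x) (induced A2 D) G"
      using embedding_substructure substructure_trans[OF _ subA] by blast
    moreover obtain B0 where "strong_set G B0" "predim A2 (univ A2) \<le> predim G B0" using unb by blast
    ultimately obtain g where g: "embedding L g A2 G" "\<And>x. x \<in> D \<Longrightarrow> g x = x" "strong_set G (g ` univ A2)"
      using strong_extend[OF L G A2(1,3,5), of "\<lambda>x. x" B0] D by auto
    have "predim G (g ` univ A2) = predim G D + 1"
      using predim_embedding[OF g(1) order_refl] A2(4) \<open>predim A1 D = predim ?A D\<close> by (simp add: predim_induced)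
    moreover have "D \<subseteq> g ` univ A2" using g(2) DA2 by force
    ultimately show ?thesis using g(3) by blast
  qed
  have "\<exists>D :: nat \<Rightarrow> nat set. \<forall>n. (strong_set G (D n) \<and> predim G (D n) = int n) \<and> D n \<subseteq> D (Suc n)"
  proof (rule dependent_nat_choice)
    show "\<exists>D. strong_set G D \<and> predim G D = int 0"
      using strong_set_empty[OF gG] predim_empty gG by (auto simp: admissible_def)
    fix D n assume "strong_set G D \<and> predim G D = int n"
    then show "\<exists>D'. (strong_set G D' \<and> predim G D' = int (Suc n)) \<and> D \<subseteq> D'" using step[of D] by auto
  qed
  then show ?thesis using that by blast
qed

text \<open>\<open>C n\<close> is the d-closure of a strong set of predimension \<open>n\<close>.
  Finite subsets lie in zero-extensions of that set, so no strong set exceeds \<open>n\<close>; its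
  dimension is \<open>n / c\<close>, and these are all the finite values. Sets strong in a member
  are strong in the later ones and in \<open>G\<close>, so the inclusions are elementary.\<close>

lemma elementary_chain:
  assumes L: "L \<noteq> {}"
  obtains C :: "nat \<Rightarrow> ('r, nat) lstruct" and G where
    "\<And>n. countable_model_S L ar \<alpha> (C n)" "countable_model_S L ar \<alpha> G"
    "\<And>m n. m \<le> n \<Longrightarrow> elementary_substructure L ar (C m) (C n)"
    "\<And>n. elementary_substructure L ar (C n) G"
    "\<And>n X. strong_set (C n) X \<Longrightarrow> predim (C n) X \<le> int n" "\<And>n. \<exists>X. strong_set (C n) X \<and> predim (C n) X = int n"
    "\<And>k. \<exists>X. strong_set G X \<and> k \<le> predim G X"
proof -
  obtain G :: "('r, nat) lstruct" where G: "model_S L ar \<alpha> G" and unb: "\<And>k. \<exists>X. strong_set G X \<and> k \<le> predim G X"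
    using generic_model by blast
  obtain D where D: "\<And>n. strong_set G (D n)" "\<And>n. predim G (D n) = int n" "\<And>n. D n \<subseteq> D (Suc n)"
    using strong_tower[OF L G unb] by blast
  have D_mono: "D m \<subseteq> D n" if "m \<le> n" for m n using that D(3) by (rule lift_Suc_mono_le[rotated])
  define C where "C n = induced G (d_closure G (D n))" for n
  have U: "univ (C n) = d_closure G (D n)" for n by (simp add: C_def)
  have subG: "substructure L (C n) G" for n unfolding C_def by (rule substructure_induced[OF d_closure_subset])
  have mC: "model_S L ar \<alpha> (C n)" for n unfolding C_def by (rule model_d_closure[OF L G D(1)])
  have stG: "strong_set G X" if "strong_set (C n) X" for n X
    using strong_set_d_closure_trans[OF D(1)] that unfolding C_def by blast
  have subC: "substructure L (C m) (C n)" if "m \<le> n" for m n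
    using substructure_mid[OF subG subG] d_closure_mono[OF D(1) D(1) D_mono[OF that]] by (simp add: U)
  have stC: "strong_set (C n) X" if mn: "m \<le> n" and X: "strong_set (C m) X" for m n X
  proof (rule strong_set_substructure[OF subG stG[OF X]])
    show "X \<subseteq> univ (C n)" using X subC[OF mn] by (auto simp: strong_set_def substructure_def)
  qed
  have elC: "elementary_substructure L ar (C m) (C n)" if "m \<le> n" for m n
    unfolding elementary_substructure_def
    using subC[OF that] strong_embedding_elementary[OF L mC mC embedding_substructure[OF subC[OF that]]] stC[OF that]
    by simp
  have elG: "elementary_substructure L ar (C n) G" for n
    unfolding elementary_substructure_def
    using subG strong_embedding_elementary[OF L mC G embedding_substructure[OF subG]] stG by simp
  have DU: "D n \<subseteq> univ (C n)" for n unfolding U by (rule d_closure_member[OF D(1) order_refl refl])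
  have dlC: "predim (C n) X = predim G X" if "X \<subseteq> univ (C n)" for n X using predim_substructure[OF subG that] .
  have max: "predim (C n) X \<le> int n" if X: "strong_set (C n) X" for n X
  proof -
    have Xf: "finite X" "X \<subseteq> d_closure G (D n)" using X by (auto simp: strong_set_def U)
    obtain B where B: "X \<subseteq> B" "strong_set G B" "D n \<subseteq> B" "predim G B = predim G (D n)"
      using d_closure_finite[OF D(1) Xf] by blast
    then have "B \<subseteq> univ (C n)" "finite B" unfolding U using d_closure_member[OF B(2-4)] B(2) by (simp_all add: strong_set_def)
    then have "predim (C n) X \<le> predim (C n) B" using X B(1) by (simp add: strong_set_le)
    then show ?thesis using dlC[OF \<open>B \<subseteq> univ (C n)\<close>] B(4) D(2) by simp
  qed
  have att: "\<exists>X. strong_set (C n) X \<and> predim (C n) X = int n" for n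
    using strong_set_substructure[OF subG D(1) DU] dlC[OF DU] D(2) by auto
  show ?thesis
  proof (rule that[of C G])
    show "countable_model_S L ar \<alpha> (C n)" for n using mC by (simp add: countable_model_S_def)
    show "countable_model_S L ar \<alpha> G" using G by (simp add: countable_model_S_def)
  qed (fact elC elG max att unb)+
qed

text \<open>Predimensions are nonnegative integers, so a bounded maximum is some \<open>n\<close>,
  and then \<open>Q\<close> and \<open>C n\<close> dominate each other. In the unbounded case
  \<open>Q\<close> and \<open>G\<close> do.\<close>

lemma isomorphic_to_member:
  fixes Q :: "('r, 'a) lstruct" and C :: "nat \<Rightarrow> ('r, nat) lstruct"
  assumes L: "L \<noteq> {}" and Q: "countable_model_S L ar \<alpha> Q"
    and C: "\<And>n. countable_model_S L ar \<alpha> (C n)" and G: "countable_model_S L ar \<alpha> G"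
    and max: "\<And>n X. strong_set (C n) X \<Longrightarrow> predim (C n) X \<le> int n"
    and att: "\<And>n. \<exists>X. strong_set (C n) X \<and> predim (C n) X = int n"
    and unb: "\<And>k. \<exists>X. strong_set G X \<and> k \<le> predim G X"
  shows "(\<exists>n. isomorphic L Q (C n)) \<or> isomorphic L Q G"
proof -
  have gQ: "admissible Q" using Q by (auto simp: countable_model_S_def model_admissible)
  show ?thesis
  proof (cases "bdd_above (dim_values L \<alpha> Q)")
    case True
    obtain X where X: "strong_set Q X" "\<And>Y. strong_set Q Y \<Longrightarrow> predim Q Y \<le> predim Q X"
      using dimension_attained[OF gQ True] by metis
    define n where "n = nat (predim Q X)"
    have n: "int n = predim Q X" using gQ X(1) by (simp add: n_def admissible_def strong_set_def)
    have "dominates (C n) Q" unfolding dominates_def using att[of n] X(2) n by metis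
    moreover have "dominates Q (C n)" unfolding dominates_def using max X(1) n by metis
    ultimately show ?thesis using isomorphic_if_dominates[OF L Q C] by blast
  next
    case False
    have "dominates Q G" unfolding dominates_def using unbounded_dim_values[OF False] by metis
    moreover have "dominates G Q" unfolding dominates_def using unb by metis
    ultimately show ?thesis using isomorphic_if_dominates[OF L Q G] by blast
  qed
qed

end

subsection \<open>The empty language\<close>

text \<open>The only atoms are equations, and a bijection carries quantifier witnesses in both
  directions.\<close>

lemma sat_empty_language:
  assumes "inj_on f (univ M)" "f ` univ M = univ N"
  shows "lformula {} ar p \<Longrightarrow> range v \<subseteq> univ M \<Longrightarrow> sat M v p \<longleftrightarrow> sat N (f \<circ> v) p"
proof (induction p arbitrary: v)
  case (Eq i j)
  then have "v i \<in> univ M" "v j \<in> univ M" by auto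
  then show ?case using assms(1) by (simp add: inj_on_eq_iff)
next
  case (Exi i p)
  have "sat M (v(i := a)) p \<longleftrightarrow> sat N ((f \<circ> v)(i := f a)) p" if "a \<in> univ M" for a
  proof -
    have "range (v(i := a)) \<subseteq> univ M" using Exi.prems that by auto
    then have "sat M (v(i := a)) p \<longleftrightarrow> sat N (f \<circ> v(i := a)) p"
      using Exi.prems(1) by (intro Exi.IH) auto
    then show ?thesis unfolding fun_upd_comp .
  qed
  then show ?case unfolding sat.simps assms(2)[symmetric] by blast
qed auto

text \<open>The empty set is strong in every finite pure set, so one with more points than
  \<open>M\<close> would embed into \<open>M\<close>.\<close>

lemma (in rational_weights) infinite_model_empty_language:
  assumes L: "L = {}" and M: "model_S L ar \<alpha> M"
  shows "infinite (univ M)"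
proof
  assume fin: "finite (univ M)"
  define B :: "('r, nat) lstruct" where "B = \<lparr>univ = {..card (univ M)}, rel = \<lambda>_. {}\<rparr>"
  have "admissible B" "finite (univ B)"
    unfolding admissible_def sym_structure_def lstructure_def predim_def by (auto simp: B_def L)
  moreover have "embedding L f (induced B {}) M" for f using L by (simp add: embedding_def)
  ultimately obtain g where "embedding L g B M"
    using model_extend[OF M _ _ strong_set_empty] by metis
  then have "card (univ B) \<le> card (univ M)" using fin by (intro card_inj_on_le[of g]) (auto simp: embedding_def)
  then show False by (simp add: B_def)
qed

lemma (in rational_weights) bijection_empty_language:
  fixes M :: "('r, 'a) lstruct" and N :: "('r, 'b) lstruct"
  assumes L: "L = {}" and M: "countable_model_S L ar \<alpha> M" and N: "countable_model_S L ar \<alpha> N"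
  obtains f where "bij_betw f (univ M) (univ N)"
proof -
  have M': "infinite (univ M)" "countable (univ M)" and N': "infinite (univ N)" "countable (univ N)"
    using infinite_model_empty_language[OF L] M N by (auto simp: countable_model_S_def)
  obtain e :: "'a \<Rightarrow> nat" where e: "bij_betw e (univ M) UNIV" using countableE_infinite[OF M'(2,1)] .
  obtain e' :: "'b \<Rightarrow> nat" where "bij_betw e' (univ N) UNIV" using countableE_infinite[OF N'(2,1)] .
  then have "bij_betw (inv_into (univ N) e' \<circ> e) (univ M) (univ N)"
    using e bij_betw_trans bij_betw_inv_into by blast
  then show ?thesis by (rule that)
qed

lemma (in rational_weights) isomorphic_empty_language:
  fixes M :: "('r, 'a) lstruct" and N :: "('r, 'b) lstruct"
  assumes "L = {}" "countable_model_S L ar \<alpha> M" "countable_model_S L ar \<alpha> N"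
  shows "isomorphic L M N"
  using bijection_empty_language[OF assms] assms(1)
  by (metis (no_types, lifting) isomorphic_def embedding_def bij_betw_def empty_iff order_refl)

lemma (in rational_weights) elementary_embedding_empty_language:
  fixes M :: "('r, 'a) lstruct" and N :: "('r, 'b) lstruct"
  assumes "L = {}" "countable_model_S L ar \<alpha> M" "countable_model_S L ar \<alpha> N"
  shows "\<exists>f. elementary_embedding L ar f M N"
proof -
  obtain f where "bij_betw f (univ M) (univ N)" using bijection_empty_language[OF assms] .
  then have "elementary_embedding L ar f M N"
    using sat_empty_language[of f M N ar] assms(1) by (auto simp: elementary_embedding_def bij_betw_def)
  then show ?thesis by blast
qed

subsection \<open>A common denominator\<close>

text \<open>The least positive element of the ideal generated by \<open>c\<close> and the numerators
  divides all generators, so it is 1. Negative coefficients are repaired by adding a multiple of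
  \<open>c\<close> to each of them, which only changes the multiple of \<open>c\<close> in the
  identity.\<close>

lemma unit_combination_exists:
  fixes P :: "'r \<Rightarrow> nat"
  assumes L: "finite L" "L \<noteq> {}" and c: "0 < c" and P: "\<And>E. E \<in> L \<Longrightarrow> 0 < P E"
    and coprime: "\<And>g. g dvd c \<Longrightarrow> (\<And>E. E \<in> L \<Longrightarrow> g dvd P E) \<Longrightarrow> g = 1"
  shows "\<exists>n>m. \<exists>es. set es \<subseteq> L \<and> sum_list (map P es) = 1 + n * c"
proof -
  define I where "I = {x :: int. \<exists>k n. x = (\<Sum>E\<in>L. k E * int (P E)) + n * int c}"
  have I_diff: "x - q * y \<in> I" if x: "x \<in> I" and y: "y \<in> I" for x y q
  proof -
    obtain k n where "x = (\<Sum>E\<in>L. k E * int (P E)) + n * int c" using x unfolding I_def by blast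
    moreover obtain k' n' where "y = (\<Sum>E\<in>L. k' E * int (P E)) + n' * int c"
      using y unfolding I_def by blast
    ultimately have "x - q * y = (\<Sum>E\<in>L. (k E - q * k' E) * int (P E)) + (n - q * n') * int c"
      by (simp add: algebra_simps sum_subtractf sum_distrib_left)
    then show ?thesis unfolding I_def by (intro CollectI exI)
  qed
  have cI: "int c \<in> I" unfolding I_def by (intro CollectI exI[of _ "\<lambda>_. 0"] exI[of _ 1]) simp
  have PI: "int (P E) \<in> I" if E: "E \<in> L" for E
    unfolding I_def
    by (intro CollectI exI[of _ "\<lambda>F. if F = E then 1 else 0"] exI[of _ 0])
      (simp add: L(1) E if_distrib[of "\<lambda>x. x * _"] sum.delta cong: if_cong)
  define g where "g = (LEAST d. 0 < d \<and> int d \<in> I)"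
  have g: "0 < g" "int g \<in> I" using LeastI[of "\<lambda>d. 0 < d \<and> int d \<in> I" c] c cI by (auto simp: g_def)
  have dvd: "g dvd x" if "int x \<in> I" for x
  proof (rule ccontr)
    assume "\<not> g dvd x"
    then have "0 < x mod g" by (simp add: dvd_eq_mod_eq_0)
    moreover have "int x - int (x div g) * int g = int (x mod g)"
      by (metis minus_div_mult_eq_mod of_nat_diff of_nat_mult div_times_less_eq_dividend)
    then have "int (x mod g) \<in> I" using I_diff[OF that g(2), of "int (x div g)"] by simp
    ultimately have "g \<le> x mod g" unfolding g_def by (intro Least_le) simp
    then show False using g(1) by (simp add: mod_less_divisor not_less[symmetric] del: not_less)
  qed
  have "g = 1" using coprime dvd cI PI by blast
  then obtain k n where kn: "1 = (\<Sum>E\<in>L. k E * int (P E)) + n * int c" using g(2) unfolding I_def by auto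
  \<comment> \<open>Exceeds every coefficient in absolute value, so the shifted ones are
    nonnegative, and also \<open>n + int m\<close>, so that the resulting multiple of
    \<open>c\<close> exceeds \<open>m\<close>.\<close>
  define t where "t = (\<Sum>E\<in>L. \<bar>k E\<bar>) + \<bar>n\<bar> + int m + 1"
  have t: "\<bar>k E\<bar> \<le> t" if "E \<in> L" for E
  proof -
    have "\<bar>k E\<bar> \<le> (\<Sum>E\<in>L. \<bar>k E\<bar>)" using that L(1) by (intro member_le_sum) auto
    then show ?thesis by (simp add: t_def)
  qed
  have t_pos: "0 \<le> t" using L by (auto simp: t_def intro!: add_nonneg_nonneg sum_nonneg)
  define K where "K E = nat (k E + int c * t)" for E
  have K: "int (K E) = k E + int c * t" if "E \<in> L" for E
  proof -
    have "1 * t \<le> int c * t" using c t_pos by (intro mult_right_mono) auto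
    then show ?thesis using t[OF that] by (simp add: K_def)
  qed
  let ?s = "\<Sum>E\<in>L. int (P E)"
  have s1: "1 \<le> ?s"
  proof -
    obtain E where E: "E \<in> L" using L(2) by blast
    then have "int (P E) \<le> ?s" using L(1) by (intro member_le_sum) auto
    then show ?thesis using P[OF E] by linarith
  qed
  have "1 * t \<le> ?s * t" using s1 t_pos by (intro mult_right_mono)
  moreover have "0 \<le> (\<Sum>E\<in>L. \<bar>k E\<bar>)" by (intro sum_nonneg) simp
  then have "n + int m < t" unfolding t_def by linarith
  ultimately have big: "int m < t * ?s - n" by (simp add: mult.commute)
  have "int (\<Sum>E\<in>L. K E * P E) = (\<Sum>E\<in>L. (k E + int c * t) * int (P E))" by (simp add: K)
  also have "\<dots> = (\<Sum>E\<in>L. k E * int (P E)) + int c * (t * ?s)"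
    by (simp add: distrib_right sum.distrib sum_distrib_left mult.assoc)
  also have "\<dots> = 1 + (t * ?s - n) * int c" using kn by (simp add: algebra_simps)
  also have "\<dots> = int (1 + nat (t * ?s - n) * c)" using big by simp
  finally have sum: "(\<Sum>E\<in>L. K E * P E) = 1 + nat (t * ?s - n) * c" by (simp only: of_nat_eq_iff)
  obtain Ls where Ls: "set Ls = L" "distinct Ls" using finite_distinct_list[OF L(1)] by blast
  define es where "es = concat (map (\<lambda>E. replicate (K E) E) Ls)"
  have "sum_list (map P (concat (map (\<lambda>E. replicate (K E) E) xs))) = sum_list (map (\<lambda>E. K E * P E) xs)" for xs
    by (induction xs) (auto simp: sum_list_replicate)
  then have "sum_list (map P es) = (\<Sum>E\<in>L. K E * P E)"
    using Ls by (simp add: es_def sum_list_distinct_conv_sum_set)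
  moreover have "set es \<subseteq> L" using Ls by (auto simp: es_def)
  ultimately show ?thesis using sum big by (intro exI[of _ "nat (t * ?s - n)"]) auto
qed

text \<open>The least common denominator is taken: a divisor shared by it and all numerators could
  be cancelled, so minimality amounts to the coprimality behind the Bezout identity.\<close>

lemma rational_weights_exists:
  fixes L :: "'r set" and ar :: "'r \<Rightarrow> nat" and \<alpha> :: "'r \<Rightarrow> real"
  assumes L: "finite L" and ar: "\<forall>E\<in>L. ar E \<ge> 2" and \<alpha>: "\<forall>E\<in>L. \<alpha> E \<in> {0<..<1} \<inter> \<rat>"
  obtains c P where "rational_weights L ar \<alpha> c P"
proof -
  let ?D = "\<lambda>c :: nat. 0 < c \<and> (\<forall>E\<in>L. \<exists>p :: nat. \<alpha> E = real p / real c)"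
  have "\<exists>c. ?D c"
    using L \<alpha>
  proof (induction L)
    case empty
    then show ?case by (intro exI[of _ 1]) simp
  next
    case (insert F L)
    then obtain c where c: "0 < c" "\<forall>E\<in>L. \<exists>p :: nat. \<alpha> E = real p / real c" by auto
    obtain a b :: nat where ab: "b \<noteq> 0" "\<alpha> F = real a / real b"
      using insert.prems Rats_abs_nat_div_natE[of "\<alpha> F"] by (metis Int_iff abs_of_pos greaterThanLessThan_iff insertI1)
    show ?case
    proof (rule exI[of _ "c * b"], intro conjI ballI)
      show "0 < c * b" using c ab by simp
      fix E assume "E \<in> insert F L"
      then consider "E = F" | p where "\<alpha> E = real p / real c" using c(2) by auto
      then show "\<exists>p :: nat. \<alpha> E = real p / real (c * b)"
      proof cases
        case 1 then show ?thesis using ab c(1) by (intro exI[of _ "a * c"]) simp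
      next
        case 2 then show ?thesis using ab(1) by (intro exI[of _ "p * b"]) simp
      qed
    qed
  qed
  define c where "c = (LEAST c. ?D c)"
  have c: "?D c" unfolding c_def using \<open>\<exists>c. ?D c\<close> by (rule LeastI_ex)
  have c_min: "c \<le> d" if "?D d" for d unfolding c_def using that by (rule Least_le)
  obtain P where P: "\<And>E. E \<in> L \<Longrightarrow> \<alpha> E = real (P E) / real c" using c by metis
  have P_bounds: "0 < P E" "P E < c" if E: "E \<in> L" for E
    using \<alpha> P[OF E] E c by (auto simp: zero_less_divide_iff divide_less_eq)
  have coprime: "g = 1" if g: "g dvd c" "\<And>E. E \<in> L \<Longrightarrow> g dvd P E" for g
  proof -
    obtain d where d: "c = g * d" using g(1) by blast
    then have pos: "0 < g" "0 < d" using c by auto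
    have "\<exists>p :: nat. \<alpha> E = real p / real d" if E: "E \<in> L" for E
    proof -
      obtain p where "P E = g * p" using g(2)[OF E] by blast
      then show ?thesis using P[OF E] d pos by (intro exI[of _ p]) simp
    qed
    then have "c \<le> d" using pos by (intro c_min) simp
    then show ?thesis using d pos by (metis One_nat_def Suc_lessI mult_le_cancel2 nat_mult_1 not_le)
  qed
  have "rational_weights L ar \<alpha> c P"
  proof
    show "finite L" by (rule L)
    show "0 < c" using c by simp
    fix E assume "E \<in> L"
    then show "2 \<le> ar E" "\<alpha> E = real (P E) / real c" "0 < P E" "P E < c" using ar P P_bounds by auto
  next
    fix m assume ne: "L \<noteq> {}"
    have c_pos: "0 < c" using c by simp
    show "\<exists>n>m. \<exists>es. set es \<subseteq> L \<and> sum_list (map P es) = 1 + n * c"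
      by (rule unit_combination_exists[OF L ne c_pos P_bounds(1) coprime])
  qed
  then show ?thesis by (rule that)
qed

theorem theorem4p8:
  fixes L :: "'r set" and ar :: "'r \<Rightarrow> nat" and \<alpha> :: "'r \<Rightarrow> real"
  assumes "finite L"
    and "\<forall>E\<in>L. ar E \<ge> 2"
    and "\<forall>E\<in>L. \<alpha> E \<in> {0<..<1} \<inter> \<rat>"
  shows "(\<forall>(M :: ('r, 'a) lstruct) (N :: ('r, 'b) lstruct).
            countable_model_S L ar \<alpha> M \<and> countable_model_S L ar \<alpha> N \<and>
            dimension L \<alpha> M \<le> dimension L \<alpha> N \<longrightarrow>
            (\<exists>f. elementary_embedding L ar f M N)) \<and>
         (\<exists>(C :: nat \<Rightarrow> ('r, nat) lstruct) (C\<omega> :: ('r, nat) lstruct).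
            (\<forall>n. countable_model_S L ar \<alpha> (C n)) \<and> countable_model_S L ar \<alpha> C\<omega> \<and>
            (\<forall>m n. m \<le> n \<longrightarrow> elementary_substructure L ar (C m) (C n)) \<and>
            (\<forall>n. elementary_substructure L ar (C n) C\<omega>) \<and>
            (\<forall>P :: ('r, nat) lstruct. countable_model_S L ar \<alpha> P \<longrightarrow>
               (\<exists>n. isomorphic L P (C n)) \<or> isomorphic L P C\<omega>) \<and>
            (\<forall>P :: ('r, 'a) lstruct. countable_model_S L ar \<alpha> P \<longrightarrow>
               (\<exists>n. isomorphic L P (C n)) \<or> isomorphic L P C\<omega>))"
proof -
  obtain c P where "rational_weights L ar \<alpha> c P" using rational_weights_exists[OF assms] .
  then interpret rational_weights L ar \<alpha> c P .
  show ?thesis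
  proof (cases "L = {}")
    case True
    \<comment> \<open>All countable models are isomorphic here, so a constant chain
      suffices.\<close>
    obtain G :: "('r, nat) lstruct" where "model_S L ar \<alpha> G" using generic_model by blast
    then have G: "countable_model_S L ar \<alpha> G" by (simp add: countable_model_S_def)
    have "elementary_substructure L ar G G"
      using True by (simp add: elementary_substructure_def substructure_def elementary_embedding_def comp_def)
    moreover have "isomorphic L Q G" if "countable_model_S L ar \<alpha> Q" for Q :: "('r, nat) lstruct"
      by (rule isomorphic_empty_language[OF True that G])
    moreover have "isomorphic L Q G" if "countable_model_S L ar \<alpha> Q" for Q :: "('r, 'a) lstruct"
      by (rule isomorphic_empty_language[OF True that G])
    moreover have "\<exists>f. elementary_embedding L ar f M N"
      if "countable_model_S L ar \<alpha> M" "countable_model_S L ar \<alpha> N"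
      for M :: "('r, 'a) lstruct" and N :: "('r, 'b) lstruct"
      by (rule elementary_embedding_empty_language[OF True that])
    ultimately show ?thesis using G by (intro conjI exI[of _ "\<lambda>_. G"] exI[of _ G] allI impI) auto
  next
    case False
    obtain C :: "nat \<Rightarrow> ('r, nat) lstruct" and G where
      C: "\<And>n. countable_model_S L ar \<alpha> (C n)" and G: "countable_model_S L ar \<alpha> G"
      and el: "\<And>m n. m \<le> n \<Longrightarrow> elementary_substructure L ar (C m) (C n)"
        "\<And>n. elementary_substructure L ar (C n) G"
      and dims: "\<And>n X. strong_set (C n) X \<Longrightarrow> predim (C n) X \<le> int n" "\<And>n. \<exists>X. strong_set (C n) X \<and> predim (C n) X = int n"
        "\<And>k. \<exists>X. strong_set G X \<and> k \<le> predim G X"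
      by (rule elementary_chain[OF False]) (rule that)
    \<comment> \<open>One lemma at two universe types: the chain lives on natural numbers, while the
      models compared with it may also have points of type \<open>'a\<close>.\<close>
    have iso_nat: "(\<exists>n. isomorphic L Q (C n)) \<or> isomorphic L Q G" if "countable_model_S L ar \<alpha> Q"
      for Q :: "('r, nat) lstruct"
      by (rule isomorphic_to_member[OF False that C G dims])
    have iso_a: "(\<exists>n. isomorphic L Q (C n)) \<or> isomorphic L Q G" if "countable_model_S L ar \<alpha> Q"
      for Q :: "('r, 'a) lstruct"
      by (rule isomorphic_to_member[OF False that C G dims])
    show ?thesis
    proof (intro conjI exI[of _ C] exI[of _ G] allI impI)
      fix M :: "('r, 'a) lstruct" and N :: "('r, 'b) lstruct"
      assume "countable_model_S L ar \<alpha> M \<and> countable_model_S L ar \<alpha> N \<and> dimension L \<alpha> M \<le> dimension L \<alpha> N"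
      then show "\<exists>f. elementary_embedding L ar f M N" using elementary_embedding_exists[OF False] by blast
    qed (use C G el iso_nat iso_a in blast)+
  qed
qed

end
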